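(* Let $n\ge1$ and let $q:\mathbb R^{2n}\to\mathbb C$ be a complex-valued quadratic form with nonnegative real part $\operatorname{Re} q\ge0$, and let $S$ be the singular space of $q$. If there exist $t>0$ and $X_0\in\mathbb R^{2n}$ such that the linear operator $\langle X_0,X\rangle^we^{-tq^w}$ is bounded on $L^2(\mathbb R^n)$, then $X_0\in S^\perp$.
   Context: Let $Q\in S_{2n}(\mathbb C)$ be the symmetric matrix of $q$ ($q(X)=X^TQX$) and $J=\begin{pmatrix}0_n&I_n\\-I_n&0_n\end{pmatrix}$. The Hamilton map is $F=JQ$, with entrywise real and imaginary parts $\operatorname{Re}F,\operatorname{Im}F$. The singular space is $S=\bigcap_{j=0}^{+\infty}\ker(\operatorname{Re}F(\operatorname{Im}F)^j)\cap\mathbb R^{2n}$, and $S^\perp$ is its orthogonal complement for the canonical Euclidean structure of $\mathbb R^{2n}$. For $X_0=(x_0,\xi_0)\in\mathbb R^{2n}$, $\langle X_0,X\rangle^w=\langle x_0,x\rangle+\langle\xi_0,D_x\rangle$ with $D_x=-i\nabla_x$ (acting on $\mathscr S'(\mathbb R^n)$). The operator $q^w$ is $\begin{pmatrix}x&-i\nabla\end{pmatrix}Q\begin{pmatrix}x\\-i\nabla\end{pmatrix}$ on $L^2(\mathbb R^n)$ with domain $\{u\in L^2:q^wu\in L^2\}$; since $\operatorname{Re}q\ge0$ it is maximal accretive, and $(e^{-tq^w})_{t\ge0}$ is the contraction semigroup on $L^2(\mathbb R^n)$ with generator $-q^w$. *)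

theory Defs
  imports "HOL-Analysis.Analysis"
begin

section \<open>Quadratic forms on phase space and their singular space\<close>

text \<open>
  Phase space $R^{2n}$ is \<open>real^('n+'n)\<close>: the coordinates \<open>X $ Inl j\<close> are the positions
  $x_j$ and the coordinates \<open>X $ Inr j\<close> are the momenta $\xi_j$.
\<close>

definition is_quadratic_form_matrix :: "complex^'m^'m \<Rightarrow> (real^'m \<Rightarrow> complex) \<Rightarrow> bool" where
  "is_quadratic_form_matrix Q q \<longleftrightarrow>
     transpose Q = Q \<and>
     (\<forall>X. q X = (\<Sum>a\<in>UNIV. \<Sum>b\<in>UNIV. Q $ a $ b * of_real (X $ a) * of_real (X $ b)))"

definition symplectic_J :: "complex^('n::finite + 'n)^('n + 'n)" where
  "symplectic_J = (\<chi> a b. case (a, b) of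
       (Inl i, Inr j) \<Rightarrow> if i = j then 1 else 0
     | (Inr i, Inl j) \<Rightarrow> if i = j then - 1 else 0
     | _ \<Rightarrow> 0)"

definition hamilton_map :: "complex^('n::finite + 'n)^('n + 'n) \<Rightarrow> complex^('n + 'n)^('n + 'n)" where
  "hamilton_map Q = symplectic_J ** Q"

definition Re_mat :: "complex^'m^'m \<Rightarrow> real^'m^'m" where
  "Re_mat A = (\<chi> a b. Re (A $ a $ b))"

definition Im_mat :: "complex^'m^'m \<Rightarrow> real^'m^'m" where
  "Im_mat A = (\<chi> a b. Im (A $ a $ b))"

definition singular_space :: "complex^('n::finite + 'n)^('n + 'n) \<Rightarrow> (real^('n + 'n)) set" where
  "singular_space Q =
     (\<Inter>j. {X. Re_mat (hamilton_map Q) *v ((((*v) (Im_mat (hamilton_map Q))) ^^ j) X) = 0})"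

section \<open>The space $L^2$\<close>

definition sq_integrable :: "('a::euclidean_space \<Rightarrow> complex) \<Rightarrow> bool" where
  "sq_integrable f \<longleftrightarrow>
     f \<in> borel_measurable lborel \<and> integrable lborel (\<lambda>x. (norm (f x))\<^sup>2)"

lemma sq_integrable_zero: "sq_integrable (\<lambda>_. 0)"
  by (simp add: sq_integrable_def)

lemma sq_integrable_scale:
  assumes "sq_integrable f"
  shows "sq_integrable (\<lambda>x. c * f x)"
  using assms by (auto simp: sq_integrable_def norm_mult power_mult_distrib)

lemma sq_integrable_add:
  assumes "sq_integrable f" "sq_integrable g"
  shows "sq_integrable (\<lambda>x. f x + g x)"
  unfolding sq_integrable_def
proof
  have m [measurable]: "f \<in> borel_measurable lborel" "g \<in> borel_measurable lborel"
    using assms by (auto simp: sq_integrable_def)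
  show "(\<lambda>x. f x + g x) \<in> borel_measurable lborel"
    by measurable
  have *: "(norm (a + b))\<^sup>2 \<le> 2 * (norm a)\<^sup>2 + 2 * (norm b)\<^sup>2" for a b :: complex
  proof -
    have "(norm (a + b))\<^sup>2 \<le> (norm a + norm b)\<^sup>2"
      by (intro power_mono norm_triangle_ineq) auto
    also have "\<dots> \<le> 2 * (norm a)\<^sup>2 + 2 * (norm b)\<^sup>2"
      using sum_squares_bound[of "norm a" "norm b"] by (simp add: power2_sum)
    finally show ?thesis .
  qed
  show "integrable lborel (\<lambda>x. (norm (f x + g x))\<^sup>2)"
  proof (rule Bochner_Integration.integrable_bound)
    show "integrable lborel (\<lambda>x. 2 * (norm (f x))\<^sup>2 + 2 * (norm (g x))\<^sup>2)"
      using assms by (auto simp: sq_integrable_def)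
  qed (use * in auto)
qed

lemma integrable_mult_cnj:
  assumes "sq_integrable f" "sq_integrable g"
  shows "integrable lborel (\<lambda>x. f x * cnj (g x))"
proof (rule Bochner_Integration.integrable_bound)
  have m [measurable]: "f \<in> borel_measurable lborel" "g \<in> borel_measurable lborel"
    using assms by (auto simp: sq_integrable_def)
  show "integrable lborel (\<lambda>x. (norm (f x))\<^sup>2 + (norm (g x))\<^sup>2)"
    using assms by (auto simp: sq_integrable_def)
  have "(\<lambda>x. cnj (g x)) \<in> borel_measurable lborel"
    by (rule measurable_compose[OF m(2)]) (intro borel_measurable_continuous_onI continuous_intros)
  then show "(\<lambda>x. f x * cnj (g x)) \<in> borel_measurable lborel"
    by measurable
  have "norm a * norm b \<le> (norm a)\<^sup>2 + (norm b)\<^sup>2" for a b :: complex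
  proof -
    have "0 \<le> norm a * norm b" by simp
    moreover have "2 * (norm a * norm b) \<le> (norm a)\<^sup>2 + (norm b)\<^sup>2"
      using sum_squares_bound[of "norm a" "norm b"] by (simp add: mult.assoc)
    ultimately show ?thesis by linarith
  qed
  then show "AE x in lborel. norm (f x * cnj (g x)) \<le> norm ((norm (f x))\<^sup>2 + (norm (g x))\<^sup>2)"
    by (simp add: norm_mult)
qed

lemma measurable_mult_cnj:
  assumes "sq_integrable f" "sq_integrable g"
  shows "(\<lambda>x. f x * cnj (g x)) \<in> borel_measurable lborel"
  using integrable_mult_cnj[OF assms] by (rule borel_measurable_integrable)

definition L2_eq :: "('a::euclidean_space \<Rightarrow> complex) \<Rightarrow> ('a \<Rightarrow> complex) \<Rightarrow> bool" where
  "L2_eq f g \<longleftrightarrow> sq_integrable f \<and> sq_integrable g \<and> (AE x in lborel. f x = g x)"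

lemma part_equivp_L2_eq: "part_equivp L2_eq"
proof (rule part_equivpI)
  show "\<exists>f. L2_eq f f"
    using sq_integrable_zero by (auto simp: L2_eq_def)
  show "symp L2_eq"
    by (auto simp: symp_def L2_eq_def)
  show "transp L2_eq"
    by (auto simp: transp_def L2_eq_def)
qed

quotient_type (overloaded) 'a L2 = "'a::euclidean_space \<Rightarrow> complex" / partial: L2_eq
  by (rule part_equivp_L2_eq)

instantiation L2 :: (euclidean_space) real_inner
begin

lift_definition zero_L2 :: "'a L2" is "\<lambda>_. 0"
  by (simp add: L2_eq_def sq_integrable_zero)

lift_definition plus_L2 :: "'a L2 \<Rightarrow> 'a L2 \<Rightarrow> 'a L2" is "\<lambda>f g x. f x + g x"
  by (auto simp: L2_eq_def sq_integrable_add)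

lift_definition uminus_L2 :: "'a L2 \<Rightarrow> 'a L2" is "\<lambda>f x. - f x"
  using sq_integrable_scale[of _ "- 1"] by (auto simp: L2_eq_def)

definition minus_L2 :: "'a L2 \<Rightarrow> 'a L2 \<Rightarrow> 'a L2" where
  "minus_L2 u v = u + - v"

lift_definition scaleR_L2 :: "real \<Rightarrow> 'a L2 \<Rightarrow> 'a L2" is "\<lambda>r f x. of_real r * f x"
  by (auto simp: L2_eq_def sq_integrable_scale)

lift_definition inner_L2 :: "'a L2 \<Rightarrow> 'a L2 \<Rightarrow> real" is
  "\<lambda>f g. Re (LINT x|lborel. f x * cnj (g x))"
proof -
  fix f f' g g' :: "'a \<Rightarrow> complex"
  assume "L2_eq f f'" "L2_eq g g'"
  then show "Re (LINT x|lborel. f x * cnj (g x)) = Re (LINT x|lborel. f' x * cnj (g' x))"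
    by (intro arg_cong[where f = Re] integral_cong_AE measurable_mult_cnj)
       (auto simp: L2_eq_def)
qed

lift_definition norm_L2 :: "'a L2 \<Rightarrow> real" is
  "\<lambda>f. sqrt (LINT x|lborel. (norm (f x))\<^sup>2)"
proof -
  fix f f' :: "'a \<Rightarrow> complex"
  assume "L2_eq f f'"
  then show "sqrt (LINT x|lborel. (norm (f x))\<^sup>2) = sqrt (LINT x|lborel. (norm (f' x))\<^sup>2)"
    by (intro arg_cong[where f = sqrt] integral_cong_AE)
       (auto simp: L2_eq_def sq_integrable_def)
qed

definition dist_L2 :: "'a L2 \<Rightarrow> 'a L2 \<Rightarrow> real" where
  "dist_L2 u v = norm (u - v)"

definition sgn_L2 :: "'a L2 \<Rightarrow> 'a L2" where
  "sgn_L2 u = inverse (norm u) *\<^sub>R u"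

definition uniformity_L2 :: "('a L2 \<times> 'a L2) filter" where
  "uniformity_L2 = (INF e\<in>{0<..}. principal {(u, v). dist u v < e})"

definition open_L2 :: "'a L2 set \<Rightarrow> bool" where
  "open_L2 U \<longleftrightarrow> (\<forall>u\<in>U. eventually (\<lambda>(u', v). u' = u \<longrightarrow> v \<in> U) uniformity)"

instance
proof
  fix u v w :: "'a L2" and r s :: real
  show "u + v + w = u + (v + w)"
    by transfer (auto simp: L2_eq_def sq_integrable_add add.assoc)
  show "u + v = v + u"
    by transfer (auto simp: L2_eq_def sq_integrable_add add.commute)
  show "0 + u = u"
    by transfer (auto simp: L2_eq_def)
  show "- u + u = 0"
    by transfer (auto simp: L2_eq_def sq_integrable_zero)
  show "u - v = u + - v"
    by (rule minus_L2_def)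
  show "r *\<^sub>R (u + v) = r *\<^sub>R u + r *\<^sub>R v"
    by transfer (auto simp: L2_eq_def distrib_left distrib_right intro!: sq_integrable_add sq_integrable_scale)
  show "(r + s) *\<^sub>R u = r *\<^sub>R u + s *\<^sub>R u"
    by transfer (auto simp: L2_eq_def distrib_left distrib_right intro!: sq_integrable_add sq_integrable_scale)
  show "r *\<^sub>R s *\<^sub>R u = (r * s) *\<^sub>R u"
    by transfer (auto simp: L2_eq_def mult.assoc intro!: sq_integrable_scale)
  show "1 *\<^sub>R u = u"
    by transfer (auto simp: L2_eq_def)
  show "dist u v = norm (u - v)"
    by (rule dist_L2_def)
  show "sgn u = inverse (norm u) *\<^sub>R u"
    by (rule sgn_L2_def)
  show "(uniformity :: ('a L2 \<times> 'a L2) filter) = (INF e\<in>{0<..}. principal {(u, v). dist u v < e})"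
    by (rule uniformity_L2_def)
  show "open U \<longleftrightarrow> (\<forall>u\<in>U. eventually (\<lambda>(u', v). u' = u \<longrightarrow> v \<in> U) uniformity)" for U :: "'a L2 set"
    by (rule open_L2_def)
  show "inner u v = inner v u"
  proof transfer
    fix f g :: "'a \<Rightarrow> complex"
    have "(LINT x|lborel. g x * cnj (f x)) = (LINT x|lborel. cnj (f x * cnj (g x)))"
      by (simp add: mult.commute)
    also have "\<dots> = cnj (LINT x|lborel. f x * cnj (g x))"
      by (rule Bochner_Integration.integral_cnj)
    finally show "Re (LINT x|lborel. f x * cnj (g x)) = Re (LINT x|lborel. g x * cnj (f x))"
      by simp
  qed
  show "inner (u + v) w = inner u w + inner v w"
    by transfer (simp add: L2_eq_def distrib_right integrable_mult_cnj)
  show "inner (r *\<^sub>R u) v = r * inner u v"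
    by transfer (simp add: mult.assoc)
  have Re_integral: "Re (LINT x|lborel. f x * cnj (f x)) = (LINT x|lborel. (norm (f x))\<^sup>2)"
    for f :: "'a \<Rightarrow> complex"
  proof -
    have "(LINT x|lborel. f x * cnj (f x)) = (LINT x|lborel. complex_of_real ((norm (f x))\<^sup>2))"
      by (simp only: complex_norm_square)
    also have "\<dots> = complex_of_real (LINT x|lborel. (norm (f x))\<^sup>2)"
      by (rule integral_complex_of_real)
    finally show ?thesis by simp
  qed
  show "0 \<le> inner u u"
    by transfer (simp add: Re_integral)
  show "inner u u = 0 \<longleftrightarrow> u = 0"
  proof transfer
    fix f :: "'a \<Rightarrow> complex"
    assume "L2_eq f f"
    then have f: "sq_integrable f" by (simp add: L2_eq_def)
    have "(LINT x|lborel. (norm (f x))\<^sup>2) = 0 \<longleftrightarrow> (AE x in lborel. (norm (f x))\<^sup>2 = 0)"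
      using f by (intro integral_nonneg_eq_0_iff_AE) (auto simp: sq_integrable_def)
    then show "Re (LINT x|lborel. f x * cnj (f x)) = 0 \<longleftrightarrow> L2_eq f (\<lambda>_. 0)"
      using f by (simp add: Re_integral L2_eq_def sq_integrable_zero)
  qed
  show "norm u = sqrt (inner u u)"
    by transfer (simp add: Re_integral)
qed

end

lift_definition cscale :: "complex \<Rightarrow> 'a::euclidean_space L2 \<Rightarrow> 'a L2" is "\<lambda>c f x. c * f x"
  by (auto simp: L2_eq_def sq_integrable_scale)

section \<open>Schwartz functions and distributions\<close>

definition partial_deriv :: "'n::finite \<Rightarrow> (real^'n \<Rightarrow> complex) \<Rightarrow> real^'n \<Rightarrow> complex" where
  "partial_deriv j \<phi> = (\<lambda>x. frechet_derivative \<phi> (at x) (axis j 1))"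

text \<open>
  In the following definition, the list \<open>js\<close> ranges over all finite sequences of coordinate
  indices, so that \<open>foldr partial_deriv js\<close> is an arbitrary iterated partial derivative. Total
  differentiability of all of them amounts to $C^\infty$ smoothness.
\<close>

definition schwartz :: "(real^'n \<Rightarrow> complex) \<Rightarrow> bool" where
  "schwartz \<phi> \<longleftrightarrow>
     (\<forall>js. (\<forall>x. foldr partial_deriv js \<phi> differentiable at x) \<and>
           (\<forall>k::nat. bounded (range (\<lambda>x. (1 + norm x) ^ k *\<^sub>R foldr partial_deriv js \<phi> x))))"

text \<open>
  A tempered distribution is represented by its values on test functions; only the values on
  Schwartz functions matter, and \<open>distr_eq\<close> is equality of distributions. All the
  functionals considered below are obtained from \<open>L2_distr u\<close>, hence are continuous on the
  Schwartz space.
\<close>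

type_synonym 'n distr = "(real^'n \<Rightarrow> complex) \<Rightarrow> complex"

definition distr_eq :: "'n::finite distr \<Rightarrow> 'n distr \<Rightarrow> bool" where
  "distr_eq U V \<longleftrightarrow> (\<forall>\<phi>. schwartz \<phi> \<longrightarrow> U \<phi> = V \<phi>)"

definition L2_distr :: "(real^'n) L2 \<Rightarrow> 'n::finite distr" where
  "L2_distr u = (\<lambda>\<phi>. LINT x|lborel. rep_L2 u x * \<phi> x)"

text \<open>
  \<open>phase_op (Inl j)\<close> is multiplication by $x_j$ and \<open>phase_op (Inr j)\<close> is
  $D_{x_j} = -i \partial_{x_j}$, acting on distributions by duality; the sign in
  $\langle \partial_j U, \phi\rangle = - \langle U, \partial_j \phi\rangle$ turns $-i$ into $i$.
\<close>

fun phase_op :: "'n::finite + 'n \<Rightarrow> 'n distr \<Rightarrow> 'n distr" where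
  "phase_op (Inl j) U = (\<lambda>\<phi>. U (\<lambda>x. of_real (x $ j) * \<phi> x))"
| "phase_op (Inr j) U = (\<lambda>\<phi>. \<i> * U (partial_deriv j \<phi>))"

definition linear_weyl :: "real^('n + 'n) \<Rightarrow> 'n::finite distr \<Rightarrow> 'n distr" where
  "linear_weyl X0 U = (\<lambda>\<phi>. \<Sum>a\<in>UNIV. of_real (X0 $ a) * phase_op a U \<phi>)"

definition quadratic_weyl :: "complex^('n + 'n)^('n + 'n) \<Rightarrow> 'n::finite distr \<Rightarrow> 'n distr" where
  "quadratic_weyl Q U =
     (\<lambda>\<phi>. \<Sum>a\<in>UNIV. \<Sum>b\<in>UNIV. Q $ a $ b * phase_op a (phase_op b U) \<phi>)"

section \<open>The operator $q^w$ on $L^2$ and semigroups\<close>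

text \<open>Unbounded operators on $L^2$ are given by their graphs.\<close>

definition quadratic_weyl_graph ::
    "complex^('n::finite + 'n)^('n + 'n) \<Rightarrow> ((real^'n) L2 \<times> (real^'n) L2) set" where
  "quadratic_weyl_graph Q = {(u, v). distr_eq (quadratic_weyl Q (L2_distr u)) (L2_distr v)}"

definition contraction_semigroup :: "(real \<Rightarrow> 'a::euclidean_space L2 \<Rightarrow> 'a L2) \<Rightarrow> bool" where
  "contraction_semigroup T \<longleftrightarrow>
     (\<forall>t\<ge>0. (\<forall>u v. T t (u + v) = T t u + T t v) \<and>
             (\<forall>c u. T t (cscale c u) = cscale c (T t u)) \<and>
             (\<forall>u. norm (T t u) \<le> norm u)) \<and>
     (\<forall>u. T 0 u = u) \<and>
     (\<forall>s\<ge>0. \<forall>t\<ge>0. \<forall>u. T (s + t) u = T s (T t u)) \<and>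
     (\<forall>u. ((\<lambda>t. T t u) \<longlongrightarrow> u) (at_right 0))"

definition generator_graph ::
    "(real \<Rightarrow> 'a::euclidean_space L2 \<Rightarrow> 'a L2) \<Rightarrow> ('a L2 \<times> 'a L2) set" where
  "generator_graph T = {(u, v). ((\<lambda>h. (T h u - u) /\<^sub>R h) \<longlongrightarrow> v) (at_right 0)}"

text \<open>
  \<open>is_heat_semigroup Q T\<close> states that \<open>T\<close> is $(e^{-tq^w})_{t \ge 0}$: it is the contraction
  semigroup with generator $-q^w$. The values \<open>T t\<close> for \<open>t < 0\<close> are irrelevant.
\<close>

definition is_heat_semigroup ::
    "complex^('n::finite + 'n)^('n + 'n) \<Rightarrow> (real \<Rightarrow> (real^'n) L2 \<Rightarrow> (real^'n) L2) \<Rightarrow> bool" where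
  "is_heat_semigroup Q T \<longleftrightarrow>
     contraction_semigroup T \<and> generator_graph T = {(u, - v) |u v. (u, v) \<in> quadratic_weyl_graph Q}"

text \<open>
  A linear map from $L^2$ to tempered distributions is bounded on $L^2$ if it takes
  values in $L^2$ and satisfies a norm estimate there.
\<close>

definition bounded_on_L2 :: "((real^'n) L2 \<Rightarrow> 'n::finite distr) \<Rightarrow> bool" where
  "bounded_on_L2 A \<longleftrightarrow> (\<exists>C. \<forall>u. \<exists>v. distr_eq (A u) (L2_distr v) \<and> norm v \<le> C * norm u)"

end

theory Submission
  imports Defs "HOL-Probability.Distributions"
begin

text \<open>
  Gaussian wave packets $\exp(\frac{i}{2} \langle Z(x - y), x - y\rangle + i \langle\eta, x - y\rangle + c)$
  are carried into each other by the semigroup: $Z$ solves a matrix Riccati equation, linearised by the flow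
  of $X' = -2iFX$, and stays in the Siegel upper half space because $\operatorname{Im} \langle\bar x, \xi\rangle$
  does not decrease along that flow when $\operatorname{Re} q \ge 0$. The centre $(y, \eta)$ follows the same flow,
  and on the singular space this flow is real. Hence the packet centred at time $t$ in $Y \in S$ has the same
  norms, at times $0$ and $t$, as the packet centred at the origin, whereas the mean of
  $\langle X_0, X\rangle^w$ in it is shifted by $\langle X_0, Y\rangle$. Boundedness of
  $\langle X_0, X\rangle^w e^{-tq^w}$ therefore bounds $\langle X_0, Y\rangle$ uniformly on the subspace $S$,
  so it vanishes there.
\<close>

section \<open>Gaussian bounds and integration by parts\<close>

text \<open>The semigroup is known only through its generator, so an identity e^{-tq^w} u = v has to
  be won from an explicit curve in L^2 that starts at u, ends at v and solves the Cauchy problem.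
  Gaussians are states for which such a curve can be written down. The factor -2i arises because
  e^{-sq^w} is the quantum evolution of the Hamiltonian -iq, and the Hamilton field of q at X is
  2FX. For Y in S, Re F annihilates every (Im F)^k Y, so on this orbit -2iF acts as the real matrix
  2 Im F. Reality of the centre is the crux: for a real centre the modulus of the packet is an exact
  translate of that of the packet at the origin, while a complex centre would in general change the
  norms. The centre is prescribed at time t and followed backwards; at time 0 only its reality
  matters, not its position. Since the resulting bound on the mean is affine along each line in S,
  scaling Y finishes the proof.\<close>

lemma integrable_gaussian:
  fixes \<epsilon> :: real
  assumes "\<epsilon> > 0"
  shows "integrable lborel (\<lambda>x::'a::euclidean_space. exp (- (\<epsilon> * (norm x)\<^sup>2)))"
proof (rule integrableI_nonneg)
  define \<sigma> where "\<sigma> = sqrt (1 / (2 * \<epsilon>))"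
  have \<sigma>: "\<sigma> > 0" "2 * \<sigma>\<^sup>2 = 1 / \<epsilon>" using assms by (auto simp: \<sigma>_def)
  have "integrable lborel (\<lambda>r. sqrt (2 * pi * \<sigma>\<^sup>2) * normal_density 0 \<sigma> r)"
    using integrable_normal_density[OF \<sigma>(1)] by (intro integrable_mult_right) auto
  also have "(\<lambda>r. sqrt (2 * pi * \<sigma>\<^sup>2) * normal_density 0 \<sigma> r) = (\<lambda>r. exp (- (\<epsilon> * r\<^sup>2)))"
    using \<sigma> by (auto simp: normal_density_def field_simps fun_eq_iff)
  finally have 1: "integrable lborel (\<lambda>r::real. exp (- (\<epsilon> * r\<^sup>2)))" .
  then have fin: "(\<integral>\<^sup>+r. ennreal (exp (- (\<epsilon> * r\<^sup>2))) \<partial>lborel) < \<infinity>"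
    by (simp add: integrable_iff_bounded)
  have eq: "exp (- (\<epsilon> * (norm x)\<^sup>2)) = (\<Prod>b\<in>Basis. exp (- (\<epsilon> * (x \<bullet> b)\<^sup>2)))" for x :: 'a
  proof -
    have "(norm x)\<^sup>2 = (\<Sum>b\<in>Basis. (x \<bullet> b)\<^sup>2)"
      unfolding power2_norm_eq_inner by (subst euclidean_inner) (simp add: power2_eq_square)
    then show ?thesis by (simp add: exp_sum[symmetric] sum_distrib_left sum_negf)
  qed
  have "(\<integral>\<^sup>+x. ennreal (exp (- (\<epsilon> * (norm (x::'a))\<^sup>2))) \<partial>lborel)
      = (\<integral>\<^sup>+x. (\<Prod>b\<in>Basis. ennreal (exp (- (\<epsilon> * ((x::'a) \<bullet> b)\<^sup>2)))) \<partial>lborel)"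
    by (simp add: eq prod_ennreal)
  also have "\<dots> = (\<Prod>b\<in>(Basis::'a set). (\<integral>\<^sup>+r. ennreal (exp (- (\<epsilon> * r\<^sup>2))) \<partial>lborel))"
    by (rule nn_integral_lborel_prod) auto
  also have "\<dots> < \<infinity>" using fin by (auto simp: ennreal_prod_eq_top power_less_top_ennreal)
  finally show "(\<integral>\<^sup>+x. ennreal (exp (- (\<epsilon> * (norm (x::'a))\<^sup>2))) \<partial>lborel) < \<infinity>" .
qed auto

text \<open>The rate is existential and no polynomial factor is allowed: a polynomial factor is paid
  for by halving the rate. Evaluation at 0 shows that \<open>C\<close> is nonnegative, which is used
  whenever such bounds are multiplied.\<close>

definition gaussian_bounded :: "('a::euclidean_space \<Rightarrow> 'b::real_normed_vector) \<Rightarrow> bool" where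
  "gaussian_bounded f \<longleftrightarrow> (\<exists>C \<epsilon>. \<epsilon> > 0 \<and> (\<forall>x. norm (f x) \<le> C * exp (- (\<epsilon> * (norm x)\<^sup>2))))"

lemma gaussian_bounded_integrable:
  fixes f :: "'a::euclidean_space \<Rightarrow> 'b::{banach, second_countable_topology}"
  assumes "gaussian_bounded f" "f \<in> borel_measurable borel"
  shows "integrable lborel f"
proof -
  obtain C \<epsilon> where "\<epsilon> > 0" and b: "\<And>x. norm (f x) \<le> C * exp (- (\<epsilon> * (norm x)\<^sup>2))"
    using assms(1) unfolding gaussian_bounded_def by blast
  show ?thesis
  proof (rule Bochner_Integration.integrable_bound)
    show "integrable lborel (\<lambda>x::'a. C * exp (- (\<epsilon> * (norm x)\<^sup>2)))"
      by (intro integrable_mult_right integrable_gaussian \<open>\<epsilon> > 0\<close>)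
    show "AE x in lborel. norm (f x) \<le> norm (C * exp (- (\<epsilon> * (norm x)\<^sup>2)))"
      using b by (intro AE_I2) (metis abs_ge_self order_trans real_norm_def)
  qed (use assms in auto)
qed

text \<open>(1 + r)^k is at most e^{kr}, and completing the square bounds kr by k^2/(2\<epsilon>) +
  \<epsilon>r^2/2, which consumes half of the exponent.\<close>

lemma poly_times_gaussian:
  fixes \<epsilon> :: real
  assumes "\<epsilon> > 0"
  obtains C where "C \<ge> 0" "\<And>r. r \<ge> 0 \<Longrightarrow> (1 + r) ^ k * exp (- (\<epsilon> * r\<^sup>2)) \<le> C * exp (- (\<epsilon> / 2 * r\<^sup>2))"
proof -
  define c where "c = exp ((real k)\<^sup>2 / (2 * \<epsilon>))"
  have "(1 + r) ^ k * exp (- (\<epsilon> * r\<^sup>2)) \<le> c * exp (- (\<epsilon> / 2 * r\<^sup>2))" if "r \<ge> 0" for r :: real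
  proof -
    have "(1 + r) ^ k \<le> exp r ^ k"
      using that exp_ge_add_one_self[of r] by (intro power_mono) auto
    also have "\<dots> = exp (k * r)" by (simp add: exp_of_nat_mult)
    also have "\<dots> \<le> exp ((real k)\<^sup>2 / (2 * \<epsilon>) + \<epsilon> / 2 * r\<^sup>2)"
    proof -
      have "0 \<le> (real k - \<epsilon> * r)\<^sup>2" by simp
      then have "2 * \<epsilon> * (k * r) \<le> (real k)\<^sup>2 + \<epsilon>\<^sup>2 * r\<^sup>2" by (simp add: power2_eq_square algebra_simps)
      then have "k * r \<le> ((real k)\<^sup>2 + \<epsilon>\<^sup>2 * r\<^sup>2) / (2 * \<epsilon>)"
        using assms by (simp add: field_simps)
      also have "\<dots> = (real k)\<^sup>2 / (2 * \<epsilon>) + \<epsilon> / 2 * r\<^sup>2"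
        using assms by (simp add: field_simps power2_eq_square)
      finally show ?thesis by simp
    qed
    finally have "(1 + r) ^ k * exp (- (\<epsilon> * r\<^sup>2))
        \<le> exp ((real k)\<^sup>2 / (2 * \<epsilon>) + \<epsilon> / 2 * r\<^sup>2) * exp (- (\<epsilon> * r\<^sup>2))"
      by (rule mult_right_mono) simp
    also have "\<dots> = c * exp (- (\<epsilon> / 2 * r\<^sup>2))"
      by (simp add: c_def exp_add[symmetric] field_simps)
    finally show ?thesis .
  qed
  then show ?thesis by (intro that[of c]) (auto simp: c_def)
qed

definition poly_bounded :: "('a::euclidean_space \<Rightarrow> 'b::real_normed_vector) \<Rightarrow> bool" where
  "poly_bounded f \<longleftrightarrow> (\<exists>C k. \<forall>x. norm (f x) \<le> C * (1 + norm x) ^ k)"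

lemma poly_bounded_bounded: "bounded (range f) \<Longrightarrow> poly_bounded f"
  unfolding poly_bounded_def bounded_iff by (metis mult.right_neutral power_0 rangeI)

lemma gaussian_bounded_mult:
  fixes f g :: "'a::euclidean_space \<Rightarrow> 'b::real_normed_field"
  assumes "poly_bounded f" "gaussian_bounded g"
  shows "gaussian_bounded (\<lambda>x. f x * g x)"
proof -
  obtain C k where f: "\<And>x. norm (f x) \<le> C * (1 + norm x) ^ k"
    using assms(1) unfolding poly_bounded_def by blast
  obtain C' \<epsilon> where "\<epsilon> > 0" and g: "\<And>x. norm (g x) \<le> C' * exp (- (\<epsilon> * (norm x)\<^sup>2))"
    using assms(2) unfolding gaussian_bounded_def by blast
  obtain D where D: "\<And>r. r \<ge> 0 \<Longrightarrow> (1 + r) ^ k * exp (- (\<epsilon> * r\<^sup>2)) \<le> D * exp (- (\<epsilon> / 2 * r\<^sup>2))"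
    using poly_times_gaussian[OF \<open>\<epsilon> > 0\<close>] by metis
  have C: "0 \<le> C" using order_trans[OF norm_ge_zero f[of 0]] by simp
  have C': "0 \<le> C'" using order_trans[OF norm_ge_zero g[of 0]] by simp
  have "norm (f x * g x) \<le> (C * C' * D) * exp (- (\<epsilon> / 2 * (norm x)\<^sup>2))" for x
  proof -
    have "norm (f x * g x) \<le> (C * (1 + norm x) ^ k) * (C' * exp (- (\<epsilon> * (norm x)\<^sup>2)))"
      unfolding norm_mult using C by (intro mult_mono f g) auto
    also have "\<dots> = (C * C') * ((1 + norm x) ^ k * exp (- (\<epsilon> * (norm x)\<^sup>2)))" by simp
    also have "\<dots> \<le> (C * C') * (D * exp (- (\<epsilon> / 2 * (norm x)\<^sup>2)))"
      using C C' by (intro mult_left_mono D) auto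
    finally show ?thesis by (simp add: mult.assoc)
  qed
  then show ?thesis unfolding gaussian_bounded_def
    using \<open>\<epsilon> > 0\<close> by (intro exI[of _ "C * C' * D"] exI[of _ "\<epsilon> / 2"]) auto
qed

lemma gaussian_bounded_imp_bounded:
  assumes "gaussian_bounded f" shows "bounded (range f)"
proof -
  obtain C \<epsilon> where "\<epsilon> > 0" and g: "\<And>x. norm (f x) \<le> C * exp (- (\<epsilon> * (norm x)\<^sup>2))"
    using assms unfolding gaussian_bounded_def by blast
  have C: "0 \<le> C" using order_trans[OF norm_ge_zero g[of 0]] by simp
  have "norm (f x) \<le> C" for x
  proof -
    have "C * exp (- (\<epsilon> * (norm x)\<^sup>2)) \<le> C * 1" using C \<open>\<epsilon> > 0\<close> by (intro mult_left_mono) auto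
    then show ?thesis using g[of x] by simp
  qed
  then show ?thesis by (auto simp: bounded_iff)
qed

lemma gaussian_bounded_sq_integrable:
  assumes "gaussian_bounded f" "f \<in> borel_measurable borel"
  shows "sq_integrable f"
  unfolding sq_integrable_def
proof
  have "gaussian_bounded (\<lambda>x. f x * f x)"
    using gaussian_bounded_mult[OF poly_bounded_bounded[OF gaussian_bounded_imp_bounded] , OF assms(1) assms(1)] .
  then have "integrable lborel (\<lambda>x. f x * f x)"
    using assms by (intro gaussian_bounded_integrable) auto
  then have "integrable lborel (\<lambda>x. norm (f x * f x))" by (rule integrable_norm)
  then show "integrable lborel (\<lambda>x. (norm (f x))\<^sup>2)" by (simp add: norm_mult power2_eq_square)
qed (use assms in auto)

lemma integral_lborel_translate:
  fixes f :: "'a::euclidean_space \<Rightarrow> 'b::{banach, second_countable_topology}"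
  assumes [measurable]: "f \<in> borel_measurable borel"
  shows "(LINT x|lborel. f (a + x)) = (LINT x|lborel. f x)"
proof -
  have "(LINT x|lborel. f x) = (LINT x|distr lborel borel ((+) a). f x)"
    by (simp add: lborel_distr_plus)
  also have "\<dots> = (LINT x|lborel. f (a + x))" by (intro integral_distr) auto
  finally show ?thesis by simp
qed

text \<open>Provides one integrable majorant for all translates by vectors of norm at most
  \<open>r\<close>, as dominated convergence of difference quotients requires.\<close>

lemma gaussian_shift_le:
  fixes a x :: "'a::real_normed_vector"
  assumes "\<epsilon> > 0" "norm a \<le> r"
  shows "exp (- (\<epsilon> * (norm (x + a))\<^sup>2)) \<le> exp (\<epsilon> * r\<^sup>2) * exp (- (\<epsilon> / 2 * (norm x)\<^sup>2))"
proof -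
  have "norm x \<le> norm (x + a) + norm a" by (metis add_diff_cancel_right' norm_triangle_ineq4)
  then have "(norm x)\<^sup>2 \<le> (norm (x + a) + norm a)\<^sup>2" by (intro power_mono) auto
  also have "\<dots> \<le> 2 * (norm (x + a))\<^sup>2 + 2 * (norm a)\<^sup>2"
    using sum_squares_bound[of "norm (x + a)" "norm a"] by (simp add: power2_sum)
  also have "\<dots> \<le> 2 * (norm (x + a))\<^sup>2 + 2 * r\<^sup>2"
    using assms power_mono[OF assms(2) norm_ge_zero] by auto
  finally have "\<epsilon> * ((norm x)\<^sup>2 / 2) \<le> \<epsilon> * ((norm (x + a))\<^sup>2 + r\<^sup>2)"
    using assms by (intro mult_left_mono) auto
  then show ?thesis by (simp add: exp_add[symmetric] algebra_simps)
qed

lemma has_vector_derivative_iff_quotient: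
  "(f has_vector_derivative f') (at x within S) \<longleftrightarrow>
     ((\<lambda>y. (f y - f x) /\<^sub>R (y - x)) \<longlongrightarrow> f') (at x within S)"
proof -
  have "(f has_vector_derivative f') (at x within S) \<longleftrightarrow>
      ((\<lambda>y. norm (f y - f x - (y - x) *\<^sub>R f') / norm (y - x)) \<longlongrightarrow> 0) (at x within S)"
    unfolding has_vector_derivative_def has_derivative_iff_norm
    by (simp add: bounded_linear_scaleR_left)
  also have "\<dots> \<longleftrightarrow> ((\<lambda>y. norm ((f y - f x) /\<^sub>R (y - x) - f')) \<longlongrightarrow> 0) (at x within S)"
  proof (rule tendsto_cong)
    show "\<forall>\<^sub>F y in at x within S. norm (f y - f x - (y - x) *\<^sub>R f') / norm (y - x)
        = norm ((f y - f x) /\<^sub>R (y - x) - f')"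
    proof (rule eventually_mono[OF eventually_neq_at_within[of x]])
      fix y assume "y \<noteq> x"
      then have "(f y - f x) /\<^sub>R (y - x) - f' = (f y - f x - (y - x) *\<^sub>R f') /\<^sub>R (y - x)"
        using right_inverse[of "y - x"] by (simp add: scaleR_diff_right)
      then show "norm (f y - f x - (y - x) *\<^sub>R f') / norm (y - x) = norm ((f y - f x) /\<^sub>R (y - x) - f')"
        by (simp add: divide_inverse mult.commute)
    qed
  qed
  also have "\<dots> \<longleftrightarrow> ((\<lambda>y. (f y - f x) /\<^sub>R (y - x)) \<longlongrightarrow> f') (at x within S)"
    unfolding tendsto_norm_zero_iff by (rule LIM_zero_iff)
  finally show ?thesis .
qed

text \<open>By translation invariance every difference quotient of \<open>f\<close> along
  \<open>e\<close> has integral 0. The mean value inequality bounds the quotients by a fixed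
  Gaussian, so the integral passes to the limit \<open>g\<close>. This is the source of all
  integrations by parts below.\<close>

lemma integral_directional_derivative_0:
  fixes f g :: "'a::euclidean_space \<Rightarrow> complex"
  assumes f: "\<And>x. (f has_derivative F x) (at x)" and F: "\<And>x. F x e = g x"
    and fb: "gaussian_bounded f" and gb: "gaussian_bounded g"
    and g_meas [measurable]: "g \<in> borel_measurable borel"
  shows "(LINT x|lborel. g x) = 0"
proof -
  have contf: "continuous_on UNIV f"
    using f by (meson continuous_at_imp_continuous_on has_derivative_continuous)
  then have f_meas [measurable]: "f \<in> borel_measurable borel"
    by (rule borel_measurable_continuous_onI)
  obtain C \<epsilon> where \<epsilon>: "\<epsilon> > 0" and g: "\<And>x. norm (g x) \<le> C * exp (- (\<epsilon> * (norm x)\<^sup>2))"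
    using gb unfolding gaussian_bounded_def by blast
  have C: "0 \<le> C" using order_trans[OF norm_ge_zero g[of 0]] by simp
  \<comment> \<open>Steps of length at most 1 keep the segment from x to x + h e within distance
    \<open>norm e\<close> of x, so that one majorant serves for all k.\<close>
  define h where "h k = 1 / real (Suc k)" for k
  have h: "0 < h k" "h k \<le> 1" for k by (auto simp: h_def)
  have h0: "h \<longlonglongrightarrow> 0" unfolding h_def using LIMSEQ_Suc[OF lim_1_over_n] by simp
  \<comment> \<open>The bound on \<open>g\<close> after a shift by at most \<open>norm e\<close>, as
    given by \<open>gaussian_shift_le\<close>.\<close>
  define G where "G x = C * (exp (\<epsilon> * (norm e)\<^sup>2) * exp (- (\<epsilon> / 2 * (norm x)\<^sup>2)))" for x :: 'a
  define q where "q k x = (f (x + h k *\<^sub>R e) - f x) /\<^sub>R h k" for k x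
  have line: "((\<lambda>r. f (x + r *\<^sub>R e)) has_vector_derivative g (x + r *\<^sub>R e)) (at r within A)" for x r A
  proof -
    have "((\<lambda>r. f (x + r *\<^sub>R e)) has_derivative (\<lambda>d. F (x + r *\<^sub>R e) (d *\<^sub>R e))) (at r within A)"
      by (rule has_derivative_compose[OF _ f]) (auto intro!: derivative_eq_intros)
    moreover have "F (x + r *\<^sub>R e) (d *\<^sub>R e) = d *\<^sub>R g (x + r *\<^sub>R e)" for d
      using F linear_cmul[OF has_derivative_linear[OF f]] by auto
    ultimately show ?thesis by (simp add: has_vector_derivative_def)
  qed
  have dom: "norm (q k x) \<le> G x" for k x
  proof -
    have gl: "norm (g (x + r *\<^sub>R e)) \<le> G x" if "r \<in> {0..h k}" for r
    proof -
      have "norm (r *\<^sub>R e) \<le> norm e" using that h(2)[of k] by (auto simp: mult_left_le_one_le)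
      from gaussian_shift_le[OF \<epsilon> this, of x] have "C * exp (- (\<epsilon> * (norm (x + r *\<^sub>R e))\<^sup>2)) \<le> G x"
        unfolding G_def using C by (intro mult_left_mono)
      then show ?thesis using g[of "x + r *\<^sub>R e"] by linarith
    qed
    have "norm (f (x + h k *\<^sub>R e) - f (x + 0 *\<^sub>R e)) \<le> G x * norm (h k - 0)"
    proof (rule differentiable_bound[where S = "{0..h k}" and f' = "\<lambda>r d. d *\<^sub>R g (x + r *\<^sub>R e)"])
      show "((\<lambda>r. f (x + r *\<^sub>R e)) has_derivative (\<lambda>d. d *\<^sub>R g (x + r *\<^sub>R e))) (at r within {0..h k})" for r
        using line unfolding has_vector_derivative_def .
      show "onorm (\<lambda>d::real. d *\<^sub>R g (x + r *\<^sub>R e)) \<le> G x" if "r \<in> {0..h k}" for r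
        using gl[OF that] by (intro onorm_le) (auto simp: mult.commute[of _ "\<bar>_\<bar>"] intro!: mult_left_mono)
    qed (use h[of k] in auto)
    then have "norm (f (x + h k *\<^sub>R e) - f x) \<le> G x * h k" using h[of k] by simp
    then show ?thesis unfolding q_def using h(1)[of k] by (simp add: divide_simps mult.commute)
  qed
  have lim: "(\<lambda>k. q k x) \<longlonglongrightarrow> g x" for x
  proof -
    have "((\<lambda>d. (f (x + d *\<^sub>R e) - f (x + 0 *\<^sub>R e)) /\<^sub>R (d - 0)) \<longlongrightarrow> g (x + 0 *\<^sub>R e)) (at 0)"
      using line[of x 0 UNIV] unfolding has_vector_derivative_iff_quotient .
    moreover have "filterlim h (at 0) sequentially"
      using h0 by (simp add: filterlim_at h_def)
    ultimately have "(\<lambda>k. (f (x + h k *\<^sub>R e) - f (x + 0 *\<^sub>R e)) /\<^sub>R (h k - 0)) \<longlonglongrightarrow> g (x + 0 *\<^sub>R e)"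
      by (rule filterlim_compose)
    then show ?thesis by (simp add: q_def)
  qed
  have Gint: "integrable lborel G"
    unfolding G_def using integrable_gaussian[of "\<epsilon> / 2"] \<epsilon> by (intro integrable_mult_right) auto
  have "(\<lambda>k. LINT x|lborel. q k x) \<longlonglongrightarrow> (LINT x|lborel. g x)"
    by (rule integral_dominated_convergence[where w = G])
       (use Gint lim dom in \<open>auto simp: q_def[abs_def]\<close>)
  moreover have "(LINT x|lborel. q k x) = 0" for k
  proof -
    have i: "integrable lborel f" using fb f_meas by (rule gaussian_bounded_integrable)
    have i': "integrable lborel (\<lambda>x. f (x + h k *\<^sub>R e))"
    proof -
      have "integrable (distr lborel borel ((+) (h k *\<^sub>R e))) f"
        using i by (simp add: lborel_distr_plus)
      then have "integrable lborel (\<lambda>x. f (h k *\<^sub>R e + x))"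
        by (subst (asm) integrable_distr_eq) auto
      then show ?thesis by (simp add: add.commute)
    qed
    have "(LINT x|lborel. q k x) = ((LINT x|lborel. f (x + h k *\<^sub>R e)) - (LINT x|lborel. f x)) /\<^sub>R h k"
      unfolding q_def using i i' by simp
    also have "(LINT x|lborel. f (x + h k *\<^sub>R e)) = (LINT x|lborel. f x)"
      using integral_lborel_translate[OF f_meas, of "h k *\<^sub>R e"] by (simp add: add.commute)
    finally show ?thesis by simp
  qed
  ultimately show ?thesis by (simp add: LIMSEQ_const_iff)
qed

section \<open>Polynomials times Gaussians\<close>

text \<open>Generated inductively so that growth bounds, conjugation and closure under partial
  derivatives all follow by rule induction, without any bookkeeping of degrees.\<close>

inductive cpoly :: "(real^'n \<Rightarrow> complex) \<Rightarrow> bool" where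
  cpoly_const: "cpoly (\<lambda>x. c)"
| cpoly_coord: "cpoly (\<lambda>x. of_real (x $ j))"
| cpoly_add: "cpoly P \<Longrightarrow> cpoly R \<Longrightarrow> cpoly (\<lambda>x. P x + R x)"
| cpoly_mult: "cpoly P \<Longrightarrow> cpoly R \<Longrightarrow> cpoly (\<lambda>x. P x * R x)"

lemmas cpoly_intros = cpoly.intros

lemma cpoly_sum: "(\<And>i. i \<in> I \<Longrightarrow> cpoly (P i)) \<Longrightarrow> cpoly (\<lambda>x. \<Sum>i\<in>I. P i x)"
  by (induction I rule: infinite_finite_induct) (auto intro: cpoly_intros)

lemma cpoly_cnj: "cpoly P \<Longrightarrow> cpoly (\<lambda>x. cnj (P x))"
  by (induction rule: cpoly.induct) (auto intro: cpoly_intros)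

lemma poly_bounded_cpoly:
  fixes P :: "real^'n \<Rightarrow> complex"
  assumes "cpoly P" shows "poly_bounded P"
  using assms
proof (induction rule: cpoly.induct)
  case (cpoly_const c)
  show ?case unfolding poly_bounded_def by (rule exI[of _ "norm c"], rule exI[of _ 0]) simp
next
  case (cpoly_coord j)
  have "norm (of_real ((x::real^'n) $ j) :: complex) \<le> 1 * (1 + norm x) ^ 1" for x
    using component_le_norm_cart[of x j] by simp
  then show ?case unfolding poly_bounded_def by blast
next
  case (cpoly_add P R)
  then obtain C k D m where P: "\<And>x. norm (P x) \<le> C * (1 + norm x) ^ k"
    and R: "\<And>x. norm (R x) \<le> D * (1 + norm x) ^ m"
    unfolding poly_bounded_def by metis
  have C: "0 \<le> C" using order_trans[OF norm_ge_zero P[of 0]] by simp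
  have D: "0 \<le> D" using order_trans[OF norm_ge_zero R[of 0]] by simp
  have "norm (P x + R x) \<le> (C + D) * (1 + norm x) ^ (k + m)" for x
  proof -
    have "norm (P x + R x) \<le> C * (1 + norm x) ^ k + D * (1 + norm x) ^ m"
      using norm_triangle_ineq[of "P x" "R x"] P[of x] R[of x] by linarith
    also have "\<dots> \<le> C * (1 + norm x) ^ (k + m) + D * (1 + norm x) ^ (k + m)"
      using C D by (intro add_mono mult_left_mono power_increasing) auto
    finally show ?thesis by (simp add: distrib_right)
  qed
  then show ?case unfolding poly_bounded_def by blast
next
  case (cpoly_mult P R)
  then obtain C k D m where P: "\<And>x. norm (P x) \<le> C * (1 + norm x) ^ k"
    and R: "\<And>x. norm (R x) \<le> D * (1 + norm x) ^ m"
    unfolding poly_bounded_def by metis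
  have C: "0 \<le> C" using order_trans[OF norm_ge_zero P[of 0]] by simp
  have "norm (P x * R x) \<le> (C * D) * (1 + norm x) ^ (k + m)" for x
  proof -
    have "norm (P x * R x) \<le> (C * (1 + norm x) ^ k) * (D * (1 + norm x) ^ m)"
      unfolding norm_mult using C by (intro mult_mono P R) auto
    then show ?thesis by (simp add: power_add mult_ac)
  qed
  then show ?case unfolding poly_bounded_def by blast
qed

text \<open>\<open>partial_deriv\<close> is read off the Frechet derivative, so total
  differentiability has to be carried along. Recording the whole family of partials makes the sum,
  product and chain rules into computations.\<close>

definition has_partials :: "(real^'n \<Rightarrow> complex) \<Rightarrow> ('n \<Rightarrow> real^'n \<Rightarrow> complex) \<Rightarrow> bool" where
  "has_partials f D \<longleftrightarrow>
     (\<forall>x. (f has_derivative (\<lambda>h. \<Sum>j\<in>UNIV. of_real (h $ j) * D j x)) (at x))"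

lemma has_partialsD:
  "has_partials f D \<Longrightarrow> (f has_derivative (\<lambda>h. \<Sum>j\<in>UNIV. of_real (h $ j) * D j x)) (at x)"
  by (simp add: has_partials_def)

lemma sum_axis: "(\<Sum>k\<in>UNIV. of_real (axis j 1 $ k) * D k) = (D j :: complex)"
  by (subst sum.remove[of _ j]) (auto simp: axis_def intro!: sum.neutral)

lemma has_partials_partial_deriv:
  assumes "has_partials f D" shows "partial_deriv j f = D j"
proof
  fix x
  have "frechet_derivative f (at x) = (\<lambda>h. \<Sum>j\<in>UNIV. of_real (h $ j) * D j x)"
    by (rule frechet_derivative_at[OF has_partialsD[OF assms], symmetric])
  then show "partial_deriv j f x = D j x" by (simp add: partial_deriv_def sum_axis)
qed

lemma has_partials_differentiable: "has_partials f D \<Longrightarrow> f differentiable at x"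
  unfolding has_partials_def differentiable_def by blast

lemma has_partials_continuous: "has_partials f D \<Longrightarrow> continuous_on UNIV f"
  unfolding has_partials_def
  by (meson continuous_at_imp_continuous_on has_derivative_continuous)

lemma has_partialsI_differentiable:
  fixes f :: "real^'n \<Rightarrow> complex"
  assumes "\<And>x. f differentiable at x"
  shows "has_partials f (\<lambda>j. partial_deriv j f)"
  unfolding has_partials_def
proof
  fix x
  have d: "(f has_derivative frechet_derivative f (at x)) (at x)"
    using assms frechet_derivative_works by blast
  then have l: "linear (frechet_derivative f (at x))" by (rule has_derivative_linear)
  have "frechet_derivative f (at x) h = (\<Sum>j\<in>UNIV. of_real (h $ j) * partial_deriv j f x)" for h
  proof -
    have "h = (\<Sum>j\<in>UNIV. (h $ j) *\<^sub>R axis j 1)"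
      using basis_expansion[of h] by (simp add: scalar_mult_eq_scaleR)
    then have "frechet_derivative f (at x) h
        = frechet_derivative f (at x) (\<Sum>j\<in>UNIV. (h $ j) *\<^sub>R axis j 1)" by simp
    also have "\<dots> = (\<Sum>j\<in>UNIV. (h $ j) *\<^sub>R frechet_derivative f (at x) (axis j 1))"
      using l by (simp add: linear_sum linear_cmul)
    finally show ?thesis by (simp add: partial_deriv_def scaleR_conv_of_real)
  qed
  then have "frechet_derivative f (at x) = (\<lambda>h. \<Sum>j\<in>UNIV. of_real (h $ j) * partial_deriv j f x)" by blast
  then show "(f has_derivative (\<lambda>h. \<Sum>j\<in>UNIV. of_real (h $ j) * partial_deriv j f x)) (at x)"
    using d by simp
qed

lemma has_partials_const: "has_partials (\<lambda>x. c) (\<lambda>j x. 0)"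
  by (auto simp: has_partials_def)

lemma has_partials_coord:
  fixes k :: "'n::finite"
  shows "has_partials (\<lambda>x. of_real (x $ k)) (\<lambda>j x. if j = k then 1 else 0)"
proof -
  have "((\<lambda>x. complex_of_real (x $ k)) has_derivative (\<lambda>h. of_real (h $ k))) (at x)" for x :: "real^'n"
    by (auto intro!: derivative_eq_intros bounded_linear_imp_has_derivative
        bounded_linear_compose[OF bounded_linear_of_real bounded_linear_vec_nth])
  moreover have "(\<Sum>j\<in>UNIV. of_real ((h::real^'n) $ j) * (if j = k then 1 else 0)) = complex_of_real (h $ k)" for h
    by (subst sum.remove[of _ k]) (auto intro!: sum.neutral)
  ultimately show ?thesis by (simp add: has_partials_def)
qed

lemma has_partials_add:
  assumes "has_partials f D" "has_partials g E"
  shows "has_partials (\<lambda>x. f x + g x) (\<lambda>j x. D j x + E j x)"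
  unfolding has_partials_def distrib_left sum.distrib
  by (intro allI has_derivative_add has_partialsD assms)

lemma has_partials_mult:
  assumes "has_partials f D" "has_partials g E"
  shows "has_partials (\<lambda>x. f x * g x) (\<lambda>j x. D j x * g x + f x * E j x)"
  unfolding has_partials_def
proof
  fix x
  have "((\<lambda>x. f x * g x) has_derivative (\<lambda>h. f x * (\<Sum>j\<in>UNIV. of_real (h $ j) * E j x)
      + (\<Sum>j\<in>UNIV. of_real (h $ j) * D j x) * g x)) (at x)"
    by (intro has_derivative_mult has_partialsD assms)
  also have "(\<lambda>h. f x * (\<Sum>j\<in>UNIV. of_real (h $ j) * E j x) + (\<Sum>j\<in>UNIV. of_real (h $ j) * D j x) * g x)
      = (\<lambda>h. \<Sum>j\<in>UNIV. of_real (h $ j) * (D j x * g x + f x * E j x))"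
    unfolding sum_distrib_left sum_distrib_right sum.distrib[symmetric]
    by (intro ext sum.cong) (simp_all add: algebra_simps)
  finally show "((\<lambda>x. f x * g x) has_derivative
      (\<lambda>h. \<Sum>j\<in>UNIV. of_real (h $ j) * (D j x * g x + f x * E j x))) (at x)" .
qed

lemma has_partials_exp:
  assumes "has_partials f D" shows "has_partials (\<lambda>x. exp (f x)) (\<lambda>j x. D j x * exp (f x))"
  unfolding has_partials_def
proof
  fix x
  have "((\<lambda>x. exp (f x)) has_derivative (\<lambda>h. exp (f x) * (\<Sum>j\<in>UNIV. of_real (h $ j) * D j x))) (at x)"
    using has_derivative_compose[of f _ x UNIV exp "\<lambda>y. exp (f x) * y"] assms DERIV_exp[of "f x"]
    by (auto simp: has_partials_def has_field_derivative_def)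
  then show "((\<lambda>x. exp (f x)) has_derivative (\<lambda>h. \<Sum>j\<in>UNIV. of_real (h $ j) * (D j x * exp (f x)))) (at x)"
    by (simp add: sum_distrib_left algebra_simps)
qed

lemma cpoly_has_partials:
  assumes "cpoly P"
  obtains D where "has_partials P D" "\<And>j. cpoly (D j)"
proof -
  have "\<exists>D. has_partials P D \<and> (\<forall>j. cpoly (D j))" using assms
  proof (induction rule: cpoly.induct)
    case (cpoly_const c)
    show ?case using has_partials_const cpoly.cpoly_const by blast
  next
    case (cpoly_coord k)
    show ?case
      by (rule exI, rule conjI[OF has_partials_coord]) (auto intro: cpoly_intros)
  next
    case (cpoly_add P R)
    then obtain D E where "has_partials P D" "has_partials R E" "\<And>j. cpoly (D j)" "\<And>j. cpoly (E j)" by blast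
    then have "has_partials (\<lambda>x. P x + R x) (\<lambda>j x. D j x + E j x) \<and> (\<forall>j. cpoly (\<lambda>x. D j x + E j x))"
      by (intro conjI allI has_partials_add cpoly.cpoly_add)
    then show ?case by (rule exI[of _ "\<lambda>j x. D j x + E j x"])
  next
    case (cpoly_mult P R)
    then obtain D E where *: "has_partials P D" "has_partials R E" "\<And>j. cpoly (D j)" "\<And>j. cpoly (E j)" by blast
    show ?case
      by (rule exI, rule conjI[OF has_partials_mult[OF *(1,2)]]) (auto intro!: cpoly_intros cpoly_mult.hyps *)
  qed
  then show ?thesis using that by blast
qed

lemma cpoly_continuous: "cpoly P \<Longrightarrow> continuous_on UNIV P"
  using cpoly_has_partials has_partials_continuous by blast

text \<open>Only the decay of the real part and polynomial partials are prescribed. \<open>K\<close>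
  absorbs lower order terms, so packets with a moving centre can share one rate and one
  constant.\<close>

locale gaussian_exponent =
  fixes \<Phi> :: "real^'n \<Rightarrow> complex" and L :: "'n \<Rightarrow> real^'n \<Rightarrow> complex" and \<epsilon> K :: real
  assumes eps: "\<epsilon> > 0"
    and Re_le: "\<And>x. Re (\<Phi> x) \<le> K - \<epsilon> * (norm x)\<^sup>2"
    and Phi: "has_partials \<Phi> L"
    and L: "\<And>j. cpoly (L j)"
begin

lemma exp_gaussian: "gaussian_bounded (\<lambda>x. exp (\<Phi> x))"
proof -
  have "norm (exp (\<Phi> x)) \<le> exp K * exp (- (\<epsilon> * (norm x)\<^sup>2))" for x
    using Re_le[of x] by (simp add: exp_add[symmetric])
  then show ?thesis unfolding gaussian_bounded_def using eps by blast
qed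

lemma poly_exp_gaussian: "cpoly P \<Longrightarrow> gaussian_bounded (\<lambda>x. P x * exp (\<Phi> x))"
  by (intro gaussian_bounded_mult poly_bounded_cpoly exp_gaussian)

lemma Phi_continuous: "continuous_on UNIV \<Phi>"
  by (rule has_partials_continuous[OF Phi])

lemma poly_exp_continuous: "cpoly P \<Longrightarrow> continuous_on UNIV (\<lambda>x. P x * exp (\<Phi> x))"
  by (intro continuous_intros Phi_continuous cpoly_continuous)

lemma poly_exp_measurable: "cpoly P \<Longrightarrow> (\<lambda>x. P x * exp (\<Phi> x)) \<in> borel_measurable borel"
  by (intro borel_measurable_continuous_onI poly_exp_continuous)

lemma poly_exp_sq_integrable: "cpoly P \<Longrightarrow> sq_integrable (\<lambda>x. P x * exp (\<Phi> x))"
  by (intro gaussian_bounded_sq_integrable poly_exp_gaussian poly_exp_measurable)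

lemma poly_exp_partials:
  assumes "has_partials P D"
  shows "has_partials (\<lambda>x. P x * exp (\<Phi> x)) (\<lambda>j x. (D j x + P x * L j x) * exp (\<Phi> x))"
  using has_partials_mult[OF assms has_partials_exp[OF Phi]] by (simp add: algebra_simps)

text \<open>Differentiating P e^\<Phi> gives (\<partial>P + P L) e^\<Phi>, and \<open>L\<close> is
  polynomial, so the class reproduces itself.\<close>

lemma poly_exp_foldr:
  assumes "cpoly P"
  shows "\<exists>R. cpoly R \<and> foldr partial_deriv js (\<lambda>x. P x * exp (\<Phi> x)) = (\<lambda>x. R x * exp (\<Phi> x))"
proof (induction js)
  case Nil
  then show ?case using assms by auto
next
  case (Cons j js)
  then obtain R where R: "cpoly R"
    "foldr partial_deriv js (\<lambda>x. P x * exp (\<Phi> x)) = (\<lambda>x. R x * exp (\<Phi> x))" by blast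
  obtain D where D: "has_partials R D" "\<And>j. cpoly (D j)" using cpoly_has_partials[OF R(1)] by blast
  have "foldr partial_deriv (j # js) (\<lambda>x. P x * exp (\<Phi> x)) = (\<lambda>x. (D j x + R x * L j x) * exp (\<Phi> x))"
    using R(2) has_partials_partial_deriv[OF poly_exp_partials[OF D(1)]] by simp
  moreover have "cpoly (\<lambda>x. D j x + R x * L j x)" by (intro cpoly_intros D L R)
  ultimately show ?case by (intro exI[of _ "\<lambda>x. D j x + R x * L j x"]) auto
qed

lemma poly_exp_schwartz:
  assumes "cpoly P" shows "schwartz (\<lambda>x. P x * exp (\<Phi> x))"
  unfolding schwartz_def
proof (intro allI conjI)
  fix js x
  obtain R where R: "cpoly R"
    "foldr partial_deriv js (\<lambda>x. P x * exp (\<Phi> x)) = (\<lambda>x. R x * exp (\<Phi> x))"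
    using poly_exp_foldr[OF assms] by blast
  obtain D where "has_partials R D" using cpoly_has_partials[OF R(1)] by blast
  then show "foldr partial_deriv js (\<lambda>x. P x * exp (\<Phi> x)) differentiable at x"
    unfolding R(2) by (rule has_partials_differentiable[OF poly_exp_partials])
  fix k :: nat
  have "poly_bounded (\<lambda>x::real^'n. of_real ((1 + norm x) ^ k) :: complex)"
    unfolding poly_bounded_def by (rule exI[of _ 1], rule exI[of _ k]) (simp only: norm_of_real, simp)
  then have "gaussian_bounded (\<lambda>x. of_real ((1 + norm x) ^ k) * (R x * exp (\<Phi> x)))"
    by (intro gaussian_bounded_mult poly_exp_gaussian R)
  then show "bounded (range (\<lambda>x. (1 + norm x) ^ k *\<^sub>R foldr partial_deriv js (\<lambda>x. P x * exp (\<Phi> x)) x))"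
    unfolding R(2) scaleR_conv_of_real by (rule gaussian_bounded_imp_bounded)
qed

end

text \<open>One bounded continuous derivative suffices for one integration by parts against a
  Gaussian. For Schwartz \<phi>, both x_k \<phi> and its partial derivatives belong to this class,
  so the inner factor of X_a X_b can be treated without showing that these products are Schwartz
  again.\<close>

definition test_function :: "(real^'n \<Rightarrow> complex) \<Rightarrow> bool" where
  "test_function \<phi> \<longleftrightarrow> bounded (range \<phi>) \<and>
     (\<exists>D. has_partials \<phi> D \<and> (\<forall>j. continuous_on UNIV (D j) \<and> bounded (range (D j))))"

lemma schwartz_foldr:
  assumes "schwartz \<phi>"
  shows "has_partials (foldr partial_deriv js \<phi>) (\<lambda>j. foldr partial_deriv (j # js) \<phi>)"
    "bounded (range (\<lambda>x. (1 + norm x) ^ k *\<^sub>R foldr partial_deriv js \<phi> x))"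
    "bounded (range (foldr partial_deriv js \<phi>))"
    "continuous_on UNIV (foldr partial_deriv js \<phi>)"
proof -
  have d: "foldr partial_deriv js \<phi> differentiable at x"
    and b: "bounded (range (\<lambda>x. (1 + norm x) ^ k *\<^sub>R foldr partial_deriv js \<phi> x))" for x and k::nat
    using assms unfolding schwartz_def by blast+
  show "bounded (range (\<lambda>x. (1 + norm x) ^ k *\<^sub>R foldr partial_deriv js \<phi> x))" by (rule b)
  show "bounded (range (foldr partial_deriv js \<phi>))" using b[of 0] by simp
  show "has_partials (foldr partial_deriv js \<phi>) (\<lambda>j. foldr partial_deriv (j # js) \<phi>)"
    using has_partialsI_differentiable[OF d] by simp
  then show "continuous_on UNIV (foldr partial_deriv js \<phi>)" by (rule has_partials_continuous)
qed

lemma test_function_partial_deriv: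
  assumes "schwartz \<phi>" shows "test_function (foldr partial_deriv js \<phi>)"
  unfolding test_function_def using schwartz_foldr[OF assms] by blast

lemma test_function_coord:
  fixes \<phi> :: "real^'n \<Rightarrow> complex"
  assumes "schwartz \<phi>" shows "test_function (\<lambda>x. of_real (x $ k) * \<phi> x)"
proof -
  have b: "bounded (range (\<lambda>x. of_real (x $ k) * f x))"
    if f: "bounded (range (\<lambda>x. (1 + norm x) ^ 1 *\<^sub>R f x))" for f :: "real^'n \<Rightarrow> complex"
  proof -
    obtain B where B: "\<And>x. norm ((1 + norm x) ^ 1 *\<^sub>R f x) \<le> B" using f by (auto simp: bounded_iff)
    have "norm (of_real (x $ k) * f x) \<le> B" for x
    proof -
      have "norm (of_real (x $ k) * f x) \<le> norm ((1 + norm x) ^ 1 *\<^sub>R f x)"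
        using component_le_norm_cart[of x k] by (auto simp: norm_mult intro!: mult_right_mono)
      then show ?thesis using B[of x] by linarith
    qed
    then show ?thesis by (auto simp: bounded_iff)
  qed
  have p: "has_partials \<phi> (\<lambda>j. partial_deriv j \<phi>)" using schwartz_foldr(1)[OF assms, of "[]"] by simp
  show ?thesis unfolding test_function_def
  proof (intro conjI exI allI)
    show "bounded (range (\<lambda>x. of_real (x $ k) * \<phi> x))"
      using schwartz_foldr(2)[OF assms, of 1 "[]"] by (intro b) simp
    show "has_partials (\<lambda>x. of_real (x $ k) * \<phi> x)
        (\<lambda>j x. (if j = k then 1 else 0) * \<phi> x + of_real (x $ k) * partial_deriv j \<phi> x)"
      by (intro has_partials_mult has_partials_coord p)
    fix j
    have b1: "bounded (range (\<lambda>x. (if j = k then 1 else 0) * \<phi> x))"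
      using schwartz_foldr(3)[OF assms, of "[]"] by (auto simp: bounded_iff)
    have b2: "bounded (range (\<lambda>x. of_real (x $ k) * partial_deriv j \<phi> x))"
      using schwartz_foldr(2)[OF assms, of 1 "[j]"] by (intro b) simp
    show "bounded (range (\<lambda>x. (if j = k then 1 else 0) * \<phi> x + of_real (x $ k) * partial_deriv j \<phi> x))"
      using bounded_plus_comp[OF b1 b2] .
    show "continuous_on UNIV (\<lambda>x. (if j = k then 1 else 0) * \<phi> x + of_real (x $ k) * partial_deriv j \<phi> x)"
      using schwartz_foldr(4)[OF assms, of "[j]"] schwartz_foldr(4)[OF assms, of "[]"]
      by (intro continuous_intros) auto
  qed
qed

lemma test_function_measurable: "test_function \<phi> \<Longrightarrow> \<phi> \<in> borel_measurable borel"
  unfolding test_function_def using borel_measurable_continuous_onI has_partials_continuous by blast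

text \<open>\<open>rep_L2\<close> returns some representative, which agrees with \<open>f\<close>
  only almost everywhere; the integral does not see the difference.\<close>

lemma L2_distr_abs:
  assumes "sq_integrable f" "\<phi> \<in> borel_measurable borel"
  shows "L2_distr (abs_L2 f) \<phi> = (LINT x|lborel. f x * \<phi> x)"
proof -
  have "L2_eq (rep_L2 (abs_L2 f)) f"
    using rep_abs_rsp_left[OF Quotient3_L2, of f f] assms(1) by (simp add: L2_eq_def)
  then show ?thesis unfolding L2_distr_def L2_eq_def sq_integrable_def
    using assms by (intro integral_cong_AE) auto
qed

context gaussian_exponent
begin

text \<open>The pairing \<open>L2_distr\<close> is bilinear, so the conjugate of a state is the test
  function that turns it into the inner product with that state. The conjugate exponent has the same
  real part and conjugate polynomial partials.\<close>

lemma exp_cnj_schwartz: "schwartz (\<lambda>x. cnj (exp (\<Phi> x)))"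
proof -
  have "gaussian_exponent (\<lambda>x. cnj (\<Phi> x)) (\<lambda>j x. cnj (L j x)) \<epsilon> K"
  proof
    show "0 < \<epsilon>" by (rule eps)
    show "Re (cnj (\<Phi> x)) \<le> K - \<epsilon> * (norm x)\<^sup>2" for x using Re_le[of x] by simp
    show "cpoly (\<lambda>x. cnj (L j x))" for j by (intro cpoly_cnj L)
    show "has_partials (\<lambda>x. cnj (\<Phi> x)) (\<lambda>j x. cnj (L j x))"
      unfolding has_partials_def
      using bounded_linear.has_derivative[OF bounded_linear_cnj has_partialsD[OF Phi]] by simp
  qed
  from gaussian_exponent.poly_exp_schwartz[OF this cpoly_const[of 1]] show ?thesis
    by (simp add: exp_cnj)
qed

text \<open>The product \<phi> P e^\<Phi> and its partial derivative are Gaussian bounded, hence the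
  integral of the derivative vanishes; the product rule then separates the two terms.\<close>

lemma poly_exp_by_parts:
  assumes P: "cpoly P" and D: "has_partials P D" "\<And>j. cpoly (D j)" and \<phi>: "test_function \<phi>"
  shows "(LINT x|lborel. P x * exp (\<Phi> x) * partial_deriv j \<phi> x)
       = - (LINT x|lborel. (D j x + P x * L j x) * exp (\<Phi> x) * \<phi> x)"
proof -
  obtain E where E: "has_partials \<phi> E" and Ec: "continuous_on UNIV (E j)" and Eb: "bounded (range (E j))"
    and pb: "bounded (range \<phi>)"
    using \<phi> unfolding test_function_def by blast
  have Ej: "partial_deriv j \<phi> = E j" using has_partials_partial_deriv[OF E] .
  define R where "R x = D j x + P x * L j x" for x
  have R: "cpoly R" unfolding R_def by (intro cpoly_intros P D L)
  have g1: "gaussian_bounded (\<lambda>x. \<phi> x * (P x * exp (\<Phi> x)))"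
    by (intro gaussian_bounded_mult poly_exp_gaussian poly_bounded_bounded P pb)
  have g2: "gaussian_bounded (\<lambda>x. \<phi> x * (R x * exp (\<Phi> x)))"
    by (intro gaussian_bounded_mult poly_exp_gaussian poly_bounded_bounded R pb)
  have g3: "gaussian_bounded (\<lambda>x. E j x * (P x * exp (\<Phi> x)))"
    by (intro gaussian_bounded_mult poly_exp_gaussian poly_bounded_bounded P Eb)
  have m2: "(\<lambda>x. \<phi> x * (R x * exp (\<Phi> x))) \<in> borel_measurable borel"
    using poly_exp_measurable[OF R] test_function_measurable[OF \<phi>] by (rule borel_measurable_times[rotated])
  have m3: "(\<lambda>x. E j x * (P x * exp (\<Phi> x))) \<in> borel_measurable borel"
    using poly_exp_measurable[OF P] borel_measurable_continuous_onI[OF Ec] by (rule borel_measurable_times[rotated])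
  have i2: "integrable lborel (\<lambda>x. \<phi> x * (R x * exp (\<Phi> x)))"
    by (rule gaussian_bounded_integrable[OF g2 m2])
  have i3: "integrable lborel (\<lambda>x. E j x * (P x * exp (\<Phi> x)))"
    by (rule gaussian_bounded_integrable[OF g3 m3])
  have hp: "has_partials (\<lambda>x. \<phi> x * (P x * exp (\<Phi> x)))
      (\<lambda>j x. E j x * (P x * exp (\<Phi> x)) + \<phi> x * ((D j x + P x * L j x) * exp (\<Phi> x)))"
    by (rule has_partials_mult[OF E poly_exp_partials[OF D(1)]])
  obtain C1 e1 where e1: "e1 > 0" "\<And>x. norm (\<phi> x * (R x * exp (\<Phi> x))) \<le> C1 * exp (- (e1 * (norm x)\<^sup>2))"
    using g2 unfolding gaussian_bounded_def by blast
  obtain C2 e2 where e2: "e2 > 0" "\<And>x. norm (E j x * (P x * exp (\<Phi> x))) \<le> C2 * exp (- (e2 * (norm x)\<^sup>2))"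
    using g3 unfolding gaussian_bounded_def by blast
  have C1: "0 \<le> C1" using order_trans[OF norm_ge_zero e1(2)[of 0]] by simp
  have C2: "0 \<le> C2" using order_trans[OF norm_ge_zero e2(2)[of 0]] by simp
  have "norm (E j x * (P x * exp (\<Phi> x)) + \<phi> x * (R x * exp (\<Phi> x)))
      \<le> (C1 + C2) * exp (- (min e1 e2 * (norm x)\<^sup>2))" for x
  proof -
    have "C1 * exp (- (e1 * (norm x)\<^sup>2)) \<le> C1 * exp (- (min e1 e2 * (norm x)\<^sup>2))"
      using C1 by (intro mult_left_mono) (auto intro: mult_right_mono)
    moreover have "C2 * exp (- (e2 * (norm x)\<^sup>2)) \<le> C2 * exp (- (min e1 e2 * (norm x)\<^sup>2))"
      using C2 by (intro mult_left_mono) (auto intro: mult_right_mono)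
    ultimately show ?thesis
      using norm_triangle_ineq[of "E j x * (P x * exp (\<Phi> x))" "\<phi> x * (R x * exp (\<Phi> x))"] e1(2)[of x] e2(2)[of x]
      by (simp add: distrib_right)
  qed
  then have g4: "gaussian_bounded (\<lambda>x. E j x * (P x * exp (\<Phi> x)) + \<phi> x * (R x * exp (\<Phi> x)))"
    unfolding gaussian_bounded_def using e1(1) e2(1) by (metis min_less_iff_conj)
  have "(LINT x|lborel. E j x * (P x * exp (\<Phi> x)) + \<phi> x * (R x * exp (\<Phi> x))) = 0"
  proof (rule integral_directional_derivative_0[OF _ _ g1 g4])
    show "((\<lambda>x. \<phi> x * (P x * exp (\<Phi> x))) has_derivative
       (\<lambda>h. \<Sum>j\<in>UNIV. of_real (h $ j) * (E j x * (P x * exp (\<Phi> x)) + \<phi> x * ((D j x + P x * L j x) * exp (\<Phi> x))))) (at x)" for x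
      using hp unfolding has_partials_def by blast
    show "(\<Sum>k\<in>UNIV. of_real (axis j 1 $ k) * (E k x * (P x * exp (\<Phi> x)) + \<phi> x * ((D k x + P x * L k x) * exp (\<Phi> x))))
      = E j x * (P x * exp (\<Phi> x)) + \<phi> x * (R x * exp (\<Phi> x))" for x
      by (subst sum_axis) (simp add: R_def)
  qed (use m2 m3 in auto)
  then have "(LINT x|lborel. E j x * (P x * exp (\<Phi> x))) = - (LINT x|lborel. \<phi> x * (R x * exp (\<Phi> x)))"
    using i2 i3 by (simp add: eq_neg_iff_add_eq_0)
  then show ?thesis by (simp add: Ej R_def mult_ac)
qed

end

section \<open>Weyl operators on Gaussians and curves in $L^2$\<close>

fun phase_symbol :: "('n \<Rightarrow> real^'n \<Rightarrow> complex) \<Rightarrow> 'n + 'n \<Rightarrow> real^'n \<Rightarrow> complex" where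
  "phase_symbol L (Inl j) x = of_real (x $ j)"
| "phase_symbol L (Inr j) x = - \<i> * L j x"

text \<open>
  On $e^\Phi$ the operator $X_a X_b$ acts as multiplication by $\ell_a \ell_b$ plus a constant that comes
  from $D_{x_k}$ hitting the affine function $\ell_b$, where $\ell_a$ is \<open>phase_symbol L a\<close>.
\<close>

fun symbol_correction :: "('n \<Rightarrow> 'n \<Rightarrow> complex) \<Rightarrow> 'n + 'n \<Rightarrow> 'n + 'n \<Rightarrow> complex" where
  "symbol_correction Z (Inl k) b = 0"
| "symbol_correction Z (Inr k) (Inl j) = (if k = j then - \<i> else 0)"
| "symbol_correction Z (Inr k) (Inr j) = - \<i> * Z k j"

definition weyl_symbol ::
    "('n \<Rightarrow> real^'n \<Rightarrow> complex) \<Rightarrow> ('n \<Rightarrow> 'n \<Rightarrow> complex) \<Rightarrow> complex^('n::finite + 'n)^('n + 'n) \<Rightarrow> real^'n \<Rightarrow> complex" where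
  "weyl_symbol L Z Q x = (\<Sum>a\<in>UNIV. \<Sum>b\<in>UNIV.
     Q $ a $ b * (phase_symbol L a x * phase_symbol L b x + symbol_correction Z a b))"

text \<open>A quadratic exponent with Hessian iZ. Since the Hessian is constant in x, a second
  derivative falling on an affine symbol leaves only a constant.\<close>

locale affine_gaussian_exponent = gaussian_exponent \<Phi> L \<epsilon> K
  for \<Phi> :: "real^'n::finite \<Rightarrow> complex" and L \<epsilon> K +
  fixes Z :: "'n \<Rightarrow> 'n \<Rightarrow> complex"
  assumes L_partials: "\<And>j. has_partials (L j) (\<lambda>k x. \<i> * Z k j)"
begin

lemma cpoly_phase_symbol: "cpoly (phase_symbol L a)"
proof (cases a)
  case (Inl j)
  then have "phase_symbol L a = (\<lambda>x. of_real (x $ j))" by auto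
  then show ?thesis using cpoly_coord by metis
next
  case (Inr j)
  then have "phase_symbol L a = (\<lambda>x. (- \<i>) * L j x)" by auto
  then show ?thesis using cpoly_mult[OF cpoly_const L] by metis
qed

lemma phase_symbol_partials:
  "has_partials (phase_symbol L b) (\<lambda>k x. \<i> * symbol_correction Z (Inr k) b)"
proof (cases b)
  case (Inl j)
  then have "phase_symbol L b = (\<lambda>x. of_real (x $ j))" by auto
  moreover have "(\<lambda>k x::real^'n. \<i> * symbol_correction Z (Inr k) b) = (\<lambda>k x. if k = j then 1 else 0)"
    using Inl by (auto simp: fun_eq_iff)
  ultimately show ?thesis using has_partials_coord[of j] by simp
next
  case (Inr j)
  then have "phase_symbol L b = (\<lambda>x. (- \<i>) * L j x)" by auto
  moreover have "(\<lambda>k x::real^'n. \<i> * symbol_correction Z (Inr k) b) = (\<lambda>k x. 0 * L j x + (- \<i>) * (\<i> * Z k j))"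
    using Inr by (auto simp: fun_eq_iff)
  ultimately show ?thesis using has_partials_mult[OF has_partials_const L_partials, of "- \<i>" j] by simp
qed

lemma poly_exp_test_integrable:
  assumes "cpoly P" "test_function \<phi>"
  shows "integrable lborel (\<lambda>x. P x * exp (\<Phi> x) * \<phi> x)"
proof -
  have "integrable lborel (\<lambda>x. \<phi> x * (P x * exp (\<Phi> x)))"
  proof (rule gaussian_bounded_integrable)
    show "gaussian_bounded (\<lambda>x. \<phi> x * (P x * exp (\<Phi> x)))"
      using assms(2) unfolding test_function_def
      by (intro gaussian_bounded_mult poly_exp_gaussian poly_bounded_bounded assms) auto
    show "(\<lambda>x. \<phi> x * (P x * exp (\<Phi> x))) \<in> borel_measurable borel"
      using test_function_measurable[OF assms(2)] poly_exp_measurable[OF assms(1)]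
      by (rule borel_measurable_times)
  qed
  then show ?thesis by (simp add: mult_ac)
qed

lemma exp_sq_integrable: "sq_integrable (\<lambda>x. exp (\<Phi> x))"
  using poly_exp_sq_integrable[OF cpoly_const[of 1]] by simp

abbreviation state :: "(real^'n) L2" where "state \<equiv> abs_L2 (\<lambda>x. exp (\<Phi> x))"

text \<open>For momenta, the factor i of \<open>phase_op\<close> meets the minus sign of the
  integration by parts, which gives the symbol -iL.\<close>

lemma phase_op_state:
  assumes "test_function \<phi>"
  shows "phase_op b (L2_distr state) \<phi> = (LINT x|lborel. phase_symbol L b x * exp (\<Phi> x) * \<phi> x)"
proof (cases b)
  case (Inl j)
  have m: "(\<lambda>x. of_real (x $ j) * \<phi> x) \<in> borel_measurable borel"
    by (intro borel_measurable_times[OF borel_measurable_continuous_onI test_function_measurable[OF assms]]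
        continuous_intros)
  show ?thesis using L2_distr_abs[OF exp_sq_integrable m] by (simp add: Inl mult_ac)
next
  case (Inr j)
  have m: "partial_deriv j \<phi> \<in> borel_measurable borel"
  proof -
    obtain D where "has_partials \<phi> D" "continuous_on UNIV (D j)"
      using assms unfolding test_function_def by blast
    then show ?thesis using has_partials_partial_deriv[of \<phi> D j] borel_measurable_continuous_onI by metis
  qed
  have "phase_op b (L2_distr state) \<phi> = \<i> * (LINT x|lborel. 1 * exp (\<Phi> x) * partial_deriv j \<phi> x)"
    using L2_distr_abs[OF exp_sq_integrable m] by (simp add: Inr)
  also have "\<dots> = \<i> * - (LINT x|lborel. (0 + 1 * L j x) * exp (\<Phi> x) * \<phi> x)"
    by (subst poly_exp_by_parts[OF cpoly_const has_partials_const cpoly_const assms]) simp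
  also have "\<dots> = (LINT x|lborel. (- \<i>) * (L j x * exp (\<Phi> x) * \<phi> x))"
    by (subst integral_mult_right_zero) simp
  finally show ?thesis by (simp add: Inr mult_ac)
qed

text \<open>The outer operator acts on the test function first, so \<open>phase_op_state\<close>
  applies to x_j \<phi> or to the j-th partial derivative of \<phi>. In the second case another
  integration by parts moves the derivative back, now across the affine symbol of \<open>b\<close>,
  and this produces the correction.\<close>

lemma phase_op_phase_op_state:
  assumes "schwartz \<phi>"
  shows "phase_op a (phase_op b (L2_distr state)) \<phi> =
     (LINT x|lborel. (phase_symbol L a x * phase_symbol L b x + symbol_correction Z a b) * exp (\<Phi> x) * \<phi> x)"
proof (cases a)
  case (Inl j)
  show ?thesis using phase_op_state[OF test_function_coord[OF assms]] by (simp add: Inl mult_ac)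
next
  case (Inr j)
  have t: "test_function \<phi>" "test_function (partial_deriv j \<phi>)"
    using test_function_partial_deriv[OF assms, of "[]"] test_function_partial_deriv[OF assms, of "[j]"] by auto
  have "phase_op a (phase_op b (L2_distr state)) \<phi>
      = \<i> * (LINT x|lborel. phase_symbol L b x * exp (\<Phi> x) * partial_deriv j \<phi> x)"
    using phase_op_state[OF t(2)] by (simp add: Inr)
  also have "\<dots> = \<i> * - (LINT x|lborel. (\<i> * symbol_correction Z (Inr j) b + phase_symbol L b x * L j x) * exp (\<Phi> x) * \<phi> x)"
    by (subst poly_exp_by_parts[OF cpoly_phase_symbol phase_symbol_partials cpoly_const t(1)]) simp
  also have "\<dots> = (LINT x|lborel. (- \<i>) * ((\<i> * symbol_correction Z (Inr j) b + phase_symbol L b x * L j x) * exp (\<Phi> x) * \<phi> x))"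
    by (subst integral_mult_right_zero) simp
  also have "\<dots> = (LINT x|lborel. (phase_symbol L a x * phase_symbol L b x + symbol_correction Z a b) * exp (\<Phi> x) * \<phi> x)"
    by (intro Bochner_Integration.integral_cong) (auto simp: Inr algebra_simps)
  finally show ?thesis .
qed

lemma linear_weyl_state:
  assumes "test_function \<phi>"
  shows "linear_weyl X0 (L2_distr state) \<phi> =
    (LINT x|lborel. (\<Sum>a\<in>UNIV. of_real (X0 $ a) * phase_symbol L a x) * exp (\<Phi> x) * \<phi> x)"
proof -
  have "linear_weyl X0 (L2_distr state) \<phi>
      = (\<Sum>a\<in>UNIV. LINT x|lborel. of_real (X0 $ a) * (phase_symbol L a x * exp (\<Phi> x) * \<phi> x))"
    unfolding linear_weyl_def phase_op_state[OF assms] by (subst integral_mult_right_zero) simp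
  also have "\<dots> = (LINT x|lborel. (\<Sum>a\<in>UNIV. of_real (X0 $ a) * (phase_symbol L a x * exp (\<Phi> x) * \<phi> x)))"
    by (intro Bochner_Integration.integral_sum[symmetric] integrable_mult_right
        poly_exp_test_integrable cpoly_phase_symbol assms)
  also have "\<dots> = (LINT x|lborel. (\<Sum>a\<in>UNIV. of_real (X0 $ a) * phase_symbol L a x) * exp (\<Phi> x) * \<phi> x)"
    by (simp only: sum_distrib_right mult.assoc)
  finally show ?thesis .
qed

lemma cpoly_weyl_symbol: "cpoly (weyl_symbol L Z Q)"
  unfolding weyl_symbol_def[abs_def] by (intro cpoly_sum cpoly_intros cpoly_phase_symbol)

text \<open>The graph has the maximal domain, so an identity of distributions between two elements
  of L^2 is all that membership asks for; no core or closure enters.\<close>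

lemma quadratic_weyl_graph_state:
  "(state, abs_L2 (\<lambda>x. weyl_symbol L Z Q x * exp (\<Phi> x))) \<in> quadratic_weyl_graph Q"
  unfolding quadratic_weyl_graph_def distr_eq_def mem_Collect_eq prod.case
proof (intro allI impI)
  fix \<phi> :: "real^'n \<Rightarrow> complex" assume \<phi>: "schwartz \<phi>"
  have t: "test_function \<phi>" using test_function_partial_deriv[OF \<phi>, of "[]"] by simp
  have i: "integrable lborel (\<lambda>x. Q $ a $ b * ((phase_symbol L a x * phase_symbol L b x + symbol_correction Z a b) * exp (\<Phi> x) * \<phi> x))" for a b
    by (intro integrable_mult_right poly_exp_test_integrable cpoly_phase_symbol cpoly_intros t)
  have "quadratic_weyl Q (L2_distr state) \<phi> = (\<Sum>a\<in>UNIV. \<Sum>b\<in>UNIV. LINT x|lborel.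
       Q $ a $ b * ((phase_symbol L a x * phase_symbol L b x + symbol_correction Z a b) * exp (\<Phi> x) * \<phi> x))"
    unfolding quadratic_weyl_def phase_op_phase_op_state[OF \<phi>] by (subst integral_mult_right_zero) simp
  also have "\<dots> = (LINT x|lborel. (\<Sum>a\<in>UNIV. \<Sum>b\<in>UNIV.
       Q $ a $ b * ((phase_symbol L a x * phase_symbol L b x + symbol_correction Z a b) * exp (\<Phi> x) * \<phi> x)))"
    by (simp only: Bochner_Integration.integral_sum[of UNIV, OF Bochner_Integration.integrable_sum, OF i] Bochner_Integration.integral_sum[of UNIV, OF i])
  also have "\<dots> = (LINT x|lborel. weyl_symbol L Z Q x * exp (\<Phi> x) * \<phi> x)"
    by (simp only: weyl_symbol_def sum_distrib_right mult.assoc)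
  also have "\<dots> = L2_distr (abs_L2 (\<lambda>x. weyl_symbol L Z Q x * exp (\<Phi> x))) \<phi>"
    by (rule L2_distr_abs[symmetric])
       (intro poly_exp_sq_integrable cpoly_weyl_symbol test_function_measurable t)+
  finally show "quadratic_weyl Q (L2_distr state) \<phi> = L2_distr (abs_L2 (\<lambda>x. weyl_symbol L Z Q x * exp (\<Phi> x))) \<phi>" .
qed

end

section \<open>Curves in L^2 and uniqueness for contraction semigroups\<close>

lemma norm_abs_L2: "sq_integrable f \<Longrightarrow> norm (abs_L2 f) = sqrt (LINT x|lborel. (norm (f x))\<^sup>2)"
  by (rule norm_L2.abs_eq) (simp add: L2_eq_def)

lemma abs_L2_scale: "sq_integrable f \<Longrightarrow> r *\<^sub>R abs_L2 f = abs_L2 (\<lambda>x. r *\<^sub>R f x)"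
  by (subst scaleR_L2.abs_eq) (simp_all add: L2_eq_def scaleR_conv_of_real)

lemma abs_L2_diff:
  assumes "sq_integrable f" "sq_integrable g"
  shows "abs_L2 f - abs_L2 g = abs_L2 (\<lambda>x. f x - g x)"
proof -
  have "sq_integrable (\<lambda>x. - g x)" using sq_integrable_scale[OF assms(2), of "-1"] by simp
  then show ?thesis unfolding minus_L2_def using assms
    by (simp add: uminus_L2.abs_eq plus_L2.abs_eq L2_eq_def)
qed

lemma sq_integrable_diff: "sq_integrable f \<Longrightarrow> sq_integrable g \<Longrightarrow> sq_integrable (\<lambda>x. f x - g x)"
  using sq_integrable_add[of f "\<lambda>x. - g x"] sq_integrable_scale[of g "-1"] by simp

text \<open>A majorant G of the time derivative, uniform in s and square integrable in x, upgrades
  pointwise differentiability to L^2: by the mean value inequality increments are at most G |s - r|.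
  This makes the curve Lipschitz with constant the L^2 norm of G, and it dominates the difference
  quotients.\<close>

lemma
  fixes u :: "real \<Rightarrow> 'a::euclidean_space \<Rightarrow> complex"
  assumes sq: "\<And>s. s \<in> {0..t} \<Longrightarrow> sq_integrable (u s)"
    and sq': "\<And>s. s \<in> {0..t} \<Longrightarrow> sq_integrable (u' s)"
    and deriv: "\<And>s x. s \<in> {0..t} \<Longrightarrow> ((\<lambda>s. u s x) has_vector_derivative u' s x) (at s within {0..t})"
    and bound: "\<And>s x. s \<in> {0..t} \<Longrightarrow> norm (u' s x) \<le> G x"
    and G: "integrable lborel (\<lambda>x. (G x)\<^sup>2)"
  shows L2_curve_continuous: "continuous_on {0..t} (\<lambda>s. abs_L2 (u s))"
    and L2_curve_right_derivative: "\<And>s. 0 \<le> s \<Longrightarrow> s < t \<Longrightarrow>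
      ((\<lambda>h. (abs_L2 (u (s + h)) - abs_L2 (u s)) /\<^sub>R h) \<longlongrightarrow> abs_L2 (u' s)) (at_right 0)"
proof -
  have lip: "norm (u s x - u r x) \<le> G x * \<bar>s - r\<bar>" if "s \<in> {0..t}" "r \<in> {0..t}" for s r x
  proof -
    have "norm (u s x - u r x) \<le> G x * norm (s - r)"
    proof (rule differentiable_bound[where S = "{0..t}" and f' = "\<lambda>r d. d *\<^sub>R u' r x"])
      show "((\<lambda>s. u s x) has_derivative (\<lambda>d. d *\<^sub>R u' r x)) (at r within {0..t})" if "r \<in> {0..t}" for r
        using deriv[OF that] unfolding has_vector_derivative_def .
      show "onorm (\<lambda>d::real. d *\<^sub>R u' r x) \<le> G x" if "r \<in> {0..t}" for r
        using bound[OF that, of x]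
        by (intro onorm_le) (auto simp: mult.commute[of _ "\<bar>_\<bar>"] intro!: mult_left_mono)
    qed (use that in auto)
    then show ?thesis by simp
  qed
  define c where "c = sqrt (LINT x|lborel. (G x)\<^sup>2)"
  have lip2: "norm (abs_L2 (u s) - abs_L2 (u r)) \<le> c * \<bar>s - r\<bar>" if sr: "s \<in> {0..t}" "r \<in> {0..t}" for s r
  proof -
    have "(LINT x|lborel. (norm (u s x - u r x))\<^sup>2) \<le> (LINT x|lborel. (G x)\<^sup>2 * \<bar>s - r\<bar>\<^sup>2)"
    proof (rule integral_mono)
      show "integrable lborel (\<lambda>x. (norm (u s x - u r x))\<^sup>2)"
        using sq_integrable_diff[OF sq sq] sr by (auto simp: sq_integrable_def)
      show "integrable lborel (\<lambda>x. (G x)\<^sup>2 * \<bar>s - r\<bar>\<^sup>2)"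
        using G by (rule integrable_mult_left)
      show "(norm (u s x - u r x))\<^sup>2 \<le> (G x)\<^sup>2 * \<bar>s - r\<bar>\<^sup>2" for x
        using power_mono[OF lip[OF sr, of x] norm_ge_zero, where n = 2] by (simp add: power_mult_distrib)
    qed
    also have "\<dots> = (LINT x|lborel. (G x)\<^sup>2) * \<bar>s - r\<bar>\<^sup>2" by simp
    finally have "sqrt (LINT x|lborel. (norm (u s x - u r x))\<^sup>2) \<le> sqrt ((LINT x|lborel. (G x)\<^sup>2) * \<bar>s - r\<bar>\<^sup>2)"
      by (rule real_sqrt_le_mono)
    also have "\<dots> = c * \<bar>s - r\<bar>" by (simp add: c_def real_sqrt_mult)
    finally show ?thesis
      using abs_L2_diff[OF sq sq, of s r] norm_abs_L2[OF sq_integrable_diff[OF sq sq], of s r] sr by simp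
  qed
  have c: "c \<ge> 0" by (simp add: c_def)
  show "continuous_on {0..t} (\<lambda>s. abs_L2 (u s))"
  proof (rule lipschitz_on_continuous_on)
    show "c-lipschitz_on {0..t} (\<lambda>s. abs_L2 (u s))"
      using lip2 c by (intro lipschitz_onI) (auto simp: dist_norm)
  qed
  fix s assume s: "0 \<le> s" "s < t"
  \<comment> \<open>Restricting h to this interval keeps s + h inside [0, t], where the hypotheses
    hold.\<close>
  define A where "A = {0<..<t - s}"
  have A: "at_right 0 = at 0 within A"
    unfolding A_def using s by (intro at_within_nhd[of _ "{..<t - s}"]) auto
  show "((\<lambda>h. (abs_L2 (u (s + h)) - abs_L2 (u s)) /\<^sub>R h) \<longlongrightarrow> abs_L2 (u' s)) (at_right 0)"
    unfolding A
  proof (subst tendsto_at_iff_sequentially, intro allI impI, unfold comp_def)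
    fix h assume "\<forall>i. h i \<in> A - {0}" and h0: "h \<longlonglongrightarrow> (0::real)"
    then have h: "0 < h i" "h i < t - s" for i unfolding A_def by auto
    have in_t: "s \<in> {0..t}" "s + h i \<in> {0..t}" for i using h[of i] s by auto
    define q where "q i x = (u (s + h i) x - u s x) /\<^sub>R h i - u' s x" for i x
    have sqd: "sq_integrable (\<lambda>x. (u (s + h i) x - u s x) /\<^sub>R h i)" for i
      unfolding scaleR_conv_of_real by (intro sq_integrable_scale sq_integrable_diff sq in_t)
    have sqq: "sq_integrable (q i)" for i
      unfolding q_def[abs_def] by (intro sq_integrable_diff sqd sq' in_t)
    have eq: "norm ((abs_L2 (u (s + h i)) - abs_L2 (u s)) /\<^sub>R h i - abs_L2 (u' s)) = sqrt (LINT x|lborel. (norm (q i x))\<^sup>2)" for i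
      unfolding abs_L2_diff[OF sq[OF in_t(2)] sq[OF in_t(1)]]
        abs_L2_scale[OF sq_integrable_diff[OF sq[OF in_t(2)] sq[OF in_t(1)]]]
        abs_L2_diff[OF sqd sq'[OF in_t(1)]]
      using norm_abs_L2[OF sqq[of i]] by (simp add: q_def[abs_def])
    have q0: "(\<lambda>i. q i x) \<longlonglongrightarrow> 0" for x
    proof -
      have "((\<lambda>y. (u y x - u s x) /\<^sub>R (y - s)) \<longlongrightarrow> u' s x) (at s within {0..t})"
        using deriv[OF in_t(1), of x] unfolding has_vector_derivative_iff_quotient .
      moreover have "filterlim (\<lambda>i. s + h i) (at s within {0..t}) sequentially"
        unfolding filterlim_at using h in_t tendsto_add[OF tendsto_const h0, of s]
        by (auto intro!: always_eventually) (metis less_irrefl)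
      ultimately have "(\<lambda>i. (u (s + h i) x - u s x) /\<^sub>R (s + h i - s)) \<longlonglongrightarrow> u' s x"
        by (rule filterlim_compose)
      then have "(\<lambda>i. (u (s + h i) x - u s x) /\<^sub>R h i) \<longlonglongrightarrow> u' s x" by simp
      from tendsto_diff[OF this tendsto_const[of "u' s x"]] show ?thesis by (simp add: q_def)
    qed
    have "(\<lambda>i. LINT x|lborel. (norm (q i x))\<^sup>2) \<longlonglongrightarrow> (LINT x|(lborel::'a measure). (0::real))"
    \<comment> \<open>The difference quotient and its limit are each bounded by G, so their
      difference is at most 2G and its square at most 4G^2.\<close>
    proof (rule integral_dominated_convergence[where w = "\<lambda>x. 4 * (G x)\<^sup>2"])
      show "integrable lborel (\<lambda>x. 4 * (G x)\<^sup>2)" using G by simp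
      show "AE x in lborel. (\<lambda>i. (norm (q i x))\<^sup>2) \<longlonglongrightarrow> 0"
        using tendsto_power[OF tendsto_norm[OF q0], where n = 2] by simp
      show "(\<lambda>x. (norm (q i x))\<^sup>2) \<in> borel_measurable lborel" for i
        using sqq[of i] unfolding sq_integrable_def by (intro borel_measurable_power borel_measurable_norm) auto
      show "AE x in lborel. norm ((norm (q i x))\<^sup>2) \<le> 4 * (G x)\<^sup>2" for i
      proof (rule AE_I2)
        fix x
        have "norm (u (s + h i) x - u s x) \<le> G x * h i"
          using lip[OF in_t(2)[of i] in_t(1), of x] h(1)[of i] by simp
        then have "norm ((u (s + h i) x - u s x) /\<^sub>R h i) \<le> G x"
          using h(1)[of i] by (simp add: divide_simps mult.commute)
        then have "norm (q i x) \<le> 2 * G x"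
          unfolding q_def using norm_triangle_ineq4[of "(u (s + h i) x - u s x) /\<^sub>R h i" "u' s x"]
            bound[OF in_t(1), of x] by linarith
        from power_mono[OF this norm_ge_zero, where n = 2] show "norm ((norm (q i x))\<^sup>2) \<le> 4 * (G x)\<^sup>2"
          by (simp add: power_mult_distrib)
      qed
    qed auto
    then have "(\<lambda>i. sqrt (LINT x|lborel. (norm (q i x))\<^sup>2)) \<longlonglongrightarrow> sqrt 0"
      by (intro tendsto_real_sqrt) simp
    then have "(\<lambda>i. (abs_L2 (u (s + h i)) - abs_L2 (u s)) /\<^sub>R h i - abs_L2 (u' s)) \<longlonglongrightarrow> 0"
      by (subst tendsto_norm_zero_iff[symmetric]) (simp only: eq real_sqrt_zero)
    then show "(\<lambda>i. (abs_L2 (u (s + h i)) - abs_L2 (u s)) /\<^sub>R h i) \<longlonglongrightarrow> abs_L2 (u' s)"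
      by (rule LIM_zero_cancel)
  qed
qed

text \<open>Continuous induction, since only right increments are controlled: the set of times up to
  which the bound holds has a supremum, continuity carries the bound to it, and the increment at
  that point would push it further if it were smaller than t.\<close>

lemma le_linear_if_right_increments_small:
  fixes f :: "real \<Rightarrow> real"
  assumes "t \<ge> 0" "continuous_on {0..t} f" "f 0 \<le> 0"
    and step: "\<And>s. 0 \<le> s \<Longrightarrow> s < t \<Longrightarrow> eventually (\<lambda>h. f (s + h) \<le> f s + \<epsilon> * h) (at_right 0)"
  shows "f t \<le> \<epsilon> * t"
proof -
  \<comment> \<open>The bound is required on all of [0, s], so that \<open>A\<close> is an initial
    segment and the bound holds strictly below its supremum.\<close>
  define A where "A = {s \<in> {0..t}. \<forall>r\<in>{0..s}. f r \<le> \<epsilon> * r}"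
  have A0: "0 \<in> A" using assms by (auto simp: A_def)
  have bdd: "bdd_above A" by (auto simp: A_def bdd_above_def)
  define m where "m = Sup A"
  have m: "0 \<le> m" "m \<le> t"
    unfolding m_def using A0 bdd by (auto intro!: cSup_upper cSup_least simp: A_def)
  have below: "f r \<le> \<epsilon> * r" if "0 \<le> r" "r < m" for r
  proof -
    obtain s where "s \<in> A" "r < s" using \<open>r < m\<close> A0 unfolding m_def by (metis less_cSupE empty_iff)
    then show ?thesis using that by (auto simp: A_def)
  qed
  have fm: "f m \<le> \<epsilon> * m"
  proof (cases "m = 0")
    case False
    then have m0: "m > 0" using m by simp
    have "continuous_on {0..m} (\<lambda>r. f r - \<epsilon> * r)"
      using m by (intro continuous_intros continuous_on_subset[OF assms(2)]) auto
    then have "((\<lambda>r. f r - \<epsilon> * r) \<longlongrightarrow> f m - \<epsilon> * m) (at m within {0..m})"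
      using m by (auto simp: continuous_on_def)
    moreover have "at m within {0..m} = at_left m"
      using m0 by (intro at_within_nhd[of _ "{0<..}"]) auto
    ultimately have "((\<lambda>r. f r - \<epsilon> * r) \<longlongrightarrow> f m - \<epsilon> * m) (at_left m)" by simp
    moreover have "eventually (\<lambda>r. f r - \<epsilon> * r \<le> 0) (at_left m)"
      unfolding eventually_at_left_field using m0 below by (intro exI[of _ 0]) auto
    ultimately have "f m - \<epsilon> * m \<le> 0" by (intro tendsto_upperbound) auto
    then show ?thesis by simp
  qed (use assms(3) in auto)
  have "m = t"
  proof (rule ccontr)
    assume "m \<noteq> t"
    then have "m < t" using m by simp
    from step[OF m(1) this] obtain b where b: "b > 0" "\<And>h. 0 < h \<Longrightarrow> h < b \<Longrightarrow> f (m + h) \<le> f m + \<epsilon> * h"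
      unfolding eventually_at_right_field by auto
    define d where "d = min (b / 2) (t - m)"
    have d: "0 < d" "d < b" "m + d \<le> t" using b \<open>m < t\<close> by (auto simp: d_def)
    have "m + d \<in> A"
      unfolding A_def
    proof (intro CollectI conjI ballI)
      fix r assume r: "r \<in> {0..m + d}"
      consider "r < m" | "r = m" | "r > m" by linarith
      then show "f r \<le> \<epsilon> * r"
      proof cases
        case 3
        then have "f (m + (r - m)) \<le> f m + \<epsilon> * (r - m)" using r d by (intro b) auto
        then show ?thesis using fm by (simp add: algebra_simps)
      qed (use below r fm in auto)
    qed (use d m in auto)
    then have "m + d \<le> m" unfolding m_def using bdd by (intro cSup_upper)
    then show False using d by simp
  qed
  then show ?thesis using fm by simp
qed

lemma contraction_semigroup_diff:
  assumes "contraction_semigroup T" "t \<ge> 0"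
  shows "T t (u - v) = T t u - T t v"
proof -
  have "T t (u - v) + T t v = T t (u - v + v)"
    using assms unfolding contraction_semigroup_def by metis
  then show ?thesis by (simp add: algebra_simps)
qed

text \<open>T(r+h)u - T(r)u = T(r)(T(h)u - u) has norm at most that of T(h)u - u, uniformly in r.
  Taking the smaller of two times as r turns right continuity at 0 into two-sided continuity
  everywhere.\<close>

lemma contraction_semigroup_continuous:
  assumes T: "contraction_semigroup T"
  shows "continuous_on {0..} (\<lambda>s. T s u)"
proof (rule continuous_onI)
  fix s e :: real assume s: "s \<in> {0..}" and e: "e > 0"
  have "((\<lambda>t. T t u) \<longlongrightarrow> u) (at_right 0)" using T by (auto simp: contraction_semigroup_def)
  then have "eventually (\<lambda>h. dist (T h u) u < e) (at_right 0)" using e by (rule tendstoD)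
  then obtain d where d: "d > 0" "\<And>h. 0 < h \<Longrightarrow> h < d \<Longrightarrow> dist (T h u) u < e"
    unfolding eventually_at_right_field by auto
  have *: "dist (T (r + h) u) (T r u) \<le> e" if "0 \<le> r" "0 < h" "h < d" for r h
  proof -
    have "T (r + h) u - T r u = T r (T h u - u)"
      using T that contraction_semigroup_diff[OF T that(1)] by (simp add: contraction_semigroup_def)
    then have "dist (T (r + h) u) (T r u) \<le> norm (T h u - u)"
      using T that(1) by (simp add: contraction_semigroup_def dist_norm)
    then show ?thesis using d(2)[OF that(2,3)] by (simp add: dist_norm)
  qed
  show "\<exists>d>0. \<forall>r\<in>{0..}. dist r s < d \<longrightarrow> dist (T r u) (T s u) \<le> e"
  proof (intro exI[of _ d] conjI ballI impI d(1))
    fix r :: real assume r: "r \<in> {0..}" "dist r s < d"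
    consider "r = s" | "r < s" | "s < r" by linarith
    then show "dist (T r u) (T s u) \<le> e"
    proof cases
      case 2
      then show ?thesis using *[of r "s - r"] r by (auto simp: dist_real_def dist_commute)
    next
      case 3
      then show ?thesis using *[of s "r - s"] r s by (auto simp: dist_real_def)
    qed (use e in auto)
  qed
qed

text \<open>At each s the curves U(s+h) and T(h)U(s) have the same right derivative at h = 0, so
  they differ by o(h), while contractivity prevents the error accumulated so far from growing. The
  error therefore stays below e s for every e > 0.\<close>

lemma contraction_semigroup_unique_solution:
  assumes T: "contraction_semigroup T" and t: "t \<ge> 0"
    and cont: "continuous_on {0..t} U"
    and gen: "\<And>s. 0 \<le> s \<Longrightarrow> s < t \<Longrightarrow> (U s, V s) \<in> generator_graph T"
    and deriv: "\<And>s. 0 \<le> s \<Longrightarrow> s < t \<Longrightarrow> ((\<lambda>h. (U (s + h) - U s) /\<^sub>R h) \<longlongrightarrow> V s) (at_right 0)"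
  shows "T t (U 0) = U t"
proof -
  define f where "f s = norm (U s - T s (U 0))" for s
  have "f t \<le> \<epsilon>" if "\<epsilon> > 0" for \<epsilon>
  proof -
    \<comment> \<open>Division by t + 1 instead of t also covers t = 0, and still gives e t \<le>
      \<epsilon>.\<close>
    define e where "e = \<epsilon> / (t + 1)"
    have e: "e > 0" using that t by (simp add: e_def)
    have "f t \<le> e * t"
    proof (rule le_linear_if_right_increments_small[OF t])
      show "continuous_on {0..t} f" unfolding f_def[abs_def]
        by (intro continuous_intros cont continuous_on_subset[OF contraction_semigroup_continuous[OF T]]) auto
      show "f 0 \<le> 0" using T by (simp add: f_def contraction_semigroup_def)
      fix s assume s: "0 \<le> s" "s < t"
      have "((\<lambda>h. (T h (U s) - U s) /\<^sub>R h) \<longlongrightarrow> V s) (at_right 0)"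
        using gen[OF s] by (simp add: generator_graph_def)
      from tendsto_diff[OF deriv[OF s] this]
      have "((\<lambda>h. (U (s + h) - U s) /\<^sub>R h - (T h (U s) - U s) /\<^sub>R h) \<longlongrightarrow> 0) (at_right 0)" by simp
      from tendstoD[OF this e]
      have "eventually (\<lambda>h. norm ((U (s + h) - U s) /\<^sub>R h - (T h (U s) - U s) /\<^sub>R h) < e) (at_right 0)"
        by simp
      moreover have "eventually (\<lambda>h. h > 0) (at_right (0::real))" by (rule eventually_at_right_less)
      ultimately show "eventually (\<lambda>h. f (s + h) \<le> f s + e * h) (at_right 0)"
      proof eventually_elim
        fix h :: real assume h: "norm ((U (s + h) - U s) /\<^sub>R h - (T h (U s) - U s) /\<^sub>R h) < e" "h > 0"
        have "(U (s + h) - U s) /\<^sub>R h - (T h (U s) - U s) /\<^sub>R h = (U (s + h) - T h (U s)) /\<^sub>R h"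
          by (simp add: algebra_simps)
        then have n: "norm (U (s + h) - T h (U s)) \<le> e * h"
          using h by (simp add: divide_simps mult.commute)
        \<comment> \<open>New error of the step from s to s + h plus the old error transported by
          T(h).\<close>
        have "U (s + h) - T (s + h) (U 0) = (U (s + h) - T h (U s)) + T h (U s - T s (U 0))"
          using contraction_semigroup_diff[OF T, of h] T h s
          by (simp add: contraction_semigroup_def add.commute[of s h])
        then have "f (s + h) \<le> norm (U (s + h) - T h (U s)) + norm (T h (U s - T s (U 0)))"
          unfolding f_def by (metis norm_triangle_ineq)
        also have "norm (T h (U s - T s (U 0))) \<le> f s"
          using T h by (simp add: f_def contraction_semigroup_def)
        finally show "f (s + h) \<le> f s + e * h" using n by linarith
      qed
    qed
    also have "\<dots> \<le> \<epsilon>" using t that by (simp add: e_def field_simps)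
    finally show ?thesis .
  qed
  then have "f t \<le> 0" by (rule field_le_epsilon[of "f t" 0, simplified])
  then show ?thesis by (simp add: f_def)
qed

section \<open>The complex Hamiltonian flow\<close>

text \<open>Stated coordinatewise, so that products and conjugates of coordinates can be
  differentiated as complex scalars.\<close>

definition solves :: "complex^'m^'m \<Rightarrow> (real \<Rightarrow> complex^'m) \<Rightarrow> bool" where
  "solves A X \<longleftrightarrow> (\<forall>s a. ((\<lambda>s. X s $ a) has_vector_derivative (A *v X s) $ a) (at s))"

text \<open>The exponential series, summed in each coordinate as a power series in s. Its
  coefficients are the iterates A^k v divided by k!, so the trajectory is real as soon as all
  iterates are; A itself may be complex.\<close>

lemma linear_flow_exists:
  fixes A :: "complex^'m^'m"
  obtains X where "solves A X" "X 0 = v"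
    "(\<And>k a. (((*v) A ^^ k) v) $ a \<in> \<real>) \<Longrightarrow> (\<And>s a. X s $ a \<in> \<real>)"
proof -
  define p where "p k = ((*v) A ^^ k) v" for k
  have p_Suc: "p (Suc k) = A *v p k" for k by (simp add: p_def)
  \<comment> \<open>The sum of all entries bounds every row sum, which gives growth at most B R^k
    for the iterates and hence an exponential majorant.\<close>
  define R where "R = (\<Sum>a\<in>UNIV. \<Sum>b\<in>UNIV. norm (A $ a $ b))"
  define B where "B = (\<Sum>a\<in>UNIV. norm (v $ a))"
  have R: "R \<ge> 0" unfolding R_def by (intro sum_nonneg) auto
  have B: "B \<ge> 0" unfolding B_def by (intro sum_nonneg) auto
  have row: "(\<Sum>b\<in>UNIV. norm (A $ a $ b)) \<le> R" for a
    unfolding R_def by (rule member_le_sum) (auto intro: sum_nonneg)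
  have bound: "norm (p k $ a) \<le> B * R ^ k" for k a
  proof (induction k arbitrary: a)
    case 0
    show ?case unfolding B_def p_def by (simp, rule member_le_sum) auto
  next
    case (Suc k)
    have "norm (p (Suc k) $ a) \<le> (\<Sum>b\<in>UNIV. norm (A $ a $ b * p k $ b))"
      unfolding p_Suc by (simp add: matrix_vector_mult_def norm_sum)
    also have "\<dots> \<le> (\<Sum>b\<in>UNIV. norm (A $ a $ b) * (B * R ^ k))"
      by (intro sum_mono) (simp add: norm_mult mult_left_mono Suc.IH)
    also have "\<dots> = (\<Sum>b\<in>UNIV. norm (A $ a $ b)) * (B * R ^ k)" by (simp add: sum_distrib_right)
    also have "\<dots> \<le> R * (B * R ^ k)" using B R by (intro mult_right_mono row) auto
    finally show ?case by (simp add: mult_ac)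
  qed
  define c where "c a k = p k $ a / fact k" for a k
  have summ: "summable (\<lambda>k. c a k * z ^ k)" for a and z :: complex
  proof (rule summable_comparison_test')
    show "summable (\<lambda>k. B * ((R * norm z) ^ k /\<^sub>R fact k))"
      by (intro summable_mult summable_exp_generic)
    show "norm (c a k * z ^ k) \<le> B * ((R * norm z) ^ k /\<^sub>R fact k)" for k
    proof -
      have "norm (c a k * z ^ k) = norm (p k $ a) * norm z ^ k / fact k"
        by (simp add: c_def norm_mult norm_divide norm_power)
      also have "\<dots> \<le> (B * R ^ k) * norm z ^ k / fact k"
        by (intro divide_right_mono mult_right_mono bound) auto
      finally show ?thesis by (simp add: power_mult_distrib divide_inverse mult_ac)
    qed
  qed
  define X where "X s = (\<chi> a. \<Sum>k. c a k * of_real s ^ k)" for s :: real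
  have sol: "solves A X" unfolding solves_def
  proof (intro allI)
    fix s a
    \<comment> \<open>The differentiated series has coefficient (k+1) c_{k+1} = (A^{k+1} v)_a / k!,
      which is row a of A applied to the k-th coefficients.\<close>
    have d: "diffs (c a) k = (\<Sum>b\<in>UNIV. A $ a $ b * c b k)" for k
    proof -
      have "diffs (c a) k = p (Suc k) $ a / fact k"
        unfolding diffs_def c_def by (simp add: divide_simps fact_reduce del: of_nat_Suc)
      also have "\<dots> = (\<Sum>b\<in>UNIV. A $ a $ b * c b k)"
        unfolding p_Suc c_def by (simp add: matrix_vector_mult_def sum_divide_distrib)
      finally show ?thesis .
    qed
    have "(\<Sum>k. diffs (c a) k * of_real s ^ k) = (\<Sum>k. \<Sum>b\<in>UNIV. A $ a $ b * (c b k * of_real s ^ k))"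
      unfolding d by (simp add: sum_distrib_right mult.assoc)
    also have "\<dots> = (\<Sum>b\<in>UNIV. \<Sum>k. A $ a $ b * (c b k * of_real s ^ k))"
      by (intro suminf_sum summable_mult summ)
    also have "\<dots> = (A *v X s) $ a"
      unfolding X_def matrix_vector_mult_def by (simp add: suminf_mult summ)
    finally have e: "(\<Sum>k. diffs (c a) k * of_real s ^ k) = (A *v X s) $ a" .
    have "((\<lambda>z. \<Sum>k. c a k * z ^ k) has_field_derivative (A *v X s) $ a) (at (of_real s))"
      using termdiffs_strong_converges_everywhere[OF summ] e by metis
    from has_vector_derivative_real_field[OF this]
    show "((\<lambda>s. X s $ a) has_vector_derivative (A *v X s) $ a) (at s)" by (simp add: X_def)
  qed
  have X0: "X 0 = v"
    using powser_zero[of "c _"] by (simp add: X_def vec_eq_iff) (simp add: c_def p_def)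
  have "X s $ a \<in> \<real>" if re: "\<And>k a. (((*v) A ^^ k) v) $ a \<in> \<real>" for s a
  proof -
    have "c a k * of_real s ^ k \<in> \<real>" for k
    proof -
      have "(fact k :: complex) \<in> \<real>" by (metis of_real_fact Reals_of_real)
      then show ?thesis
        using re unfolding c_def p_def by (intro Reals_mult Reals_divide Reals_power) auto
    qed
    then have "Im (c a k * of_real s ^ k) = 0" for k by (rule complex_is_Real_iff[THEN iffD1])
    moreover have "(\<lambda>k. Im (c a k * of_real s ^ k)) sums Im (X s $ a)"
      using sums_Im[OF summable_sums[OF summ[of a "of_real s"]]] by (simp add: X_def)
    ultimately have "(\<lambda>k. 0) sums Im (X s $ a)" by (simp only:)
    then have "Im (X s $ a) = 0" by (rule sums_unique2[OF _ sums_zero])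
    then show ?thesis by (simp add: complex_is_Real_iff)
  qed
  then show ?thesis using that sol X0 by blast
qed

lemma solves_shift:
  assumes "solves A X" shows "solves A (\<lambda>s. X (s - t))"
  unfolding solves_def
proof (intro allI)
  fix s a
  have "((\<lambda>s. X s $ a) \<circ> (\<lambda>s. s - t) has_vector_derivative 1 *\<^sub>R (A *v X (s - t)) $ a) (at s)"
    by (rule vector_diff_chain_at)
       (use assms in \<open>auto simp: solves_def intro!: derivative_eq_intros\<close>)
  then show "((\<lambda>s. X (s - t) $ a) has_vector_derivative (A *v X (s - t)) $ a) (at s)" by (simp add: o_def)
qed

lemma solves_combination:
  assumes "\<And>i. solves A (X i)" shows "solves A (\<lambda>s. \<Sum>i\<in>UNIV. v i *s X i s)"
  unfolding solves_def
proof (intro allI)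
  fix s a
  have "((\<lambda>s. \<Sum>i\<in>UNIV. v i * X i s $ a) has_vector_derivative (\<Sum>i\<in>UNIV. v i * (A *v X i s) $ a)) (at s)"
    using assms unfolding solves_def
    by (intro has_vector_derivative_sum has_vector_derivative_mult_right) auto
  moreover have "(\<Sum>i\<in>UNIV. v i * (A *v X i s) $ a) = (A *v (\<Sum>i\<in>UNIV. v i *s X i s)) $ a"
    by (simp add: matrix_vector_mult_def sum_distrib_left, subst sum.swap) (simp add: mult_ac)
  ultimately show "((\<lambda>s. (\<Sum>i\<in>UNIV. v i *s X i s) $ a) has_vector_derivative
      (A *v (\<Sum>i\<in>UNIV. v i *s X i s)) $ a) (at s)" by simp
qed

lemma sum_UNIV_sum: "(\<Sum>a\<in>(UNIV::('m::finite + 'n::finite) set). f a) = (\<Sum>i\<in>UNIV. f (Inl i)) + (\<Sum>j\<in>UNIV. f (Inr j))"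
  using sum.Plus[of "UNIV::'m set" "UNIV::'n set" f] by (simp add: comp_def)

text \<open>Hamilton's equations for -iq: the derivative of x is the \<xi>-gradient of -iq, and that
  of \<xi> is minus its x-gradient.\<close>

definition heat_flow :: "complex^('n::finite + 'n)^('n + 'n) \<Rightarrow> (real \<Rightarrow> complex^('n + 'n)) \<Rightarrow> bool" where
  "heat_flow Q X \<longleftrightarrow> solves (\<chi> a b. - (2 * \<i>) * hamilton_map Q $ a $ b) X"

lemma symplectic_J_mult:
  "(symplectic_J *v X) $ Inl j = X $ Inr j" "(symplectic_J *v X) $ Inr j = - X $ Inl j"
  unfolding matrix_vector_mult_def sum_UNIV_sum vec_lambda_beta symplectic_J_def
  by (auto simp: if_distrib[of "\<lambda>x. x * _"] cong: if_cong)

lemma heat_matrix_mult: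
  "((\<chi> a b. - (2 * \<i>) * hamilton_map Q $ a $ b) *v X) $ a = - (2 * \<i>) * (hamilton_map Q *v X) $ a"
  by (simp add: matrix_vector_mult_def sum_distrib_left mult_ac sum_negf)

lemma hamilton_map_mult:
  "(hamilton_map Q *v X) $ Inl j = (Q *v X) $ Inr j" "(hamilton_map Q *v X) $ Inr j = - (Q *v X) $ Inl j"
  unfolding hamilton_map_def by (simp_all add: matrix_vector_mul_assoc[symmetric] symplectic_J_mult)

lemma heat_flowD:
  assumes "heat_flow Q X"
  shows "((\<lambda>s. X s $ Inl j) has_vector_derivative - (2 * \<i>) * (Q *v X s) $ Inr j) (at s within S)"
    and "((\<lambda>s. X s $ Inr j) has_vector_derivative (2 * \<i>) * (Q *v X s) $ Inl j) (at s within S)"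
proof -
  have d: "((\<lambda>s. X s $ a) has_vector_derivative - (2 * \<i>) * (hamilton_map Q *v X s) $ a) (at s within S)" for a
    using assms unfolding heat_flow_def solves_def heat_matrix_mult by (blast intro: has_vector_derivative_at_within)
  show "((\<lambda>s. X s $ Inl j) has_vector_derivative - (2 * \<i>) * (Q *v X s) $ Inr j) (at s within S)"
    using d[of "Inl j"] by (simp add: hamilton_map_mult)
  show "((\<lambda>s. X s $ Inr j) has_vector_derivative (2 * \<i>) * (Q *v X s) $ Inl j) (at s within S)"
    using d[of "Inr j"] by (simp add: hamilton_map_mult)
qed

section \<open>Symplectic form and positivity along the flow, and its reality on the singular
  space\<close>

definition cdot :: "complex^'m \<Rightarrow> complex^'m \<Rightarrow> complex" where
  "cdot X Y = (\<Sum>a\<in>UNIV. X $ a * Y $ a)"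

lemma cdot_matrix: "cdot X (Q *v Y) = (\<Sum>a\<in>UNIV. \<Sum>b\<in>UNIV. Q $ a $ b * (X $ a * Y $ b))"
  by (simp add: cdot_def matrix_vector_mult_def sum_distrib_left mult_ac)

lemma cdot_symmetric:
  assumes "transpose Q = Q" shows "cdot X (Q *v Y) = cdot Y (Q *v X)"
proof -
  have Q: "Q $ a $ b = Q $ b $ a" for a b using assms by (metis transpose_def vec_lambda_beta)
  show ?thesis unfolding cdot_matrix by (subst sum.swap) (simp add: Q mult_ac)
qed

lemma cdot_add: "cdot (X + Y) Z = cdot X Z + cdot Y Z" "cdot X (Y + Z) = cdot X Y + cdot X Z"
  by (simp_all add: cdot_def distrib_left distrib_right sum.distrib)

lemma cdot_quadratic_add:
  assumes "transpose Q = Q"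
  shows "cdot (X + Y) (Q *v (X + Y)) = cdot X (Q *v X) + 2 * cdot X (Q *v Y) + cdot Y (Q *v Y)"
  using cdot_symmetric[OF assms, of Y X] by (simp add: cdot_add matrix_vector_right_distrib)

lemma cdot_split: "cdot X Y = (\<Sum>j\<in>UNIV. X $ Inl j * Y $ Inl j) + (\<Sum>j\<in>UNIV. X $ Inr j * Y $ Inr j)"
  by (simp add: cdot_def sum_UNIV_sum)

text \<open>The derivative of the bilinear symplectic form is 2i (X.QY - Y.QX), which vanishes by
  symmetry of Q. Without conjugation, the complex coefficient of the flow does no harm.\<close>

lemma heat_flow_symplectic:
  assumes Q: "transpose Q = Q" and X: "heat_flow Q X" and Y: "heat_flow Q Y"
  shows "(\<Sum>j\<in>UNIV. X s $ Inl j * Y s $ Inr j - X s $ Inr j * Y s $ Inl j)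
       = (\<Sum>j\<in>UNIV. X 0 $ Inl j * Y 0 $ Inr j - X 0 $ Inr j * Y 0 $ Inl j)"
proof -
  define f where "f s = (\<Sum>j\<in>UNIV. X s $ Inl j * Y s $ Inr j - X s $ Inr j * Y s $ Inl j)" for s
  have "(f has_vector_derivative 0) (at s)" for s
  proof -
    have "(f has_vector_derivative (\<Sum>j\<in>UNIV.
        (X s $ Inl j * (2 * \<i> * (Q *v Y s) $ Inl j) + - (2 * \<i>) * (Q *v X s) $ Inr j * Y s $ Inr j)
        - (X s $ Inr j * (- (2 * \<i>) * (Q *v Y s) $ Inr j) + 2 * \<i> * (Q *v X s) $ Inl j * Y s $ Inl j))) (at s)"
      unfolding f_def[abs_def]
      by (intro has_vector_derivative_sum has_vector_derivative_diff has_vector_derivative_mult heat_flowD X Y)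
    moreover have "(\<Sum>j\<in>UNIV.
        (X s $ Inl j * (2 * \<i> * (Q *v Y s) $ Inl j) + - (2 * \<i>) * (Q *v X s) $ Inr j * Y s $ Inr j)
        - (X s $ Inr j * (- (2 * \<i>) * (Q *v Y s) $ Inr j) + 2 * \<i> * (Q *v X s) $ Inl j * Y s $ Inl j))
      = 2 * \<i> * (cdot (X s) (Q *v Y s) - cdot (Y s) (Q *v X s))"
      unfolding cdot_split
      by (simp add: sum.distrib sum_subtractf sum_distrib_left sum_negf algebra_simps)
    ultimately show ?thesis using cdot_symmetric[OF Q, of "X s" "Y s"] by simp
  qed
  then obtain c where "\<And>s. f s = c"
    using has_vector_derivative_zero_constant[of UNIV f] by auto
  then show ?thesis unfolding f_def by metis
qed

text \<open>With X = U + iV for real U and V, the cross terms cancel by symmetry of Q and the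
  hermitian form becomes q(U) + q(V).\<close>

lemma Re_hermitian_nonneg:
  assumes q: "is_quadratic_form_matrix Q q" and nonneg: "\<And>X. Re (q X) \<ge> 0"
  shows "0 \<le> Re (\<Sum>a\<in>UNIV. cnj (X $ a) * (Q *v X) $ a)"
proof -
  define U V where "U = (\<chi> a. Re (X $ a))" and "V = (\<chi> a. Im (X $ a))"
  define cU cV where "cU = (\<chi> a. complex_of_real (U $ a))" and "cV = (\<chi> a. complex_of_real (V $ a))"
  have X: "X = cU + \<i> *s cV"
    by (simp add: vec_eq_iff cU_def cV_def U_def V_def complex_eq_iff)
  have sym: "transpose Q = Q" and qq: "q Y = cdot (\<chi> a. of_real (Y $ a)) (Q *v (\<chi> a. of_real (Y $ a)))" for Y
    using q unfolding is_quadratic_form_matrix_def cdot_matrix by (simp_all add: mult_ac)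
  have "(\<Sum>a\<in>UNIV. cnj (X $ a) * (Q *v X) $ a) = cdot (cU + (- \<i>) *s cV) (Q *v (cU + \<i> *s cV))"
    unfolding cdot_def X by (simp add: cU_def cV_def)
  also have "\<dots> = cdot cU (Q *v cU) + cdot cV (Q *v cV) + \<i> * (cdot cU (Q *v cV) - cdot cV (Q *v cU))"
    unfolding cdot_matrix
    by (simp add: sum.distrib sum_distrib_left sum_subtractf sum_negf algebra_simps)
  also have "\<dots> = q U + q V"
    using cdot_symmetric[OF sym, of cU cV] by (simp add: qq cU_def cV_def)
  finally show ?thesis using nonneg[of U] nonneg[of V] by simp
qed

text \<open>The derivative of this quantity is twice the real part of the hermitian form of Q at
  X(s).\<close>

lemma heat_flow_positive:
  assumes q: "is_quadratic_form_matrix Q q" and nonneg: "\<And>X. Re (q X) \<ge> 0"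
    and X: "heat_flow Q X" and s: "s \<ge> 0"
  shows "Im (\<Sum>j\<in>UNIV. cnj (X 0 $ Inl j) * X 0 $ Inr j) \<le> Im (\<Sum>j\<in>UNIV. cnj (X s $ Inl j) * X s $ Inr j)"
proof -
  define f where "f s = (\<Sum>j\<in>UNIV. cnj (X s $ Inl j) * X s $ Inr j)" for s
  define f' where "f' s = (\<Sum>j\<in>UNIV. cnj (X s $ Inl j) * (2 * \<i> * (Q *v X s) $ Inl j)
      + cnj (- (2 * \<i>) * (Q *v X s) $ Inr j) * X s $ Inr j)" for s
  have f: "(f has_vector_derivative f' s) (at s)" for s
    unfolding f_def[abs_def] f'_def
    by (intro has_vector_derivative_sum has_vector_derivative_mult heat_flowD X
        bounded_linear.has_vector_derivative[OF bounded_linear_cnj])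
  have "Im (f' s) = 2 * Re (\<Sum>a\<in>UNIV. cnj (X s $ a) * (Q *v X s) $ a)" for s
    unfolding f'_def sum_UNIV_sum
    by (simp add: sum.distrib sum_subtractf sum_distrib_left algebra_simps)
  then have pos: "0 \<le> Im (f' s)" for s
    using Re_hermitian_nonneg[OF q nonneg, of "X s"] by simp
  have d: "((\<lambda>s. Im (f s)) has_real_derivative Im (f' s)) (at s)" for s
    using bounded_linear.has_vector_derivative[OF bounded_linear_Im f]
    by (simp add: has_real_derivative_iff_has_vector_derivative)
  have "Im (f 0) \<le> Im (f s)"
    by (rule DERIV_nonneg_imp_nondecreasing[OF s]) (use d pos in blast)
  then show ?thesis by (simp add: f_def)
qed

text \<open>Serves, through Cramer's rule, to show that Z = N M^{-1} is differentiable.\<close>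

lemma det_differentiable:
  fixes A :: "real \<Rightarrow> complex^'n^'n"
  assumes "\<And>i j. (\<lambda>s. A s $ i $ j) differentiable (at s)"
  shows "(\<lambda>s. det (A s)) differentiable (at s)"
proof -
  have p: "(\<lambda>s. \<Prod>i\<in>UNIV. A s $ i $ p i) differentiable (at s)" for p
  proof -
    obtain D where "\<And>i j. ((\<lambda>s. A s $ i $ j) has_derivative D i j) (at s)"
      using assms unfolding differentiable_def by metis
    from has_derivative_prod[of UNIV "\<lambda>i s. A s $ i $ p i", OF this] show ?thesis
      unfolding differentiable_def by blast
  qed
  show ?thesis unfolding det_def
    by (intro differentiable_sum ballI differentiable_mult differentiable_const finite_permutations finite) (rule p)
qed

text \<open>Put Y_k = (Im F)^k Y. Membership in S says that Re F kills every Y_k, so F Y_k = i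
  Y_{k+1} and -2iF sends Y_k to 2 Y_{k+1}. All iterates of Y under -2iF are thus the real vectors
  2^k Y_k, and the series solution is real.\<close>

lemma singular_space_heat_flow:
  assumes "Y \<in> singular_space Q"
  obtains X where "heat_flow Q X" "\<And>a. X t $ a = of_real (Y $ a)" "\<And>s a. X s $ a \<in> \<real>"
proof -
  let ?F = "hamilton_map Q"
  let ?A = "\<chi> a b. - (2 * \<i>) * ?F $ a $ b"
  define emb :: "real^('a + 'a) \<Rightarrow> complex^('a + 'a)" where "emb u = (\<chi> a. of_real (u $ a))" for u
  define u where "u k = ((*v) (Im_mat ?F) ^^ k) Y" for k
  have Re0: "Re_mat ?F *v u k = 0" for k
    using assms by (simp add: singular_space_def u_def)
  have step: "?A *v (c *s emb (u k)) = (2 * c) *s emb (u (Suc k))" for c k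
  proof -
    have "(?F *v emb (u k)) $ a = of_real ((Re_mat ?F *v u k) $ a) + \<i> * of_real ((Im_mat ?F *v u k) $ a)" for a
      by (simp add: matrix_vector_mult_def emb_def Re_mat_def Im_mat_def complex_eq_iff)
    moreover have "Im_mat ?F *v u k = u (Suc k)" by (simp add: u_def)
    ultimately have "(?F *v emb (u k)) $ a = (\<i> *s emb (u (Suc k))) $ a" for a
      by (simp only: Re0) (simp add: emb_def)
    then have "?F *v emb (u k) = \<i> *s emb (u (Suc k))" by (subst vec_eq_iff) blast
    note F = this
    have "(?A *v (c *s emb (u k))) $ a = ((2 * c) *s emb (u (Suc k))) $ a" for a
    proof -
      have "(?A *v (c *s emb (u k))) $ a = - (2 * \<i>) * (?F *v (c *s emb (u k))) $ a"
        by (rule heat_matrix_mult)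
      also have "?F *v (c *s emb (u k)) = c *s (\<i> *s emb (u (Suc k)))"
        unfolding F[symmetric] by (rule vector_scalar_commute)
      also have "- (2 * \<i>) * (c *s (\<i> *s emb (u (Suc k)))) $ a = ((2 * c) *s emb (u (Suc k))) $ a"
        unfolding vector_smult_component using i_squared by algebra
      finally show ?thesis .
    qed
    then show ?thesis by (subst vec_eq_iff) blast
  qed
  have pow: "((*v) ?A ^^ k) (emb Y) = (2 ^ k) *s emb (u k)" for k
  proof (induction k)
    case 0 show ?case by (simp add: u_def)
  next
    case (Suc k) then show ?case using step by simp
  qed
  have re: "((*v) ?A ^^ k) (emb Y) $ a \<in> \<real>" for k a
    unfolding pow by (auto simp: emb_def intro!: Reals_mult Reals_power)
  obtain X where X: "solves ?A X" "X 0 = emb Y" "\<And>s a. X s $ a \<in> \<real>"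
    using linear_flow_exists[of ?A "emb Y"] re by metis
  show ?thesis
  \<comment> \<open>The equation is autonomous, so a translation in time places the prescribed value
    Y at time t.\<close>
  proof (rule that[of "\<lambda>s. X (s - t)"])
    show "heat_flow Q (\<lambda>s. X (s - t))" unfolding heat_flow_def by (rule solves_shift[OF X(1)])
    show "X (t - t) $ a = of_real (Y $ a)" for a by (simp add: X(2) emb_def)
  qed (rule X(3))
qed

section \<open>The Riccati equation\<close>

definition graph_vec :: "complex^'n^'n \<Rightarrow> complex^'n \<Rightarrow> complex^('n::finite + 'n)" where
  "graph_vec Z w = (\<chi> a. case a of Inl j \<Rightarrow> w $ j | Inr j \<Rightarrow> (Z *v w) $ j)"

lemma graph_vec_simps [simp]: "graph_vec Z w $ Inl j = w $ j" "graph_vec Z w $ Inr j = (Z *v w) $ j"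
  by (simp_all add: graph_vec_def)

lemma norm_complex_vec_squared: "(norm (v::complex^'n))\<^sup>2 = (\<Sum>i\<in>UNIV. (norm (v $ i))\<^sup>2)"
  by (simp add: norm_vec_def L2_set_def sum_nonneg)

definition cvec :: "real^'n \<Rightarrow> complex^'n" where
  "cvec x = (\<chi> j. of_real (x $ j))"

text \<open>Let M and N collect the position and momentum parts of n flow lines that start on the
  graph of iI. Energy growth makes M injective, so Z = N M^{-1} exists for all s \<ge> 0; the same
  inequality, read at w = Mv, gives positivity of Im Z. The flowed plane stays Lagrangian, so Z is
  symmetric. The Riccati equation is recorded only as an identity of quadratic forms.\<close>

lemma riccati_solution:
  fixes Q :: "complex^('n::finite + 'n)^('n + 'n)"
  assumes q: "is_quadratic_form_matrix Q q" and nonneg: "\<And>X. Re (q X) \<ge> 0"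
  obtains Z Z' :: "real \<Rightarrow> complex^'n^'n" where
    "\<And>s j k. 0 \<le> s \<Longrightarrow> ((\<lambda>s. Z s $ j $ k) has_vector_derivative Z' s $ j $ k) (at s)"
    "\<And>s j k. 0 \<le> s \<Longrightarrow> Z s $ j $ k = Z s $ k $ j"
    "\<And>s w. 0 \<le> s \<Longrightarrow> (\<Sum>j\<in>UNIV. w $ j * (Z' s *v w) $ j) = 2 * \<i> * cdot (graph_vec (Z s) w) (Q *v graph_vec (Z s) w)"
    "\<And>t. 0 \<le> t \<Longrightarrow> \<exists>\<epsilon>>0. \<forall>s\<in>{0..t}. \<forall>x::real^'n.
        \<epsilon> * (norm x)\<^sup>2 \<le> Im (\<Sum>j\<in>UNIV. cvec x $ j * (Z s *v cvec x) $ j)"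
proof -
  have Q: "transpose Q = Q" using q by (simp add: is_quadratic_form_matrix_def)
  have "\<exists>X. heat_flow Q X \<and> (\<forall>j. X 0 $ Inl j = axis i 1 $ j \<and> X 0 $ Inr j = \<i> * axis i 1 $ j)" for i :: 'n
  proof -
    \<comment> \<open>Z(0) = iI corresponds to the standard Gaussian, and the initial energy of the
      combination with coefficients v is exactly the squared norm of v.\<close>
    define v :: "complex^('n + 'n)" where
      "v = (\<chi> a. case a of Inl j \<Rightarrow> axis i 1 $ j | Inr j \<Rightarrow> \<i> * axis i 1 $ j)"
    obtain X where "heat_flow Q X" "X 0 = v" unfolding heat_flow_def by (rule linear_flow_exists)
    then show ?thesis by (intro exI[of _ X]) (simp add: v_def)
  qed
  then obtain W where W: "\<And>i. heat_flow Q (W i)"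
    and W0: "\<And>i j. W i 0 $ Inl j = axis i 1 $ j" "\<And>i j. W i 0 $ Inr j = \<i> * axis i 1 $ j" by metis
  define X where "X v s = (\<Sum>i\<in>UNIV. (v $ i) *s W i s)" for v :: "complex^'n" and s
  have X: "heat_flow Q (X v)" for v
    using W unfolding X_def[abs_def] heat_flow_def by (rule solves_combination)
  have X0: "X v 0 $ Inl j = v $ j" "X v 0 $ Inr j = \<i> * v $ j" for v j
  proof -
    have "(\<Sum>i\<in>UNIV. v $ i * axis i 1 $ j) = v $ j"
      by (subst sum.remove[of _ j]) (auto simp: axis_def intro!: sum.neutral)
    then show "X v 0 $ Inl j = v $ j" "X v 0 $ Inr j = \<i> * v $ j"
      by (simp_all add: X_def W0 sum_distrib_left[symmetric] mult.left_commute[of _ \<i>])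
  qed
  define M N where "M s = (\<chi> j i. W i s $ Inl j)" and "N s = (\<chi> j i. W i s $ Inr j)" for s
  have MX: "(M s *v v) $ j = X v s $ Inl j" and NX: "(N s *v v) $ j = X v s $ Inr j" for s v j
    by (simp_all add: M_def N_def X_def matrix_vector_mult_def mult.commute)
  have energy: "(norm v)\<^sup>2 \<le> Im (\<Sum>j\<in>UNIV. cnj ((M s *v v) $ j) * (N s *v v) $ j)" if "s \<ge> 0" for s v
  proof -
    have "Im (\<Sum>j\<in>UNIV. cnj (X v 0 $ Inl j) * X v 0 $ Inr j) = (norm v)\<^sup>2"
      unfolding norm_complex_vec_squared cmod_power2 Im_sum
      by (intro sum.cong) (simp_all add: X0 power2_eq_square)
    then show ?thesis using heat_flow_positive[OF q nonneg X that, of v] by (simp add: MX NX)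
  qed
  have det: "det (M s) \<noteq> 0" if s: "s \<ge> 0" for s
  proof -
    have "v = 0" if "M s *v v = 0" for v
      using energy[OF s, of v] that by simp
    then have "\<exists>B. B ** M s = mat 1" using matrix_left_invertible_ker[of "M s"] by blast
    then show ?thesis
      unfolding invertible_det_nz[symmetric] invertible_def using matrix_left_right_inverse by blast
  qed
  \<comment> \<open>Column \<open>k\<close> of M is replaced by the i-th unit vector; by Cramer's
    rule these determinants over det M are the entries of the inverse, hence differentiable in
    s.\<close>
  define cof where "cof s k i = (\<chi> a b. if b = k then axis i 1 $ a else M s $ a $ b)" for s k i
  define Minv where "Minv s = (\<chi> k i. det (cof s k i) / det (M s))" for s
  have inv: "M s *v (Minv s *v w) = w" "Minv s *v (M s *v w) = w" if s: "s \<ge> 0" for s w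
  proof -
    have col: "M s *v (\<chi> k. Minv s $ k $ i) = axis i 1" for i
      using cramer[OF det[OF s], of "\<chi> k. Minv s $ k $ i" "axis i 1"]
      by (simp add: Minv_def cof_def)
    have "(M s ** Minv s) $ a $ i = (M s *v (\<chi> k. Minv s $ k $ i)) $ a" for a i
      by (simp add: matrix_matrix_mult_def matrix_vector_mult_def)
    then have "(M s ** Minv s) $ a $ i = mat 1 $ a $ i" for a i
      by (simp add: col axis_def mat_def)
    then have 1: "M s ** Minv s = mat 1" by (simp add: vec_eq_iff)
    then have 2: "Minv s ** M s = mat 1" using matrix_left_right_inverse by blast
    show "M s *v (Minv s *v w) = w" "Minv s *v (M s *v w) = w"
      by (simp_all only: matrix_vector_mul_assoc 1 2 matrix_vector_mul_lid)
  qed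
  define Z where "Z s = N s ** Minv s" for s
  have ZM: "Z s *v (M s *v v) = N s *v v" if "s \<ge> 0" for s v
    unfolding Z_def matrix_vector_mul_assoc[symmetric] inv[OF that] ..
  have Wd: "(\<lambda>s. W i s $ a) differentiable (at s)" for i a s
    using W[of i] unfolding heat_flow_def solves_def differentiable_def has_vector_derivative_def by blast
  have Zd: "(\<lambda>s. Z s $ j $ k) differentiable (at s)" if "s \<ge> 0" for s j k
  proof -
    have M: "(\<lambda>s. det (M s)) differentiable (at s)"
      by (rule det_differentiable) (simp add: M_def Wd)
    have cof: "(\<lambda>s. det (cof s k i)) differentiable (at s)" for k i
    proof (rule det_differentiable)
      fix a b show "(\<lambda>s. cof s k i $ a $ b) differentiable (at s)"
        by (cases "b = k") (simp_all add: cof_def M_def Wd)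
    qed
    show ?thesis
      unfolding Z_def Minv_def matrix_matrix_mult_def vec_lambda_beta N_def
      by (intro differentiable_sum ballI differentiable_mult differentiable_divide Wd cof M det that) auto
  qed
  \<comment> \<open>Existence of the derivative is already known; its value is extracted later by
    differentiating \<xi> = Zx along the flow.\<close>
  define Z' where "Z' s = (\<chi> j k. vector_derivative (\<lambda>s. Z s $ j $ k) (at s))" for s
  have Z': "((\<lambda>s. Z s $ j $ k) has_vector_derivative Z' s $ j $ k) (at s)" if "0 \<le> s" for s j k
    using Zd[OF that, of j k] unfolding vector_derivative_works by (simp add: Z'_def)
  have sym: "Z s $ j $ k = Z s $ k $ j" if s: "0 \<le> s" for s j k
  proof -
    \<comment> \<open>The symplectic form vanishes on the graph of iI at time 0, hence on the flowed
      plane. Evaluated at the points over u and w, this is the symmetry of Z.\<close>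
    have *: "(\<Sum>l\<in>UNIV. u $ l * (Z s *v w) $ l) = (\<Sum>l\<in>UNIV. (Z s *v u) $ l * w $ l)" for u w
    proof -
      have "(\<Sum>l\<in>UNIV. X v s $ Inl l * X v' s $ Inr l - X v s $ Inr l * X v' s $ Inl l) = 0" for v v'
        using heat_flow_symplectic[OF Q X[of v] X[of v'], where s = s] by (simp add: X0)
      from this[of "Minv s *v u" "Minv s *v w"]
      show ?thesis
        unfolding MX[symmetric] NX[symmetric] ZM[OF s, symmetric] inv[OF s] by (simp add: sum_subtractf)
    qed
    have "(\<Sum>l\<in>UNIV. axis j 1 $ l * (Z s *v axis k 1) $ l) = (Z s *v axis k 1) $ j"
      by (subst sum.remove[of _ j]) (auto simp: axis_def intro!: sum.neutral)
    moreover have "(\<Sum>l\<in>UNIV. (Z s *v axis j 1) $ l * axis k 1 $ l) = (Z s *v axis j 1) $ k"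
      by (subst sum.remove[of _ k]) (auto simp: axis_def intro!: sum.neutral)
    moreover have "(Z s *v axis i 1) $ l = Z s $ l $ i" for i l
      unfolding matrix_vector_mult_def
      by (simp, subst sum.remove[of _ i]) (auto simp: axis_def intro!: sum.neutral)
    ultimately show ?thesis using *[of "axis j 1" "axis k 1"] by simp
  qed
  have ric: "(\<Sum>j\<in>UNIV. w $ j * (Z' s *v w) $ j) = 2 * \<i> * cdot (graph_vec (Z s) w) (Q *v graph_vec (Z s) w)"
    if s: "0 \<le> s" for s w
  proof -
    define v where "v = Minv s *v w"
    have w: "X v s $ Inl j = w $ j" "X v s $ Inr j = (Z s *v w) $ j" for j
      using inv[OF s, of w] ZM[OF s, of v] by (simp_all add: MX[symmetric] NX[symmetric] v_def)
    have Xs: "X v s = graph_vec (Z s) w"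
      unfolding vec_eq_iff by (metis graph_vec_simps w sum.exhaust)
    define Y where "Y = Q *v graph_vec (Z s) w"
    have QX: "Q *v X v s = Y" by (simp add: Xs Y_def)
    \<comment> \<open>Two computations of the derivative of \<xi> = Zx are compared. The identity is
      available for nonnegative times only, so at s = 0 the derivative must be one-sided; hence the
      neighbourhood \<open>{s..}\<close>.\<close>
    have e: "2 * \<i> * Y $ Inl j = (Z' s *v w) $ j - 2 * \<i> * (\<Sum>k\<in>UNIV. Z s $ j $ k * Y $ Inr k)" for j
    proof (rule vector_derivative_unique_within)
      show "at s within {s..} \<noteq> bot" by (simp add: at_within_Ici_at_right)
      show "((\<lambda>r. X v r $ Inr j) has_vector_derivative 2 * \<i> * Y $ Inl j) (at s within {s..})"
        using heat_flowD(2)[OF X, of v j s] unfolding QX .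
      have "((\<lambda>r. \<Sum>k\<in>UNIV. Z r $ j $ k * X v r $ Inl k) has_vector_derivative
          (\<Sum>k\<in>UNIV. Z s $ j $ k * (- (2 * \<i>) * Y $ Inr k) + Z' s $ j $ k * w $ k)) (at s within {s..})"
        unfolding w(1)[symmetric] QX[symmetric]
        by (intro has_vector_derivative_sum has_vector_derivative_mult heat_flowD X
            has_vector_derivative_at_within[OF Z'] s)
      then have "((\<lambda>r. \<Sum>k\<in>UNIV. Z r $ j $ k * X v r $ Inl k) has_vector_derivative
          (Z' s *v w) $ j - 2 * \<i> * (\<Sum>k\<in>UNIV. Z s $ j $ k * Y $ Inr k)) (at s within {s..})"
        by (simp add: sum.distrib sum_subtractf matrix_vector_mult_def[of "Z' s"] sum_distrib_left sum_negf mult_ac)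
      then show "((\<lambda>r. X v r $ Inr j) has_vector_derivative
          (Z' s *v w) $ j - 2 * \<i> * (\<Sum>k\<in>UNIV. Z s $ j $ k * Y $ Inr k)) (at s within {s..})"
      proof (rule has_vector_derivative_transform_within[where d = 1])
        fix r assume "r \<in> {s..}"
        then have "r \<ge> 0" using s by simp
        from ZM[OF this, of v] have "(Z r *v (M r *v v)) $ j = X v r $ Inr j" by (simp add: NX)
        then show "(\<Sum>k\<in>UNIV. Z r $ j $ k * X v r $ Inl k) = X v r $ Inr j"
          by (simp add: matrix_vector_mult_def[of "Z r"] MX)
      qed auto
    qed
    have "(\<Sum>j\<in>UNIV. w $ j * (Z' s *v w) $ j)
        = (\<Sum>j\<in>UNIV. w $ j * (2 * \<i> * Y $ Inl j + 2 * \<i> * (\<Sum>k\<in>UNIV. Z s $ j $ k * Y $ Inr k)))"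
      unfolding e by simp
    also have "\<dots> = 2 * \<i> * ((\<Sum>j\<in>UNIV. w $ j * Y $ Inl j) + (\<Sum>j\<in>UNIV. \<Sum>k\<in>UNIV. w $ j * Z s $ j $ k * Y $ Inr k))"
      by (simp add: distrib_left sum.distrib sum_distrib_left mult_ac)
    also have "(\<Sum>j\<in>UNIV. \<Sum>k\<in>UNIV. w $ j * Z s $ j $ k * Y $ Inr k) = (\<Sum>k\<in>UNIV. (Z s *v w) $ k * Y $ Inr k)"
      by (subst sum.swap) (simp add: matrix_vector_mult_def[of "Z s"] sum_distrib_left sym[OF s] mult_ac)
    finally show ?thesis by (simp add: cdot_split Y_def)
  qed
  have pos: "\<exists>\<epsilon>>0. \<forall>s\<in>{0..t}. \<forall>x::real^'n.
      \<epsilon> * (norm x)\<^sup>2 \<le> Im (\<Sum>j\<in>UNIV. cvec x $ j * (Z s *v cvec x) $ j)" for t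
  proof -
    have "\<exists>b. \<forall>s\<in>{0..t}. norm (W i s $ Inl j) \<le> b" for i j
    proof -
      have "continuous_on {0..t} (\<lambda>s. W i s $ Inl j)"
        by (intro continuous_at_imp_continuous_on ballI differentiable_imp_continuous_within Wd)
      then have "bounded ((\<lambda>s. W i s $ Inl j) ` {0..t})"
        by (intro compact_imp_bounded compact_continuous_image) auto
      then show ?thesis by (auto simp: bounded_iff)
    qed
    then obtain b where b: "\<And>i j s. s \<in> {0..t} \<Longrightarrow> norm (W i s $ Inl j) \<le> b i j" by metis
    \<comment> \<open>A bound for the norm of M on [0, t]; the summand 1 makes it positive.\<close>
    define B where "B = (\<Sum>j\<in>UNIV. \<Sum>i\<in>UNIV. \<bar>b i j\<bar>) + 1"
    have B: "B > 0" unfolding B_def by (intro add_nonneg_pos sum_nonneg) auto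
    have Mb: "norm (M s *v v) \<le> B * norm v" if s: "s \<in> {0..t}" for s v
    proof -
      have "norm (M s *v v) \<le> (\<Sum>j\<in>UNIV. norm ((M s *v v) $ j))"
        unfolding norm_vec_def[of "M s *v v"] by (rule L2_set_le_sum) auto
      also have "\<dots> \<le> (\<Sum>j\<in>UNIV. \<Sum>i\<in>UNIV. \<bar>b i j\<bar> * norm v)"
      proof (rule sum_mono)
        fix j
        have "norm ((M s *v v) $ j) \<le> (\<Sum>i\<in>UNIV. norm (W i s $ Inl j * v $ i))"
          by (simp add: matrix_vector_mult_def M_def norm_sum)
        also have "\<dots> \<le> (\<Sum>i\<in>UNIV. \<bar>b i j\<bar> * norm v)"
        proof (rule sum_mono)
          fix i
          have "norm (W i s $ Inl j) \<le> \<bar>b i j\<bar>" using b[OF s, of i j] by linarith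
          then show "norm (W i s $ Inl j * v $ i) \<le> \<bar>b i j\<bar> * norm v"
            unfolding norm_mult by (intro mult_mono Finite_Cartesian_Product.norm_nth_le) auto
        qed
        finally show "norm ((M s *v v) $ j) \<le> (\<Sum>i\<in>UNIV. \<bar>b i j\<bar> * norm v)" .
      qed
      also have "\<dots> = (\<Sum>j\<in>UNIV. \<Sum>i\<in>UNIV. \<bar>b i j\<bar>) * norm v" by (simp add: sum_distrib_right)
      also have "\<dots> \<le> B * norm v" by (simp add: B_def mult_right_mono)
      finally show ?thesis .
    qed
    show ?thesis
    \<comment> \<open>With x = Mv the energy is at least |v|^2, and |x| \<le> B |v| turns this into
      |x|^2 / B^2.\<close>
    proof (intro exI[of _ "1 / B\<^sup>2"] conjI ballI allI)
      show "0 < 1 / B\<^sup>2" using B by simp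
      fix s and x :: "real^'n" assume s: "s \<in> {0..t}"
      then have s0: "s \<ge> 0" by simp
      define w where "w = cvec x"
      define v where "v = Minv s *v w"
      have Mv: "M s *v v = w" and Nv: "N s *v v = Z s *v w"
        using inv(1)[OF s0, of w] ZM[OF s0, of v] by (simp_all add: v_def)
      have "norm x = norm w" by (simp add: norm_vec_def L2_set_def w_def cvec_def)
      also have "\<dots> \<le> B * norm v" using Mb[OF s, of v] by (simp add: Mv)
      finally have "(norm x)\<^sup>2 \<le> (B * norm v)\<^sup>2" by (intro power_mono) auto
      then have "1 / B\<^sup>2 * (norm x)\<^sup>2 \<le> (norm v)\<^sup>2"
        using B by (simp add: power_mult_distrib field_simps)
      also have "\<dots> \<le> Im (\<Sum>j\<in>UNIV. cnj (w $ j) * (Z s *v w) $ j)"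
        using energy[OF s0, of v] by (simp add: Mv Nv)
      also have "\<dots> = Im (\<Sum>j\<in>UNIV. cvec x $ j * (Z s *v cvec x) $ j)"
        unfolding w_def by (simp add: cvec_def)
      finally show "1 / B\<^sup>2 * (norm x)\<^sup>2
          \<le> Im (\<Sum>j\<in>UNIV. cvec x $ j * (Z s *v cvec x) $ j)" .
    qed
  qed
  show ?thesis using that[of Z Z'] Z' sym ric pos by blast
qed

section \<open>Gaussian solutions of the heat equation\<close>

lemma has_partials_cong: "has_partials f D \<Longrightarrow> (\<And>j x. D j x = E j x) \<Longrightarrow> has_partials f E"
  by (simp add: has_partials_def)

lemma has_partials_sum:
  "(\<And>i. i \<in> I \<Longrightarrow> has_partials (f i) (D i)) \<Longrightarrow>
     has_partials (\<lambda>x. \<Sum>i\<in>I. f i x) (\<lambda>j x. \<Sum>i\<in>I. D i j x)"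
proof (induction I rule: infinite_finite_induct)
  case (insert i I)
  then show ?case using has_partials_add[of "f i" "D i" "\<lambda>x. \<Sum>i\<in>I. f i x" "\<lambda>j x. \<Sum>i\<in>I. D i j x"] by simp
qed (simp_all add: has_partials_const)

lemma has_partials_cmult: "has_partials f D \<Longrightarrow> has_partials (\<lambda>x. c * f x) (\<lambda>j x. c * D j x)"
  using has_partials_mult[OF has_partials_const[of c]] by simp

text \<open>In blocks this is -i (tr \<open>Q_\<xi>x\<close> + tr(\<open>Q_\<xi>\<xi>\<close> Z)),
  the constant that q^w adds to the classical symbol on the packet. The transposed argument follows
  the index order of \<open>symbol_correction\<close>.\<close>

definition trace_correction :: "complex^('n::finite + 'n)^('n + 'n) \<Rightarrow> complex^'n^'n \<Rightarrow> complex" where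
  "trace_correction Q Z = (\<Sum>a\<in>UNIV. \<Sum>b\<in>UNIV. Q $ a $ b * symbol_correction (\<lambda>k j. Z $ j $ k) a b)"

lemma continuous_on_trace_correction:
  assumes "\<And>j k. continuous_on S (\<lambda>s. Z s $ j $ k)"
  shows "continuous_on S (\<lambda>s. trace_correction Q (Z s))"
proof -
  have "continuous_on S (\<lambda>s. symbol_correction (\<lambda>k j. Z s $ j $ k) a b)" for a b
    by (cases a; cases b) (auto intro!: continuous_intros assms)
  then show ?thesis unfolding trace_correction_def by (intro continuous_intros)
qed

lemma continuous_on_bounded_interval:
  fixes f :: "real \<Rightarrow> 'a::real_normed_vector"
  assumes "continuous_on {0..t} f"
  obtains B where "B \<ge> 0" "\<And>s. s \<in> {0..t} \<Longrightarrow> norm (f s) \<le> B"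
proof -
  have "bounded (f ` {0..t})"
    using assms by (intro compact_imp_bounded compact_continuous_image) auto
  then obtain B where "\<And>s. s \<in> {0..t} \<Longrightarrow> norm (f s) \<le> B" unfolding bounded_iff by blast
  then show ?thesis using that[of "max 0 B"] by (metis max.cobounded1 max.coboundedI2)
qed

lemma continuous_on_bounded_interval_family:
  fixes f :: "'i::finite \<Rightarrow> real \<Rightarrow> 'a::real_normed_vector"
  assumes "\<And>i. continuous_on {0..t} (f i)"
  obtains B where "B \<ge> 0" "\<And>s i. s \<in> {0..t} \<Longrightarrow> norm (f i s) \<le> B"
proof -
  have "\<exists>B\<ge>0. \<forall>s\<in>{0..t}. norm (f i s) \<le> B" for i
    using continuous_on_bounded_interval[OF assms] by metis
  then obtain b where b: "\<And>i. b i \<ge> 0" "\<And>i s. s \<in> {0..t} \<Longrightarrow> norm (f i s) \<le> b i" by metis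
  show ?thesis
  proof (rule that[of "\<Sum>i\<in>UNIV. b i"])
    show "0 \<le> (\<Sum>i\<in>UNIV. b i)" by (intro sum_nonneg b)
    fix s i assume "s \<in> {0..t}"
    then have "norm (f i s) \<le> b i" by (rule b)
    also have "\<dots> \<le> (\<Sum>i\<in>UNIV. b i)" by (rule member_le_sum) (auto intro: b)
    finally show "norm (f i s) \<le> (\<Sum>i\<in>UNIV. b i)" .
  qed
qed

text \<open>The width Z and the logarithmic amplitude d are fixed once for all packets, while the
  centre X remains a parameter of the definitions inside. This is what makes packets with different
  centres comparable.\<close>

locale gaussian_wave =
  fixes Q :: "complex^('n::finite + 'n)^('n + 'n)" and t \<epsilon> :: real
    and Z Z' :: "real \<Rightarrow> complex^'n^'n" and d :: "real \<Rightarrow> complex"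
  assumes Q_sym: "transpose Q = Q" and t_pos: "0 < t" and eps_pos: "0 < \<epsilon>"
    and Z_deriv: "\<And>s j k. s \<in> {0..t} \<Longrightarrow>
      ((\<lambda>s. Z s $ j $ k) has_vector_derivative Z' s $ j $ k) (at s within {0..t})"
    and Z_sym: "\<And>s j k. s \<in> {0..t} \<Longrightarrow> Z s $ j $ k = Z s $ k $ j"
    and riccati: "\<And>s w. s \<in> {0..t} \<Longrightarrow>
      (\<Sum>j\<in>UNIV. w $ j * (Z' s *v w) $ j) = 2 * \<i> * cdot (graph_vec (Z s) w) (Q *v graph_vec (Z s) w)"
    and Z_pos: "\<And>s x. s \<in> {0..t} \<Longrightarrow>
      \<epsilon> * (norm x)\<^sup>2 \<le> Im (\<Sum>j\<in>UNIV. cvec x $ j * (Z s *v cvec x) $ j)"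
    and d_deriv: "\<And>s. s \<in> {0..t} \<Longrightarrow>
      (d has_vector_derivative - trace_correction Q (Z s)) (at s within {0..t})"
begin

definition shifted :: "(real \<Rightarrow> complex^('n + 'n)) \<Rightarrow> real \<Rightarrow> real^'n \<Rightarrow> complex^'n" where
  "shifted X s x = (\<chi> j. of_real (x $ j) - X s $ Inl j)"

text \<open>The summand $\frac{i}{2} \langle y, \eta\rangle$ absorbs the dependence of the normalisation on the centre.\<close>

definition phase :: "(real \<Rightarrow> complex^('n + 'n)) \<Rightarrow> real \<Rightarrow> real^'n \<Rightarrow> complex" where
  "phase X s x = \<i> / 2 * (\<Sum>j\<in>UNIV. shifted X s x $ j * (Z s *v shifted X s x) $ j)
     + \<i> * (\<Sum>j\<in>UNIV. X s $ Inr j * shifted X s x $ j)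
     + \<i> / 2 * (\<Sum>j\<in>UNIV. X s $ Inl j * X s $ Inr j) + d s"

definition phase_grad :: "(real \<Rightarrow> complex^('n + 'n)) \<Rightarrow> real \<Rightarrow> 'n \<Rightarrow> real^'n \<Rightarrow> complex" where
  "phase_grad X s j x = \<i> * ((Z s *v shifted X s x) $ j + X s $ Inr j)"

lemma shifted_partials:
  "has_partials (\<lambda>x. shifted X s x $ k) (\<lambda>j x. if j = k then 1 else 0)"
  using has_partials_add[OF has_partials_coord[of k] has_partials_const[of "- X s $ Inl k"]]
  by (simp add: shifted_def)

lemma Z_shifted_partials:
  "has_partials (\<lambda>x. (Z s *v shifted X s x) $ k) (\<lambda>j x. Z s $ k $ j)"
proof -
  have "has_partials (\<lambda>x. \<Sum>i\<in>UNIV. Z s $ k $ i * shifted X s x $ i)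
      (\<lambda>j x. \<Sum>i\<in>UNIV. Z s $ k $ i * (if j = i then 1 else 0))"
    by (intro has_partials_sum has_partials_cmult shifted_partials)
  moreover have "(\<Sum>i\<in>UNIV. Z s $ k $ i * (if j = i then 1 else 0)) = Z s $ k $ j" for j
    by (subst sum.remove[of _ j]) (auto intro!: sum.neutral)
  ultimately show ?thesis by (simp add: matrix_vector_mult_def)
qed

lemma phase_grad_partials: "has_partials (phase_grad X s j) (\<lambda>k x. \<i> * Z s $ j $ k)"
  unfolding phase_grad_def[abs_def]
  using has_partials_cmult[OF has_partials_add[OF Z_shifted_partials has_partials_const], of \<i> s X j]
  by simp

lemma cpoly_phase_grad: "cpoly (phase_grad X s j)"
proof -
  have "cpoly (\<lambda>x. \<i> * ((\<Sum>i\<in>UNIV. Z s $ j $ i * (of_real (x $ i) + - X s $ Inl i)) + X s $ Inr j))"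
    by (intro cpoly_intros cpoly_sum)
  then show ?thesis
    by (simp add: phase_grad_def[abs_def] matrix_vector_mult_def shifted_def)
qed

lemma phase_partials:
  assumes s: "s \<in> {0..t}"
  shows "has_partials (phase X s) (phase_grad X s)"
  unfolding phase_def[abs_def]
proof (rule has_partials_cong)
  show "has_partials (\<lambda>x. \<i> / 2 * (\<Sum>j\<in>UNIV. shifted X s x $ j * (Z s *v shifted X s x) $ j)
     + \<i> * (\<Sum>j\<in>UNIV. X s $ Inr j * shifted X s x $ j)
     + \<i> / 2 * (\<Sum>j\<in>UNIV. X s $ Inl j * X s $ Inr j) + d s)
    (\<lambda>k x. \<i> / 2 * (\<Sum>j\<in>UNIV. (if k = j then 1 else 0) * (Z s *v shifted X s x) $ j + shifted X s x $ j * Z s $ j $ k)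
     + \<i> * (\<Sum>j\<in>UNIV. X s $ Inr j * (if k = j then 1 else 0)) + 0 + 0)"
    by (intro has_partials_add has_partials_cmult has_partials_sum has_partials_mult
        shifted_partials Z_shifted_partials has_partials_const)
  fix k and x :: "real^'n"
  have "(\<Sum>j\<in>UNIV. (if k = j then 1 else 0) * (Z s *v shifted X s x) $ j) = (Z s *v shifted X s x) $ k"
    by (subst sum.remove[of _ k]) (auto intro!: sum.neutral)
  moreover have "(\<Sum>j\<in>UNIV. X s $ Inr j * (if k = j then 1 else 0)) = X s $ Inr k"
    by (subst sum.remove[of _ k]) (auto intro!: sum.neutral)
  \<comment> \<open>Symmetry of Z makes the two halves of the derivative of the quadratic term
    equal, which cancels the factor 1/2.\<close>
  moreover have "(\<Sum>j\<in>UNIV. shifted X s x $ j * Z s $ j $ k) = (Z s *v shifted X s x) $ k"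
    unfolding matrix_vector_mult_def by (simp add: Z_sym[OF s, of k] mult.commute)
  ultimately show "\<i> / 2 * (\<Sum>j\<in>UNIV. (if k = j then 1 else 0) * (Z s *v shifted X s x) $ j + shifted X s x $ j * Z s $ j $ k)
     + \<i> * (\<Sum>j\<in>UNIV. X s $ Inr j * (if k = j then 1 else 0)) + 0 + 0 = phase_grad X s k x"
    by (simp add: sum.distrib phase_grad_def distrib_left)
qed

text \<open>The point (x, -i grad of the phase) lies on the graph of Z translated to the centre, so
  q^w acts on the packet through the value of q there.\<close>

lemma phase_symbol_eq:
  "phase_symbol (phase_grad X s) a x = (X s + graph_vec (Z s) (shifted X s x)) $ a"
  by (cases a) (simp_all add: phase_grad_def shifted_def)

lemma weyl_symbol_eq:
  "weyl_symbol (phase_grad X s) (\<lambda>k j. Z s $ j $ k) Q x =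
     cdot (X s + graph_vec (Z s) (shifted X s x)) (Q *v (X s + graph_vec (Z s) (shifted X s x)))
     + trace_correction Q (Z s)"
  unfolding weyl_symbol_def phase_symbol_eq cdot_matrix trace_correction_def
  by (simp only: distrib_left sum.distrib)

lemma Z_continuous: "continuous_on {0..t} (\<lambda>s. Z s $ j $ k)"
  unfolding continuous_on_eq_continuous_within
  using has_vector_derivative_continuous[OF Z_deriv] by blast

text \<open>Let G be the point of the graph of Z over x - y. Expanding q(X + G), the Riccati
  equation accounts for q(G), the motion of the centre for the mixed term, the derivative of d for
  the constant, and the momentum term together with i/2 times the pairing of y and \<eta> for
  q(X).\<close>

lemma phase_time_derivative:
  assumes X: "heat_flow Q X" and s: "s \<in> {0..t}"
  shows "((\<lambda>s. phase X s x) has_vector_derivative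
     - weyl_symbol (phase_grad X s) (\<lambda>k j. Z s $ j $ k) Q x) (at s within {0..t})"
proof -
  let ?T = "at s within {0..t}"
  define w where "w = shifted X s x"
  define y where "y = Q *v X s"
  define G where "G = graph_vec (Z s) w"
  have X': "((\<lambda>s. X s $ Inl j) has_vector_derivative - (2 * \<i>) * y $ Inr j) ?T"
    "((\<lambda>s. X s $ Inr j) has_vector_derivative 2 * \<i> * y $ Inl j) ?T" for j
    unfolding y_def by (rule heat_flowD[OF X])+
  have w': "((\<lambda>s. shifted X s x $ j) has_vector_derivative 2 * \<i> * y $ Inr j) ?T" for j
    using has_vector_derivative_diff[OF has_vector_derivative_const heat_flowD(1)[OF X]]
    by (simp add: shifted_def y_def)
  have Zw': "((\<lambda>s. (Z s *v shifted X s x) $ j) has_vector_derivative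
      (\<Sum>k\<in>UNIV. Z s $ j $ k * (2 * \<i> * y $ Inr k) + Z' s $ j $ k * w $ k)) ?T" for j
    unfolding matrix_vector_mult_def vec_lambda_beta w_def
    by (intro has_vector_derivative_sum has_vector_derivative_mult Z_deriv s w')
  have "((\<lambda>s. phase X s x) has_vector_derivative
     (\<i> / 2 * (\<Sum>j\<in>UNIV. w $ j * (\<Sum>k\<in>UNIV. Z s $ j $ k * (2 * \<i> * y $ Inr k) + Z' s $ j $ k * w $ k)
          + 2 * \<i> * y $ Inr j * (Z s *v w) $ j)
     + \<i> * (\<Sum>j\<in>UNIV. X s $ Inr j * (2 * \<i> * y $ Inr j) + 2 * \<i> * y $ Inl j * w $ j)
     + \<i> / 2 * (\<Sum>j\<in>UNIV. X s $ Inl j * (2 * \<i> * y $ Inl j) + - (2 * \<i>) * y $ Inr j * X s $ Inr j)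
     + - trace_correction Q (Z s))) ?T"
    unfolding phase_def w_def
    by (intro has_vector_derivative_add has_vector_derivative_mult_right has_vector_derivative_sum
        has_vector_derivative_mult w' Zw'[unfolded w_def] X' d_deriv s)
  moreover
  \<comment> \<open>Here q(X) = S2 + S4 and the mixed term is 2 (S1 + S3). The momentum term alone
    would contribute -2 S2; the half pairing adds S2 - S4 and so restores -q(X).\<close>
  define S1 where "S1 = (\<Sum>j\<in>UNIV. y $ Inr j * (Z s *v w) $ j)"
  define S2 where "S2 = (\<Sum>j\<in>UNIV. X s $ Inr j * y $ Inr j)"
  define S3 where "S3 = (\<Sum>j\<in>UNIV. w $ j * y $ Inl j)"
  define S4 where "S4 = (\<Sum>j\<in>UNIV. X s $ Inl j * y $ Inl j)"
  have "(\<Sum>j\<in>UNIV. w $ j * (\<Sum>k\<in>UNIV. Z s $ j $ k * (2 * \<i> * y $ Inr k) + Z' s $ j $ k * w $ k))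
      = 2 * \<i> * S1 + 2 * \<i> * cdot G (Q *v G)"
  proof -
    have "(\<Sum>j\<in>UNIV. w $ j * (\<Sum>k\<in>UNIV. Z s $ j $ k * (2 * \<i> * y $ Inr k) + Z' s $ j $ k * w $ k))
        = 2 * \<i> * (\<Sum>j\<in>UNIV. \<Sum>k\<in>UNIV. w $ j * Z s $ j $ k * y $ Inr k) + (\<Sum>j\<in>UNIV. w $ j * (Z' s *v w) $ j)"
      by (simp add: sum.distrib distrib_left sum_distrib_left matrix_vector_mult_def mult_ac)
    also have "(\<Sum>j\<in>UNIV. \<Sum>k\<in>UNIV. w $ j * Z s $ j $ k * y $ Inr k) = S1"
      unfolding S1_def
      by (subst sum.swap) (simp add: matrix_vector_mult_def sum_distrib_left Z_sym[OF s] mult_ac)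
    finally show ?thesis using riccati[OF s, of w] by (simp add: G_def)
  qed
  then have "(\<Sum>j\<in>UNIV. w $ j * (\<Sum>k\<in>UNIV. Z s $ j $ k * (2 * \<i> * y $ Inr k) + Z' s $ j $ k * w $ k)
          + 2 * \<i> * y $ Inr j * (Z s *v w) $ j) = 4 * \<i> * S1 + 2 * \<i> * cdot G (Q *v G)"
    by (simp only: sum.distrib) (simp add: S1_def sum_distrib_left mult.assoc)
  moreover have "(\<Sum>j\<in>UNIV. X s $ Inr j * (2 * \<i> * y $ Inr j) + 2 * \<i> * y $ Inl j * w $ j) = 2 * \<i> * (S2 + S3)"
    by (simp add: S2_def S3_def sum.distrib sum_distrib_left distrib_left mult_ac)
  moreover have "(\<Sum>j\<in>UNIV. X s $ Inl j * (2 * \<i> * y $ Inl j) + - (2 * \<i>) * y $ Inr j * X s $ Inr j) = 2 * \<i> * (S4 - S2)"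
    by (simp add: S2_def S4_def sum_subtractf sum_distrib_left right_diff_distrib mult_ac)
  ultimately have "((\<lambda>s. phase X s x) has_vector_derivative
     (\<i> / 2 * (4 * \<i> * S1 + 2 * \<i> * cdot G (Q *v G)) + \<i> * (2 * \<i> * (S2 + S3)) + \<i> / 2 * (2 * \<i> * (S4 - S2))
      + - trace_correction Q (Z s))) ?T" by (simp only:)
  moreover have "\<i> / 2 * (4 * \<i> * S1 + 2 * \<i> * cdot G (Q *v G)) + \<i> * (2 * \<i> * (S2 + S3)) + \<i> / 2 * (2 * \<i> * (S4 - S2))
      = - (S4 + S2 + 2 * (S3 + S1) + cdot G (Q *v G))"
    by (simp add: algebra_simps)
  moreover have "cdot (X s + G) (Q *v (X s + G)) = S4 + S2 + 2 * (S3 + S1) + cdot G (Q *v G)"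
  proof -
    have "cdot (X s) y = S4 + S2" by (simp add: cdot_split S4_def S2_def)
    moreover have "cdot G y = S3 + S1" by (simp add: cdot_split S3_def S1_def G_def mult.commute)
    ultimately show ?thesis
      using cdot_quadratic_add[OF Q_sym, of "X s" G] cdot_symmetric[OF Q_sym, of "X s" G] by (simp add: y_def)
  qed
  ultimately show ?thesis
    unfolding weyl_symbol_eq w_def[symmetric] G_def[symmetric] by (simp only: minus_add_distrib)
qed

lemma shifted_real:
  assumes "\<And>a. X s $ a \<in> \<real>"
  shows "shifted X s x = cvec (x - (\<chi> j. Re (X s $ Inl j)))"
  using assms by (simp add: shifted_def cvec_def vec_eq_iff)

text \<open>For a real centre the linear and the constant pairing are real, so i times them does not
  contribute. The modulus then depends on the centre only through x - y.\<close>

lemma Re_phase: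
  assumes "\<And>a. X s $ a \<in> \<real>"
  shows "Re (phase X s x) = Re (d s) - Im (\<Sum>j\<in>UNIV. shifted X s x $ j * (Z s *v shifted X s x) $ j) / 2"
proof -
  have "(\<Sum>j\<in>UNIV. X s $ Inr j * shifted X s x $ j) \<in> \<real>" "(\<Sum>j\<in>UNIV. X s $ Inl j * X s $ Inr j) \<in> \<real>"
    using assms by (auto simp: shifted_def intro!: sum_in_Reals Reals_mult Reals_diff)
  then show ?thesis by (simp add: phase_def complex_is_Real_iff)
qed

text \<open>The point is that \<open>K\<close> is uniform in s: the L^2 differentiation of the
  packet needs one majorant for the whole interval.\<close>

lemma phase_affine_gaussian_exponent:
  assumes X: "heat_flow Q X" and real: "\<And>s a. X s $ a \<in> \<real>"
  obtains K where "\<And>s. s \<in> {0..t} \<Longrightarrow>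
    affine_gaussian_exponent (phase X s) (phase_grad X s) (\<epsilon> / 4) K (\<lambda>k j. Z s $ j $ k)"
proof -
  define y where "y s = (\<chi> j. Re (X s $ Inl j))" for s
  have "continuous_on {0..t} (\<lambda>s. X s $ Inl j)" for j
    unfolding continuous_on_eq_continuous_within
    using has_vector_derivative_continuous[OF heat_flowD(1)[OF X]] by blast
  then have "continuous_on {0..t} y" unfolding y_def[abs_def] by (intro continuous_on_vec_lambda continuous_on_Re)
  then obtain B where B: "\<And>s. s \<in> {0..t} \<Longrightarrow> norm (y s) \<le> B"
    using continuous_on_bounded_interval by metis
  have "continuous_on {0..t} d"
    unfolding continuous_on_eq_continuous_within
    using has_vector_derivative_continuous[OF d_deriv] by blast
  then obtain D where D: "\<And>s. s \<in> {0..t} \<Longrightarrow> norm (d s) \<le> D"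
    using continuous_on_bounded_interval by metis
  show ?thesis
  \<comment> \<open>D bounds |d| and B bounds the centre. The bound |x|^2 \<le> 2 |x - y|^2 + 2 B^2,
    multiplied by \<epsilon>/4, trades the rate \<epsilon>/2 about y for the rate \<epsilon>/4 about
    0 at the cost of \<epsilon>B^2/2.\<close>
  proof (rule that[of "D + \<epsilon> / 2 * B\<^sup>2"])
    fix s assume s: "s \<in> {0..t}"
    show "affine_gaussian_exponent (phase X s) (phase_grad X s) (\<epsilon> / 4) (D + \<epsilon> / 2 * B\<^sup>2) (\<lambda>k j. Z s $ j $ k)"
    proof unfold_locales
      show "0 < \<epsilon> / 4" using eps_pos by simp
      show "has_partials (phase X s) (phase_grad X s)" by (rule phase_partials[OF s])
      show "cpoly (phase_grad X s j)" for j by (rule cpoly_phase_grad)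
      show "has_partials (phase_grad X s j) (\<lambda>k x. \<i> * Z s $ j $ k)" for j by (rule phase_grad_partials)
      fix x
      have "norm x \<le> norm (x - y s) + norm (y s)" by (metis diff_add_cancel norm_triangle_ineq)
      then have "(norm x)\<^sup>2 \<le> (norm (x - y s) + norm (y s))\<^sup>2" by (intro power_mono) auto
      also have "\<dots> \<le> 2 * (norm (x - y s))\<^sup>2 + 2 * (norm (y s))\<^sup>2"
        using sum_squares_bound[of "norm (x - y s)" "norm (y s)"] by (simp add: power2_sum)
      also have "(norm (y s))\<^sup>2 \<le> B\<^sup>2" using B[OF s] by (intro power_mono) auto
      finally have "\<epsilon> / 4 * (norm x)\<^sup>2 \<le> \<epsilon> / 4 * (2 * (norm (x - y s))\<^sup>2 + 2 * B\<^sup>2)"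
        using eps_pos by (intro mult_left_mono) auto
      moreover have "Re (phase X s x) \<le> D - \<epsilon> * (norm (x - y s))\<^sup>2 / 2"
        using Z_pos[OF s, of "x - y s"] Re_phase[of X s x] shifted_real[of X s x] real D[OF s] abs_Re_le_cmod[of "d s"]
        by (simp add: y_def)
      ultimately show "Re (phase X s x) \<le> D + \<epsilon> / 2 * B\<^sup>2 - \<epsilon> / 4 * (norm x)\<^sup>2"
        by (simp add: algebra_simps)
    qed
  qed
qed

lemma weyl_symbol_bound:
  assumes X: "heat_flow Q X"
  obtains C where "C \<ge> 0" "\<And>s x. s \<in> {0..t} \<Longrightarrow>
    norm (weyl_symbol (phase_grad X s) (\<lambda>k j. Z s $ j $ k) Q x) \<le> C * (1 + norm x)\<^sup>2"
proof -
  have "continuous_on {0..t} (\<lambda>s. X s $ a)" for a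
    unfolding continuous_on_eq_continuous_within
    using has_vector_derivative_continuous[OF heat_flowD(1)[OF X]]
      has_vector_derivative_continuous[OF heat_flowD(2)[OF X]] by (cases a) blast+
  then obtain B where B: "B \<ge> 0" "\<And>s a. s \<in> {0..t} \<Longrightarrow> norm (X s $ a) \<le> B"
    using continuous_on_bounded_interval_family[of t "\<lambda>a s. X s $ a"] by metis
  obtain E where E: "E \<ge> 0" "\<And>s jk. s \<in> {0..t} \<Longrightarrow> norm (Z s $ fst jk $ snd jk) \<le> E"
    using continuous_on_bounded_interval_family[of t "\<lambda>jk s. Z s $ fst jk $ snd jk", OF Z_continuous] by metis
  have Zn: "norm (Z s $ j $ k) \<le> E" if "s \<in> {0..t}" for s j k using E(2)[OF that, of "(j, k)"] by simp
  obtain R where R: "R \<ge> 0" "\<And>s. s \<in> {0..t} \<Longrightarrow> norm (trace_correction Q (Z s)) \<le> R"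
    using continuous_on_bounded_interval[OF continuous_on_trace_correction[OF Z_continuous]] by metis
  define n where "n = real CARD('n)"
  \<comment> \<open>In a position component the centre cancels and 1 + |x| suffices. In a momentum
    component 1 + B covers the centre, and n E (1 + B) covers a row of Z applied to the shifted
    variable.\<close>
  define C where "C = 1 + B + n * E * (1 + B)"
  define S where "S = (\<Sum>a\<in>UNIV. \<Sum>b\<in>UNIV. norm (Q $ a $ b))"
  have C0: "C \<ge> 0" using B E by (simp add: C_def n_def)
  have S0: "S \<ge> 0" unfolding S_def by (intro sum_nonneg) auto
  show ?thesis
  proof (rule that[of "S * C\<^sup>2 + R"])
    show "0 \<le> S * C\<^sup>2 + R" using S0 R by simp
    fix s and x :: "real^'n" assume s: "s \<in> {0..t}"
    define V where "V = X s + graph_vec (Z s) (shifted X s x)"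
    have V: "norm (V $ a) \<le> C * (1 + norm x)" for a
    proof (cases a)
      case (Inl j)
      have "norm (V $ a) \<le> 1 * (1 + norm x)"
        using component_le_norm_cart[of x j] by (simp add: V_def Inl shifted_def)
      also have "\<dots> \<le> C * (1 + norm x)" using B E by (intro mult_right_mono) (auto simp: C_def n_def)
      finally show ?thesis .
    next
      case (Inr j)
      have "norm ((Z s *v shifted X s x) $ j) \<le> (\<Sum>k\<in>UNIV. norm (Z s $ j $ k * shifted X s x $ k))"
        by (simp add: matrix_vector_mult_def norm_sum)
      also have "\<dots> \<le> (\<Sum>k\<in>(UNIV::'n set). E * (norm x + B))"
      proof (rule sum_mono)
        fix k
        have "norm (shifted X s x $ k) \<le> norm (complex_of_real (x $ k)) + norm (X s $ Inl k)"
          unfolding shifted_def vec_lambda_beta by (rule norm_triangle_ineq4)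
        also have "\<dots> \<le> norm x + B" using component_le_norm_cart[of x k] B(2)[OF s] by (simp add: add_mono)
        finally show "norm (Z s $ j $ k * shifted X s x $ k) \<le> E * (norm x + B)"
          unfolding norm_mult using E by (intro mult_mono Zn s) auto
      qed
      also have "\<dots> = n * E * (norm x + B)" by (simp add: n_def)
      also have "\<dots> \<le> n * E * ((1 + B) * (1 + norm x))"
        using B E by (intro mult_left_mono) (auto simp: n_def algebra_simps)
      finally have "norm ((Z s *v shifted X s x) $ j) \<le> n * E * (1 + B) * (1 + norm x)" by simp
      moreover have "norm (X s $ Inr j) \<le> (1 + B) * (1 + norm x)"
      proof -
        have "B * 1 \<le> (1 + B) * (1 + norm x)" using B(1) by (intro mult_mono) auto
        then show ?thesis using B(2)[OF s, of "Inr j"] by linarith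
      qed
      ultimately have "norm (X s $ Inr j) + norm ((Z s *v shifted X s x) $ j) \<le> C * (1 + norm x)"
        by (simp add: C_def distrib_right)
      then show ?thesis
        using norm_triangle_ineq[of "X s $ Inr j" "(Z s *v shifted X s x) $ j"] by (simp add: V_def Inr)
    qed
    have "norm (cdot V (Q *v V)) \<le> (\<Sum>a\<in>UNIV. \<Sum>b\<in>UNIV. norm (Q $ a $ b * (V $ a * V $ b)))"
      unfolding cdot_matrix by (intro order_trans[OF norm_sum] sum_mono norm_sum)
    also have "\<dots> \<le> (\<Sum>a\<in>UNIV. \<Sum>b\<in>UNIV. norm (Q $ a $ b) * ((C * (1 + norm x)) * (C * (1 + norm x))))"
      unfolding norm_mult using C0 by (intro sum_mono mult_left_mono mult_mono V) auto
    also have "\<dots> = S * C\<^sup>2 * (1 + norm x)\<^sup>2"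
      unfolding S_def by (simp add: sum_distrib_left sum_distrib_right power2_eq_square mult_ac)
    finally have 1: "norm (cdot V (Q *v V)) \<le> S * C\<^sup>2 * (1 + norm x)\<^sup>2" .
    have "R * 1 \<le> R * (1 + norm x)\<^sup>2" using R(1) by (intro mult_left_mono) auto
    then have 2: "norm (trace_correction Q (Z s)) \<le> R * (1 + norm x)\<^sup>2" using R(2)[OF s] by linarith
    show "norm (weyl_symbol (phase_grad X s) (\<lambda>k j. Z s $ j $ k) Q x) \<le> (S * C\<^sup>2 + R) * (1 + norm x)\<^sup>2"
      unfolding weyl_symbol_eq V_def[symmetric]
      using norm_triangle_ineq[of "cdot V (Q *v V)" "trace_correction Q (Z s)"] 1 2
      by (simp add: distrib_right)
  qed
qed

definition wave :: "(real \<Rightarrow> complex^('n + 'n)) \<Rightarrow> real \<Rightarrow> (real^'n) L2" where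
  "wave X s = abs_L2 (\<lambda>x. exp (phase X s x))"

text \<open>The pointwise identity for the time derivative of the phase says that the packet solves
  the heat equation; the majorant transfers this to L^2, and uniqueness for the contraction
  semigroup identifies the curve.\<close>

lemma heat_semigroup_wave:
  assumes T: "is_heat_semigroup Q T" and X: "heat_flow Q X" and real: "\<And>s a. X s $ a \<in> \<real>"
  shows "T t (wave X 0) = wave X t"
proof -
  obtain K where age: "\<And>s. s \<in> {0..t} \<Longrightarrow>
    affine_gaussian_exponent (phase X s) (phase_grad X s) (\<epsilon> / 4) K (\<lambda>k j. Z s $ j $ k)"
    using phase_affine_gaussian_exponent[OF X real] by metis
  define V where "V s = weyl_symbol (phase_grad X s) (\<lambda>k j. Z s $ j $ k) Q" for s
  obtain C where C: "C \<ge> 0" "\<And>s x. s \<in> {0..t} \<Longrightarrow> norm (V s x) \<le> C * (1 + norm x)\<^sup>2"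
    using weyl_symbol_bound[OF X] unfolding V_def by metis
  \<comment> \<open>Quadratic growth of the symbol times the uniform Gaussian bound on the
    packet.\<close>
  define G where "G x = C * (1 + norm x)\<^sup>2 * (exp K * exp (- (\<epsilon> / 4 * (norm x)\<^sup>2)))" for x :: "real^'n"
  have sq: "sq_integrable (\<lambda>x. exp (phase X s x))" "sq_integrable (\<lambda>x. V s x * exp (phase X s x))" if "s \<in> {0..t}" for s
  proof -
    interpret affine_gaussian_exponent "phase X s" "phase_grad X s" "\<epsilon> / 4" K "\<lambda>k j. Z s $ j $ k"
      by (rule age[OF that])
    show "sq_integrable (\<lambda>x. exp (phase X s x))" by (rule exp_sq_integrable)
    show "sq_integrable (\<lambda>x. V s x * exp (phase X s x))"
      unfolding V_def by (intro poly_exp_sq_integrable cpoly_weyl_symbol)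
  qed
  have sq': "sq_integrable (\<lambda>x. - V s x * exp (phase X s x))" if "s \<in> {0..t}" for s
    using sq_integrable_scale[OF sq(2)[OF that], of "-1"] by simp
  have deriv: "((\<lambda>s. exp (phase X s x)) has_vector_derivative - V s x * exp (phase X s x)) (at s within {0..t})"
    if "s \<in> {0..t}" for s x
  proof -
    have "(exp \<circ> (\<lambda>s. phase X s x) has_vector_derivative (- V s x) * exp (phase X s x)) (at s within {0..t})"
      by (rule field_vector_diff_chain_within[OF phase_time_derivative[OF X that, of x, folded V_def]])
         (auto intro: DERIV_exp DERIV_subset)
    then show ?thesis by (simp add: o_def)
  qed
  have bound: "norm (- V s x * exp (phase X s x)) \<le> G x" if s: "s \<in> {0..t}" for s x
  proof -
    have "Re (phase X s x) \<le> K - \<epsilon> / 4 * (norm x)\<^sup>2"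
      using age[OF s] unfolding affine_gaussian_exponent_def gaussian_exponent_def by blast
    then have "norm (exp (phase X s x)) \<le> exp K * exp (- (\<epsilon> / 4 * (norm x)\<^sup>2))"
      by (simp add: exp_add[symmetric])
    then show ?thesis unfolding G_def norm_mult norm_minus_cancel using C(1)
      by (intro mult_mono C(2) s) auto
  qed
  have G: "integrable lborel (\<lambda>x. (G x)\<^sup>2)"
  proof -
    have g: "gaussian_bounded G"
      unfolding G_def[abs_def]
    proof (rule gaussian_bounded_mult)
      show "poly_bounded (\<lambda>x::real^'n. C * (1 + norm x)\<^sup>2)"
        unfolding poly_bounded_def using C(1) by (intro exI[of _ C] exI[of _ 2]) (auto simp: abs_mult)
      show "gaussian_bounded (\<lambda>x::real^'n. exp K * exp (- (\<epsilon> / 4 * (norm x)\<^sup>2)))"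
        unfolding gaussian_bounded_def using eps_pos
        by (intro exI[of _ "exp K"] exI[of _ "\<epsilon> / 4"]) (auto simp: abs_mult)
    qed
    have "integrable lborel (\<lambda>x. G x * G x)"
    proof (rule gaussian_bounded_integrable)
      show "gaussian_bounded (\<lambda>x. G x * G x)"
        by (intro gaussian_bounded_mult g poly_bounded_bounded gaussian_bounded_imp_bounded)
      show "(\<lambda>x. G x * G x) \<in> borel_measurable borel"
        unfolding G_def by (intro borel_measurable_continuous_onI continuous_intros)
    qed
    then show ?thesis by (simp add: power2_eq_square)
  qed
  show ?thesis
  \<comment> \<open>The generator is -q^w, so the velocity of the curve must be minus the function
    paired with it in the graph of q^w.\<close>
  proof (rule contraction_semigroup_unique_solution[where U = "wave X" and V = "\<lambda>s. abs_L2 (\<lambda>x. - V s x * exp (phase X s x))"])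
    show "contraction_semigroup T" using T by (simp add: is_heat_semigroup_def)
    show "0 \<le> t" using t_pos by simp
    show "continuous_on {0..t} (wave X)"
      unfolding wave_def[abs_def] by (rule L2_curve_continuous[OF sq(1) sq' deriv bound G])
    fix s assume s: "0 \<le> s" "s < t"
    then have s': "s \<in> {0..t}" by simp
    show "((\<lambda>h. (wave X (s + h) - wave X s) /\<^sub>R h) \<longlongrightarrow> abs_L2 (\<lambda>x. - V s x * exp (phase X s x))) (at_right 0)"
      unfolding wave_def by (rule L2_curve_right_derivative[OF sq(1) sq' deriv bound G s])
    interpret affine_gaussian_exponent "phase X s" "phase_grad X s" "\<epsilon> / 4" K "\<lambda>k j. Z s $ j $ k"
      by (rule age[OF s'])
    have "(wave X s, abs_L2 (\<lambda>x. V s x * exp (phase X s x))) \<in> quadratic_weyl_graph Q"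
      unfolding wave_def V_def by (rule quadratic_weyl_graph_state)
    then have "(wave X s, - abs_L2 (\<lambda>x. V s x * exp (phase X s x))) \<in> generator_graph T"
      using T unfolding is_heat_semigroup_def by blast
    moreover have "- abs_L2 (\<lambda>x. V s x * exp (phase X s x)) = abs_L2 (\<lambda>x. - V s x * exp (phase X s x))"
      using sq(2)[OF s'] by (simp add: uminus_L2.abs_eq L2_eq_def)
    ultimately show "(wave X s, abs_L2 (\<lambda>x. - V s x * exp (phase X s x))) \<in> generator_graph T" by simp
  qed
qed

lemma wave_exponent:
  assumes "heat_flow Q X" "\<And>s a. X s $ a \<in> \<real>" "s \<in> {0..t}"
  obtains K where "affine_gaussian_exponent (phase X s) (phase_grad X s) (\<epsilon> / 4) K (\<lambda>k j. Z s $ j $ k)"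
  using phase_affine_gaussian_exponent[OF assms(1,2)] assms(3) by metis

section \<open>Dependence of the packets on a real centre\<close>

lemma heat_flow_0: "heat_flow Q (\<lambda>s. 0)"
  by (simp add: heat_flow_def solves_def)

lemma Re_phase_shift:
  assumes "\<And>s a. X s $ a \<in> \<real>"
  shows "Re (phase X s x) = Re (phase (\<lambda>s. 0) s (x - (\<chi> j. Re (X s $ Inl j))))"
proof -
  have "shifted (\<lambda>s. 0) s z = cvec z" for z by (simp add: shifted_def cvec_def)
  then show ?thesis
    using Re_phase[of X s x] Re_phase[of "\<lambda>s. 0" s] shifted_real[of X s x] assms by simp
qed

lemma norm_wave_squared:
  assumes X: "heat_flow Q X" "\<And>s a. X s $ a \<in> \<real>" and s: "s \<in> {0..t}"
  shows "(norm (wave X s))\<^sup>2 = (LINT x|lborel. (exp (Re (phase X s x)))\<^sup>2)"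
proof -
  obtain K where age: "affine_gaussian_exponent (phase X s) (phase_grad X s) (\<epsilon> / 4) K (\<lambda>k j. Z s $ j $ k)"
    using wave_exponent[OF X s] .
  show ?thesis
    using norm_abs_L2[OF affine_gaussian_exponent.exp_sq_integrable[OF age]] by (simp add: wave_def)
qed

lemma phase_measurable:
  assumes s: "s \<in> {0..t}"
  shows "phase X s \<in> borel_measurable borel"
  using has_partials_continuous[OF phase_partials[OF s]] by (rule borel_measurable_continuous_onI)

lemma norm_wave:
  assumes X: "heat_flow Q X" "\<And>s a. X s $ a \<in> \<real>" and s: "s \<in> {0..t}"
  shows "norm (wave X s) = norm (wave (\<lambda>s. 0) s)"
proof -
  have [measurable]: "phase (\<lambda>s. 0) s \<in> borel_measurable borel"
    by (rule phase_measurable[OF s])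
  have "(norm (wave X s))\<^sup>2 = (norm (wave (\<lambda>s. 0) s))\<^sup>2"
    unfolding norm_wave_squared[OF X s] Re_phase_shift[of X s, OF X(2)]
    using norm_wave_squared[OF heat_flow_0 _ s]
      integral_lborel_translate[of "\<lambda>x. (exp (Re (phase (\<lambda>s. 0) s x)))\<^sup>2" "- (\<chi> j. Re (X s $ Inl j))"]
    by simp
  then show ?thesis by simp
qed

text \<open>The symbol of the linear operator on the packet at x is its value at the centre plus the
  symbol on the centred packet at x - y, and the squared modulus is a translate. Translating the
  integral therefore leaves only the value at the centre, weighted by the squared norm.\<close>

lemma linear_weyl_wave_pairing:
  assumes X: "heat_flow Q X" "\<And>s a. X s $ a \<in> \<real>" and s: "s \<in> {0..t}"
  shows "schwartz (\<lambda>x. cnj (exp (phase X s x)))"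
    and "linear_weyl X0 (L2_distr (wave X s)) (\<lambda>x. cnj (exp (phase X s x)))
      = (\<Sum>a\<in>UNIV. of_real (X0 $ a) * X s $ a) * of_real ((norm (wave (\<lambda>s. 0) s))\<^sup>2)
        + linear_weyl X0 (L2_distr (wave (\<lambda>s. 0) s)) (\<lambda>x. cnj (exp (phase (\<lambda>s. 0) s x)))"
proof -
  define P where "P X x = (\<Sum>a\<in>UNIV. of_real (X0 $ a) * phase_symbol (phase_grad X s) a x)" for X x
  define g where "g X x = (exp (Re (phase X s x)))\<^sup>2" for X x
  have sch: "schwartz (\<lambda>x. cnj (exp (phase X s x)))"
    and lin: "linear_weyl X0 (L2_distr (wave X s)) (\<lambda>x. cnj (exp (phase X s x)))
      = (LINT x|lborel. P X x * of_real (g X x))"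
    and int: "integrable lborel (\<lambda>x. P X x * of_real (g X x))" "integrable lborel (\<lambda>x. complex_of_real (g X x))"
    and meas: "P X \<in> borel_measurable borel"
    if X: "heat_flow Q X" "\<And>s a. X s $ a \<in> \<real>" for X
  proof -
    obtain K where age: "affine_gaussian_exponent (phase X s) (phase_grad X s) (\<epsilon> / 4) K (\<lambda>k j. Z s $ j $ k)"
      using wave_exponent[OF X s] .
    interpret affine_gaussian_exponent "phase X s" "phase_grad X s" "\<epsilon> / 4" K "\<lambda>k j. Z s $ j $ k" by (rule age)
    show sch: "schwartz (\<lambda>x. cnj (exp (phase X s x)))" by (rule exp_cnj_schwartz)
    then have t: "test_function (\<lambda>x. cnj (exp (phase X s x)))"
      using test_function_partial_deriv[of _ "[]"] by simp
    have P: "cpoly (P X)" unfolding P_def[abs_def] by (intro cpoly_intros cpoly_sum cpoly_phase_symbol)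
    then show "P X \<in> borel_measurable borel" by (intro borel_measurable_continuous_onI cpoly_continuous)
    have g: "exp (phase X s x) * cnj (exp (phase X s x)) = of_real (g X x)" for x
      unfolding g_def norm_exp_eq_Re[symmetric] by (rule complex_norm_square[symmetric])
    show "linear_weyl X0 (L2_distr (wave X s)) (\<lambda>x. cnj (exp (phase X s x)))
        = (LINT x|lborel. P X x * of_real (g X x))"
      unfolding wave_def linear_weyl_state[OF t] P_def mult.assoc g ..
    show "integrable lborel (\<lambda>x. P X x * of_real (g X x))"
      using poly_exp_test_integrable[OF P t] unfolding mult.assoc g .
    show "integrable lborel (\<lambda>x. complex_of_real (g X x))"
      using poly_exp_test_integrable[OF cpoly_const[of 1] t] unfolding mult.assoc g by simp
  qed
  show "schwartz (\<lambda>x. cnj (exp (phase X s x)))" by (rule sch[OF X])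
  define o0 :: "real \<Rightarrow> complex^('n + 'n)" where "o0 = (\<lambda>s. 0)"
  have o0: "heat_flow Q o0" "\<And>s a. o0 s $ a \<in> \<real>" unfolding o0_def by (rule heat_flow_0) simp
  define y where "y = (\<chi> j. Re (X s $ Inl j))"
  define c where "c = (\<Sum>a\<in>UNIV. of_real (X0 $ a) * X s $ a)"
  \<comment> \<open>Reality of the centre enters here: x - y is a real point, at which the centred
    packet can be evaluated.\<close>
  have Px: "P X x = c + P o0 (x - y)" for x
  proof -
    have "shifted X s x = shifted o0 s (x - y)"
      using shifted_real[of X s x] shifted_real[of o0 s "x - y"] X(2) o0(2)
      by (simp add: y_def o0_def zero_vec_def[symmetric])
    then show ?thesis unfolding P_def phase_symbol_eq c_def
      by (simp add: distrib_left sum.distrib o0_def)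
  qed
  have gx: "g X x = g o0 (x - y)" for x
    unfolding g_def y_def o0_def using Re_phase_shift[of X s x] X(2) by simp
  have m: "(\<lambda>x. (c + P o0 x) * of_real (g o0 x)) \<in> borel_measurable borel"
    using meas[OF o0] borel_measurable_integrable[OF int(2)[OF o0]]
    by (intro borel_measurable_times borel_measurable_add) auto
  have "(LINT x|lborel. P X x * of_real (g X x)) = (LINT x|lborel. (c + P o0 (- y + x)) * of_real (g o0 (- y + x)))"
    unfolding Px gx by (simp add: algebra_simps)
  also have "\<dots> = (LINT x|lborel. (c + P o0 x) * of_real (g o0 x))"
    by (rule integral_lborel_translate[OF m])
  also have "\<dots> = c * (LINT x|lborel. complex_of_real (g o0 x)) + (LINT x|lborel. P o0 x * of_real (g o0 x))"
    unfolding distrib_right using int[OF o0] by simp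
  also have "(LINT x|lborel. complex_of_real (g o0 x)) = of_real ((norm (wave o0 s))\<^sup>2)"
    unfolding norm_wave_squared[OF o0 s] g_def by (rule integral_complex_of_real)
  finally show "linear_weyl X0 (L2_distr (wave X s)) (\<lambda>x. cnj (exp (phase X s x)))
      = (\<Sum>a\<in>UNIV. of_real (X0 $ a) * X s $ a) * of_real ((norm (wave (\<lambda>s. 0) s))\<^sup>2)
        + linear_weyl X0 (L2_distr (wave (\<lambda>s. 0) s)) (\<lambda>x. cnj (exp (phase (\<lambda>s. 0) s x)))"
    using lin[OF X] lin[OF o0] by (simp add: c_def o0_def)
qed

lemma wave_nonzero:
  assumes X: "heat_flow Q X" "\<And>s a. X s $ a \<in> \<real>" and s: "s \<in> {0..t}"
  shows "wave X s \<noteq> 0"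
proof
  assume "wave X s = 0"
  obtain K where age: "affine_gaussian_exponent (phase X s) (phase_grad X s) (\<epsilon> / 4) K (\<lambda>k j. Z s $ j $ k)"
    using wave_exponent[OF X s] .
  have "integrable lborel (\<lambda>x. (norm (exp (phase X s x)))\<^sup>2)"
    using affine_gaussian_exponent.exp_sq_integrable[OF age] by (simp add: sq_integrable_def)
  moreover have "(LINT x|lborel. (norm (exp (phase X s x)))\<^sup>2) = 0"
    using norm_wave_squared[OF X s] \<open>wave X s = 0\<close> by simp
  ultimately have "AE x in lborel. (norm (exp (phase X s x)))\<^sup>2 = 0"
    by (subst (asm) integral_nonneg_eq_0_iff_AE) auto
  then have "AE x::real^'n in lborel. False" by simp
  then show False by (simp add: eventually_False ae_filter_eq_bot_iff)
qed

end

section \<open>From wave packets to the singular space\<close>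

lemma inner_L2_abs:
  assumes "sq_integrable f"
  shows "inner v (abs_L2 f) = Re (L2_distr v (\<lambda>x. cnj (f x)))"
proof -
  have "L2_eq (rep_L2 v) (rep_L2 v)" by (rule Quotient3_rep_reflp[OF Quotient3_L2])
  moreover have "abs_L2 (rep_L2 v) = v" by (rule Quotient3_abs_rep[OF Quotient3_L2])
  ultimately show ?thesis
    using inner_L2.abs_eq[of "rep_L2 v" f] assms by (simp add: L2_eq_def L2_distr_def)
qed

text \<open>An upper bound along the whole line spanned by Y is what forces the inner product with Y
  to vanish.\<close>

lemma singular_space_scaleR:
  assumes "Y \<in> singular_space Q" shows "r *\<^sub>R Y \<in> singular_space Q"
proof -
  have l: "A *v (r *\<^sub>R x) = r *\<^sub>R (A *v x)" for A :: "real^'m^'k" and x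
    by (rule linear_cmul[OF matrix_vector_mul_linear])
  have "((*v) A ^^ j) (r *\<^sub>R Y) = r *\<^sub>R ((*v) A ^^ j) Y" for j and A :: "real^('a + 'a)^('a + 'a)"
    by (induction j) (simp_all add: l)
  then show ?thesis using assms by (simp add: singular_space_def l)
qed

text \<open>Once Z is known, d is an antiderivative of a continuous function on [0, t], and
  \<epsilon> is the uniform lower bound for Im Z on that interval.\<close>

lemma gaussian_wave_exists:
  assumes q: "is_quadratic_form_matrix Q q" and nonneg: "\<And>X. Re (q X) \<ge> 0" and t: "t > 0"
  obtains \<epsilon> Z Z' d where "gaussian_wave Q t \<epsilon> Z Z' d"
proof (rule riccati_solution[OF q nonneg])
  fix Z Z' :: "real \<Rightarrow> complex^'a^'a"
  assume Z: "\<And>s j k. 0 \<le> s \<Longrightarrow> ((\<lambda>s. Z s $ j $ k) has_vector_derivative Z' s $ j $ k) (at s)"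
    and Z_sym: "\<And>s j k. 0 \<le> s \<Longrightarrow> Z s $ j $ k = Z s $ k $ j"
    and riccati: "\<And>s w. 0 \<le> s \<Longrightarrow>
      (\<Sum>j\<in>UNIV. w $ j * (Z' s *v w) $ j) = 2 * \<i> * cdot (graph_vec (Z s) w) (Q *v graph_vec (Z s) w)"
    and pos: "\<And>t. 0 \<le> t \<Longrightarrow> \<exists>\<epsilon>>0. \<forall>s\<in>{0..t}. \<forall>x::real^'a.
        \<epsilon> * (norm x)\<^sup>2 \<le> Im (\<Sum>j\<in>UNIV. cvec x $ j * (Z s *v cvec x) $ j)"
  obtain \<epsilon> where \<epsilon>: "\<epsilon> > 0" and \<epsilon>_bound: "\<forall>s\<in>{0..t}. \<forall>x::real^'a.
        \<epsilon> * (norm x)\<^sup>2 \<le> Im (\<Sum>j\<in>UNIV. cvec x $ j * (Z s *v cvec x) $ j)"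
    using pos[OF less_imp_le[OF t]] by (elim exE conjE)
  have Zt: "((\<lambda>s. Z s $ j $ k) has_vector_derivative Z' s $ j $ k) (at s within {0..t})" if "s \<in> {0..t}" for s j k
    using that by (intro has_vector_derivative_at_within[OF Z]) simp
  have "continuous_on {0..t} (\<lambda>s. Z s $ j $ k)" for j k
    unfolding continuous_on_eq_continuous_within
    using has_vector_derivative_continuous[OF Zt] by blast
  then have "continuous_on {0..t} (\<lambda>s. - trace_correction Q (Z s))"
    by (intro continuous_on_minus continuous_on_trace_correction)
  then obtain d where d: "\<And>s. s \<in> {0..t} \<Longrightarrow>
      (d has_vector_derivative - trace_correction Q (Z s)) (at s within {0..t})"
    using antiderivative_continuous by blast
  show thesis
  proof (rule that[of \<epsilon> Z Z' d])
    show "gaussian_wave Q t \<epsilon> Z Z' d"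
    proof
      show "transpose Q = Q" using q by (simp add: is_quadratic_form_matrix_def)
      show "0 < t" "0 < \<epsilon>" by fact+
      fix s assume s: "s \<in> {0..t}"
      then have s0: "0 \<le> s" by simp
      show "((\<lambda>s. Z s $ j $ k) has_vector_derivative Z' s $ j $ k) (at s within {0..t})" for j k
        by (rule Zt[OF s])
      show "Z s $ j $ k = Z s $ k $ j" for j k by (rule Z_sym[OF s0])
      show "(\<Sum>j\<in>UNIV. w $ j * (Z' s *v w) $ j) = 2 * \<i> * cdot (graph_vec (Z s) w) (Q *v graph_vec (Z s) w)" for w
        by (rule riccati[OF s0])
      show "\<epsilon> * (norm x)\<^sup>2 \<le> Im (\<Sum>j\<in>UNIV. cvec x $ j * (Z s *v cvec x) $ j)" for x
        using bspec[OF \<epsilon>_bound s] by (rule spec)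
      show "(d has_vector_derivative - trace_correction Q (Z s)) (at s within {0..t})" by (rule d[OF s])
    qed
  qed
qed

theorem theorem2p8:
  fixes q :: "real^('n::finite + 'n) \<Rightarrow> complex"
    and Q :: "complex^('n + 'n)^('n + 'n)"
    and T :: "real \<Rightarrow> (real^'n) L2 \<Rightarrow> (real^'n) L2"
    and t :: real
    and X0 :: "real^('n + 'n)"
  assumes "is_quadratic_form_matrix Q q"
    and "\<And>X. Re (q X) \<ge> 0"
    and "is_heat_semigroup Q T"
    and "t > 0"
    and "bounded_on_L2 (\<lambda>u. linear_weyl X0 (L2_distr (T t u)))"
  shows "X0 \<in> orthogonal_comp (singular_space Q)"
proof -
  obtain \<epsilon> Z Z' d where "gaussian_wave Q t \<epsilon> Z Z' d"
    using gaussian_wave_exists[OF assms(1,2,4)] .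
  then interpret gaussian_wave Q t \<epsilon> Z Z' d .
  have t: "0 \<in> {0..t}" "t \<in> {0..t}" using assms(4) by auto
  obtain C where C: "\<And>u. \<exists>v. distr_eq (linear_weyl X0 (L2_distr (T t u))) (L2_distr v) \<and> norm v \<le> C * norm u"
    using assms(5) unfolding bounded_on_L2_def by blast
  define n where "n s = norm (wave (\<lambda>s. 0) s)" for s
  have n: "n t > 0" using wave_nonzero[OF heat_flow_0 _ t(2)] by (simp add: n_def)
  \<comment> \<open>The contribution of the packet centred at the origin, the same for all
    Y.\<close>
  define k where "k = Re (linear_weyl X0 (L2_distr (wave (\<lambda>s. 0) t)) (\<lambda>x. cnj (exp (phase (\<lambda>s. 0) t x))))"
  have bound: "(X0 \<bullet> Y) * (n t)\<^sup>2 \<le> C * n 0 * n t - k" if Y: "Y \<in> singular_space Q" for Y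
  proof -
    obtain X where X: "heat_flow Q X" "\<And>s a. X s $ a \<in> \<real>" and Xt: "\<And>a. X t $ a = of_real (Y $ a)"
      using singular_space_heat_flow[OF Y, of t] by metis
    \<comment> \<open>The hypothesis is applied to the packet at time 0. Its norm is that of the
      centred packet because the flow through Y is real at time 0 too.\<close>
    obtain v where v: "distr_eq (linear_weyl X0 (L2_distr (wave X t))) (L2_distr v)" "norm v \<le> C * n 0"
      using C[of "wave X 0"] unfolding heat_semigroup_wave[OF assms(3) X] norm_wave[OF X t(1)] n_def by blast
    obtain K where age: "affine_gaussian_exponent (phase X t) (phase_grad X t) (\<epsilon> / 4) K (\<lambda>k j. Z t $ j $ k)"
      using wave_exponent[OF X t(2)] .
    have c: "(\<Sum>a\<in>UNIV. of_real (X0 $ a) * X t $ a) = complex_of_real (X0 \<bullet> Y)"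
      by (simp add: Xt inner_vec_def)
    have "L2_distr v (\<lambda>x. cnj (exp (phase X t x))) = linear_weyl X0 (L2_distr (wave X t)) (\<lambda>x. cnj (exp (phase X t x)))"
      using v(1) linear_weyl_wave_pairing(1)[OF X t(2)] unfolding distr_eq_def by simp
    also have "Re \<dots> = (X0 \<bullet> Y) * (n t)\<^sup>2 + k"
      unfolding linear_weyl_wave_pairing(2)[OF X t(2)] c by (simp add: n_def k_def)
    finally have "(X0 \<bullet> Y) * (n t)\<^sup>2 + k = inner v (wave X t)"
      unfolding wave_def inner_L2_abs[OF affine_gaussian_exponent.exp_sq_integrable[OF age]] by simp
    also have "\<dots> \<le> norm v * norm (wave X t)" by (rule norm_cauchy_schwarz)
    also have "\<dots> \<le> C * n 0 * n t"
      unfolding norm_wave[OF X t(2)] n_def[symmetric] using v(2) n by (intro mult_right_mono) auto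
    finally show ?thesis by simp
  qed
  have "X0 \<bullet> Y = 0" if Y: "Y \<in> singular_space Q" for Y
  proof (rule ccontr)
    assume *: "X0 \<bullet> Y \<noteq> 0"
    define b where "b = C * n 0 * n t - k"
    define m where "m = (X0 \<bullet> Y) * (n t)\<^sup>2"
    have "m \<noteq> 0" using * n by (simp add: m_def)
    \<comment> \<open>The multiple (b + 1)/m of Y is chosen so that the left side of
      \<open>bound\<close> becomes b + 1.\<close>
    moreover have "(b + 1) / m * m \<le> b"
      using bound[OF singular_space_scaleR[OF Y]] unfolding b_def m_def inner_scaleR_right mult.assoc .
    ultimately show False by simp
  qed
  then show ?thesis by (auto simp: orthogonal_comp_def orthogonal_def inner_commute)
qed

end
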